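(* Let $q,t \in (-1,1)$. Fix positive integers $k, N$, let $r_1,\ldots,r_k$ be positive integers such that $\sum_i r_i = N$, and set $s_i = \sum_{j=1}^i r_j$ with the convention $s_0=0$. Let $L_1 > \cdots > L_k$ be integers and let $\lambda^{(i)} \in \mathrm{Sig}_{r_i}$ ($1\le i\le k$) be any signatures, and define the signature $$\lambda(D) = (L_1D + \lambda^{(1)}_1,\ldots,L_1D+\lambda^{(1)}_{r_1},\ldots, L_kD + \lambda^{(k)}_1,\ldots,L_kD + \lambda^{(k)}_{r_k}) \in \mathrm{Sig}_N$$ for each $D \in \mathbb{N}$ large enough so that this is a valid signature. Then $$\frac{P_{\lambda(D)}(x_1,\ldots,x_N;q,t)}{\prod_{i=1}^{k} (x_{s_{i-1}+1} \cdots x_{s_{i}})^{L_i D}} \longrightarrow \prod_{i=1}^{k} P_{\lambda^{(i)}}(x_{s_{i-1}+1},\ldots,x_{s_i};q,t)\ \prod_{i=1}^{k-1} \Pi_{(q,t)}(x_{s_{i-1}+1}^{-1},\ldots,x_{s_i}^{-1};\, x_{s_i+1},\ldots,x_{N})$$ as $D \to \infty$, in the sense that the coefficient of each Laurent monomial $x_1^{d_1} \cdots x_N^{d_N}$ on the left hand side converges to the corresponding coefficient on the right hand side.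
   Context: Signatures. $\mathrm{Sig}_n$ is the set of weakly decreasing $n$-tuples of integers; $()$ is the empty signature; $|\lambda|=\sum_i\lambda_i$. For $\lambda\in\mathrm{Sig}_n,\mu\in\mathrm{Sig}_{n-1}$, $\mu\prec_P\lambda$ means $\lambda_i\ge\mu_i\ge\lambda_{i+1}$ for $1\le i\le n-1$. Macdonald polynomials. Write $(a;q)_\infty=\prod_{i\ge0}(1-aq^i)$ and $f(u)=(tu;q)_\infty/(qu;q)_\infty$ (with $0^0=1$). For $\mu\prec_P\lambda$ with $\lambda\in\mathrm{Sig}_n$, $\mu\in\mathrm{Sig}_{n-1}$, let $$\psi_{\lambda/\mu}=\prod_{1\le i\le j\le n-1}\frac{f(t^{j-i}q^{\mu_i-\mu_j})\,f(t^{j-i}q^{\lambda_i-\lambda_{j+1}})}{f(t^{j-i}q^{\lambda_i-\mu_j})\,f(t^{j-i}q^{\mu_i-\lambda_{j+1}})}.$$ For $\lambda\in\mathrm{Sig}_n$ (possibly with negative parts) the Macdonald (Laurent) polynomial is $$P_\lambda(x_1,\ldots,x_n;q,t)=\sum_{()=\lambda^{(0)}\prec_P\lambda^{(1)}\prec_P\cdots\prec_P\lambda^{(n)}=\lambda}\ \prod_{i=1}^n\psi_{\lambda^{(i)}/\lambda^{(i-1)}}\,x_i^{|\lambda^{(i)}|-|\lambda^{(i-1)}|},\qquad \lambda^{(i)}\in\mathrm{Sig}_i;$$ it is symmetric in $x_1,\ldots,x_n$ and for $\lambda\in\mathrm{Sig}_n^+$ (all parts $\geq 0$) is the usual monic Macdonald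 symmetric polynomial. Cauchy kernel: $\Pi_{(q,t)}(x_1,\ldots,x_a;y_1,\ldots,y_b)=\prod_{i,j}\frac{(tx_iy_j;q)_\infty}{(x_iy_j;q)_\infty}$, understood as a formal power series in the products $x_iy_j$. Thus on the right hand side of the claim the kernels are expanded as formal power series in the ratios $x_j/x_i$ with $s_{\ell-1}<i\le s_\ell<j$. *)

theory Defs
  imports
    "HOL-Analysis.Analysis"
    "HOL-Computational_Algebra.Formal_Power_Series"
    "HOL-Library.Poly_Mapping"
begin

text \<open>
  All indices start at 0: the \<open>i\<close>-th part of a signature \<open>lam\<close> is \<open>lam ! (i - 1)\<close>, and the
  variables \<open>x\<^sub>1, \<dots>, x\<^sub>N\<close> are numbered \<open>0, \<dots>, N - 1\<close>.
\<close>


section \<open>Signatures\<close>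

definition Sig :: "nat \<Rightarrow> int list set" where
  "Sig n = {lam. length lam = n \<and> sorted_wrt (\<ge>) lam}"

definition interlace :: "int list \<Rightarrow> int list \<Rightarrow> bool" (infix "\<prec>\<^sub>P" 50) where
  "\<mu> \<prec>\<^sub>P lam \<longleftrightarrow> length lam = Suc (length \<mu>) \<and>
     (\<forall>i<length \<mu>. lam ! i \<ge> \<mu> ! i \<and> \<mu> ! i \<ge> lam ! Suc i)"

text \<open>The chains \<open>() \<prec>\<^sub>P \<dots> \<prec>\<^sub>P lam\<close> of signatures of lengths \<open>0, \<dots>, n\<close>, as lists of length \<open>n + 1\<close>.
  There are none if \<open>lam\<close> is not a signature.\<close>

definition chains :: "int list \<Rightarrow> int list list set" where
  "chains lam = {\<Lambda>. length \<Lambda> = Suc (length lam) \<and> \<Lambda> ! 0 = [] \<and> \<Lambda> ! length lam = lam \<and>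
     (\<forall>i\<le>length lam. \<Lambda> ! i \<in> Sig i) \<and> (\<forall>i<length lam. \<Lambda> ! i \<prec>\<^sub>P \<Lambda> ! Suc i)}"

lemma finite_chains: "finite (chains lam)"
proof (cases "lam = []")
  case True
  then have "chains lam \<subseteq> {[[]]}"
    by (auto simp: chains_def length_Suc_conv)
  then show ?thesis
    using finite_subset by blast
next
  case False
  define n where "n = length lam"
  define B where "B = {Min (set lam)..Max (set lam)}"
  define S where "S = {\<mu>. set \<mu> \<subseteq> B \<and> length \<mu> \<le> n}"
  have "finite S"
    unfolding S_def B_def by (rule finite_lists_length_le) simp
  moreover have "chains lam \<subseteq> {\<Lambda>. set \<Lambda> \<subseteq> S \<and> length \<Lambda> = Suc n}"
  proof
    fix \<Lambda> assume \<Lambda>: "\<Lambda> \<in> chains lam"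
    then have len: "length \<Lambda> = Suc n" and last: "\<Lambda> ! n = lam"
      and sig: "\<And>i. i \<le> n \<Longrightarrow> length (\<Lambda> ! i) = i"
      and il: "\<And>i. i < n \<Longrightarrow> \<Lambda> ! i \<prec>\<^sub>P \<Lambda> ! Suc i"
      by (auto simp: chains_def n_def Sig_def)
    have *: "set (\<Lambda> ! i) \<subseteq> B" if "i \<le> n" for i
      using that
    proof (induction rule: inc_induct)
      case base
      then show ?case
        by (auto simp: last B_def)
    next
      case (step i)
      show ?case
      proof
        fix x assume "x \<in> set (\<Lambda> ! i)"
        then obtain j where j: "j < i" "x = \<Lambda> ! i ! j"
          using sig[of i] step.hyps by (auto simp: in_set_conv_nth)
        have "\<Lambda> ! Suc i ! j \<in> B" "\<Lambda> ! Suc i ! Suc j \<in> B"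
          using step sig[of "Suc i"] j by (auto intro!: subsetD[OF step.IH] nth_mem)
        moreover have "\<Lambda> ! Suc i ! Suc j \<le> x" "x \<le> \<Lambda> ! Suc i ! j"
          using il[of i] step.hyps j sig[of i] by (auto simp: interlace_def)
        ultimately show "x \<in> B"
          by (auto simp: B_def)
      qed
    qed
    show "\<Lambda> \<in> {\<Lambda>. set \<Lambda> \<subseteq> S \<and> length \<Lambda> = Suc n}"
    proof -
      have "\<Lambda> ! i \<in> S" if "i \<le> n" for i
        using *[OF that] sig[OF that] that by (simp add: S_def)
      then show ?thesis
        using len by (auto simp: in_set_conv_nth less_Suc_eq_le)
    qed
  qed
  ultimately show ?thesis
    using finite_lists_length_eq[of S "Suc n"] finite_subset by blast
qed


section \<open>Macdonald Laurent polynomials\<close>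

definition qpoch :: "real \<Rightarrow> real \<Rightarrow> real" where
  "qpoch a q = prodinf (\<lambda>i. 1 - a * q ^ i)"

definition mac_f :: "real \<Rightarrow> real \<Rightarrow> real \<Rightarrow> real" where
  "mac_f q t u = qpoch (t * u) q / qpoch (q * u) q"

definition mac_psi :: "real \<Rightarrow> real \<Rightarrow> int list \<Rightarrow> int list \<Rightarrow> real" where
  "mac_psi q t lam \<mu> =
     (\<Prod>(i, j) \<in> {(i, j). i \<le> j \<and> j < length \<mu>}.
        (mac_f q t (t ^ (j - i) * q powi (\<mu> ! i - \<mu> ! j)) *
         mac_f q t (t ^ (j - i) * q powi (lam ! i - lam ! Suc j))) /
        (mac_f q t (t ^ (j - i) * q powi (lam ! i - \<mu> ! j)) *
         mac_f q t (t ^ (j - i) * q powi (\<mu> ! i - lam ! Suc j))))"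

text \<open>Laurent monomials are given by finitely supported exponent vectors, written additively;
  Laurent polynomials form the corresponding group ring, with the convolution product of
  \<^theory>\<open>HOL-Library.Poly_Mapping\<close>.\<close>

type_synonym monomial = "nat \<Rightarrow>\<^sub>0 int"
type_synonym laurent_poly = "monomial \<Rightarrow>\<^sub>0 real"

definition const :: "real \<Rightarrow> laurent_poly" where
  "const c = Poly_Mapping.single 0 c"

definition x_pow :: "nat \<Rightarrow> int \<Rightarrow> laurent_poly" where
  "x_pow i e = Poly_Mapping.single (Poly_Mapping.single i e) 1"

text \<open>\<open>vs\<close> lists the numbers of the variables in which the polynomial is taken.\<close>

definition macdonald_P :: "real \<Rightarrow> real \<Rightarrow> int list \<Rightarrow> nat list \<Rightarrow> laurent_poly" where
  "macdonald_P q t lam vs =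
     (\<Sum>\<Lambda>\<in>chains lam. \<Prod>i<length lam.
        const (mac_psi q t (\<Lambda> ! Suc i) (\<Lambda> ! i)) *
        x_pow (vs ! i) (sum_list (\<Lambda> ! Suc i) - sum_list (\<Lambda> ! i)))"


section \<open>Formal Laurent series and the Cauchy kernel\<close>

text \<open>A formal Laurent series is its coefficient function. Products of such series only make sense
  when every coefficient is a finite sum. This holds wherever the products are used below: if
  every series involved is a Laurent polynomial or a series in ratios \<open>x\<^sub>j / x\<^sub>i\<close> with
  \<open>i < j\<close>, then a given monomial arises in only finitely many ways.\<close>

type_synonym laurent_series = "monomial \<Rightarrow> real"

definition series_mult :: "laurent_series \<Rightarrow> laurent_series \<Rightarrow> laurent_series" where
  "series_mult F G d = (\<Sum>(a, b) \<in> {(a, b). a + b = d \<and> F a \<noteq> 0 \<and> G b \<noteq> 0}. F a * G b)"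

definition series_prod :: "'i set \<Rightarrow> ('i \<Rightarrow> laurent_series) \<Rightarrow> laurent_series" where
  "series_prod I F d =
     (\<Sum>a \<in> {a \<in> I \<rightarrow>\<^sub>E UNIV. (\<Sum>i\<in>I. a i) = d \<and> (\<forall>i\<in>I. F i (a i) \<noteq> 0)}. \<Prod>i\<in>I. F i (a i))"

definition fps_at_monomial :: "real fps \<Rightarrow> monomial \<Rightarrow> laurent_series" where
  "fps_at_monomial g e d = (\<Sum>n \<in> {n. (\<Sum>_<n. e) = d}. fps_nth g n)"
  \<comment> \<open>Substitution of the monomial with exponent vector \<open>e\<close> into \<open>g\<close>. For \<open>e \<noteq> 0\<close> there is
    at most one \<open>n\<close> with \<open>n e = d\<close>.\<close>

text \<open>\<open>(a u; q)\<^sub>\<infinity>\<close> as a formal power series in \<open>u\<close>: the infinite product converges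
  coefficientwise for \<open>\<bar>q\<bar> < 1\<close>, but not in the \<open>u\<close>-adic topology, which is the one of
  \<^typ>\<open>real fps\<close>.\<close>

definition qpoch_fps :: "real \<Rightarrow> real \<Rightarrow> real fps" where
  "qpoch_fps a q =
     Abs_fps (\<lambda>n. lim (\<lambda>m. fps_nth (\<Prod>i<m. 1 - fps_const (a * q ^ i) * fps_X) n))"

lemma convergent_qpoch_fps_coeff:
  fixes a q :: real
  assumes "\<bar>q\<bar> < 1"
  shows "convergent (\<lambda>m. fps_nth (\<Prod>i<m. 1 - fps_const (a * q ^ i) * fps_X) n)"
proof (induction n)
  case 0
  have "fps_nth (\<Prod>i<m. 1 - fps_const (a * q ^ i) * fps_X) 0 = 1" for m
    by (induction m) auto
  then show ?case
    by (simp add: convergent_const)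
next
  case (Suc n)
  define c where "c = (\<lambda>n m. fps_nth (\<Prod>i<m. 1 - fps_const (a * q ^ i) * fps_X) n)"
  have step: "c (Suc n) (Suc m) - c (Suc n) m = - (a * q ^ m * c n m)" for m
  proof -
    have "P * (1 - fps_const b * fps_X) = P - fps_const b * (P * fps_X)" for P and b :: real
      by (simp add: algebra_simps)
    then show ?thesis
      by (simp add: c_def)
  qed
  have "Bseq (c n)"
    using Suc.IH by (auto simp: c_def intro: convergent_imp_Bseq)
  then obtain K where K: "\<And>m. \<bar>c n m\<bar> \<le> K"
    by (auto simp: Bseq_def)
  have "summable (\<lambda>m. c (Suc n) (Suc m) - c (Suc n) m)"
  proof (rule summable_comparison_test')
    show "summable (\<lambda>m. \<bar>a\<bar> * K * \<bar>q\<bar> ^ m)"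
      using assms by (intro summable_mult summable_geometric) auto
    show "norm (c (Suc n) (Suc m) - c (Suc n) m) \<le> \<bar>a\<bar> * K * \<bar>q\<bar> ^ m" for m
      using mult_left_mono[OF K[of m], of "\<bar>a\<bar> * \<bar>q\<bar> ^ m"]
      by (simp add: step abs_mult power_abs mult_ac)
  qed
  then have "convergent (\<lambda>m. \<Sum>i<m. c (Suc n) (Suc i) - c (Suc n) i)"
    by (simp add: summable_iff_convergent)
  then have "convergent (\<lambda>m. c (Suc n) m - c (Suc n) 0)"
    by (simp only: sum_lessThan_telescope)
  then have "convergent (\<lambda>m. (c (Suc n) m - c (Suc n) 0) + c (Suc n) 0)"
    by (intro convergent_add convergent_const)
  then show ?case
    by (simp add: c_def)
qed

text \<open>\<open>xs\<close> and \<open>ys\<close> are the exponent vectors of the monomials substituted for the two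
  sets of arguments of the kernel.\<close>

definition cauchy_kernel :: "real \<Rightarrow> real \<Rightarrow> monomial list \<Rightarrow> monomial list \<Rightarrow> laurent_series" where
  "cauchy_kernel q t xs ys =
     series_prod ({..<length xs} \<times> {..<length ys})
       (\<lambda>(i, j). fps_at_monomial (qpoch_fps t q / qpoch_fps 1 q) (xs ! i + ys ! j))"

end

theory Submission
  imports Defs "Jordan_Normal_Form.Determinant"
begin

text \<open>
  Let \<open>f(u) = (tu; q)\<^sub>\<infinity> / (qu; q)\<^sub>\<infinity>\<close>. The branching coefficient \<open>\<psi>\<close> is a product of
  values \<open>f(x / y)\<close> and their inverses, where \<open>x\<close> and \<open>y\<close> belong to two parts of the signatures: the variable of
  a part is the corresponding power of \<open>q\<close>, times a power of \<open>t\<close> that depends on the position.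
  If the blocks of a signature move apart, the ratios between different blocks tend to \<open>0\<close>,
  where \<open>f\<close> is \<open>1\<close>.

  Peel off the variables one by one, beginning with the last. Once the exponents of the monomial are
  fixed, the sum of each row of a contributing chain is prescribed, and its entries are bounded above by
  the entries of the next row. Relative to the shifts \<open>L\<^sub>i D\<close> only finitely many rows remain, and for
  large \<open>D\<close> they no longer depend on \<open>D\<close>. In the limit the blocks decouple. The block that contains the
  current variable follows the usual branching rule. In each earlier block a signature shrinks by a horizontal
  strip, with a weight that arises from \<open>\<psi>\<close> when the last part of the larger signature is sent to
  \<open>-\<infinity>\<close>. Both weights are values of \<open>skew_coeff\<close>; the resulting recursion for the limits is
  \<open>tendsto_limit_coeff\<close>.

  The series on the right satisfies the same recursion (\<open>eventually_kernel_expansion\<close>) because of a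
  Pieri rule (\<open>g_pieri\<close>): multiplication by the coefficients \<open>g\<^sub>M\<close> of
  \<open>\<Prod>\<^sub>i (t y/x\<^sub>i; q)\<^sub>\<infinity> / (y/x\<^sub>i; q)\<^sub>\<infinity>\<close> is given by exactly these weights of horizontal strips. Since
  \<open>g(qy) e(-ty) = g(y) e(-y)\<close>, where \<open>e(y) = \<Prod>\<^sub>i (1 + y/x\<^sub>i)\<close>, the \<open>g\<^sub>M\<close> are determined by the elementary
  symmetric polynomials, and two facts suffice. One is an explicit formula for multiplication by
  \<open>e\<^sub>r\<close> (\<open>e_pieri\<close>), which follows by induction on the number of variables from an identity
  that exchanges lowering and branching (\<open>e_branching_polynomial\<close>). The other one is that the weights
  of horizontal strips satisfy the recursion of the \<open>g\<^sub>M\<close> (\<open>lowering_recursion\<close>).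

  Both are identities between sums over sets of positions. For generic \<open>q\<close> and \<open>t\<close> they are, up to
  common factors, expansions of one determinant, with entries
  \<open>1 / (x\<^sub>i - z\<^sub>i y\<^sub>j) + w / (x\<^sub>i - s z\<^sub>i y\<^sub>j)\<close> and \<open>s = t/q\<close>: each choice of summands in the rows, or in the columns,
  leaves a Cauchy determinant. The first identity compares the expansion along rows with that along
  columns, the second one the values at \<open>w = -1\<close> and \<open>w = -s\<close>. All \<open>q, t \<in> (-1, 1)\<close>, including \<open>0\<close>, are
  then reached by continuity.

  The kernels themselves can be replaced by Laurent polynomials: in the grading where \<open>x\<^sub>j\<close> has weight
  \<open>j\<close> all ratios \<open>x\<^sub>j / x\<^sub>i\<close> with \<open>i < j\<close> have positive weight, so each single coefficient only sees a
  truncation (\<open>eventually_series_mult_eq\<close>).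
\<close>

section \<open>The Cauchy determinant and its subset expansions\<close>

text \<open>
  Determinants are used as sums over permutations of functions on pairs of indices, a form in which
  the products can be expanded over subsets of the rows.
\<close>

definition leibniz :: "nat \<Rightarrow> (nat \<Rightarrow> nat \<Rightarrow> real) \<Rightarrow> real" where
  "leibniz n a = (\<Sum>p | p permutes {..<n}. of_int (sign p) * (\<Prod>i<n. a i (p i)))"

lemma leibniz_cong:
  assumes "\<And>i j. i < n \<Longrightarrow> j < n \<Longrightarrow> a i j = b i j"
  shows "leibniz n a = leibniz n b"
proof -
  have "(\<Prod>i<n. a i (p i)) = (\<Prod>i<n. b i (p i))" if "p permutes {..<n}" for p
  proof (rule prod.cong[OF refl])
    fix i assume "i \<in> {..<n}"
    then show "a i (p i) = b i (p i)"
      using permutes_in_image[OF that, of i] by (simp add: assms)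
  qed
  then show ?thesis
    unfolding leibniz_def by (intro sum.cong refl) simp
qed

lemma leibniz_eq_det: "leibniz n a = Determinant.det (mat n n (\<lambda>(i, j). a i j))"
proof -
  have "leibniz n a = leibniz n (\<lambda>i j. mat n n (\<lambda>(i, j). a i j) $$ (i, j))"
    by (rule leibniz_cong) simp
  then show ?thesis
    by (simp add: leibniz_def det_def'[of _ n] atLeast0LessThan)
qed

lemma leibniz_scale: "leibniz n (\<lambda>i j. \<alpha> i * \<beta> j * a i j) = (\<Prod>i<n. \<alpha> i) * (\<Prod>j<n. \<beta> j) * leibniz n a"
proof -
  have *: "of_int (sign p) * (\<Prod>i<n. \<alpha> i * \<beta> (p i) * a i (p i)) =
      (\<Prod>i<n. \<alpha> i) * (\<Prod>j<n. \<beta> j) * (of_int (sign p) * (\<Prod>i<n. a i (p i)))"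
    if "p permutes {..<n}" for p
  proof -
    have "(\<Prod>i<n. \<beta> (p i)) = (\<Prod>j<n. \<beta> j)"
      using prod.permute[OF that, of \<beta>] unfolding o_def by (rule sym)
    then show ?thesis
      unfolding prod.distrib by (simp only: mult_ac)
  qed
  show ?thesis
    unfolding leibniz_def sum_distrib_left by (rule sum.cong) (simp_all only: mem_Collect_eq *)
qed

lemma leibniz_transpose: "leibniz n (\<lambda>i j. a j i) = leibniz n a"
proof -
  have "mat n n (\<lambda>(i, j). a j i) = transpose_mat (mat n n (\<lambda>(i, j). a i j))"
    by (intro eq_matI) auto
  then show ?thesis
    unfolding leibniz_eq_det by (simp only: det_transpose[of _ n] mat_carrier)
qed

text \<open>
  Subtracting multiples of the last row from the others clears the last column.
\<close>

lemma leibniz_Suc_eliminate: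
  assumes "a n n \<noteq> 0"
  shows "leibniz (Suc n) a = a n n * leibniz n (\<lambda>i j. a i j - a i n * a n j / a n n)"
proof -
  define A where "A = mat (Suc n) (Suc n) (\<lambda>(i, j). a i j)"
  \<comment> \<open>\<open>U\<close> performs the row operations.\<close>
  define U where "U = mat (Suc n) (Suc n) (\<lambda>(i, k). if i = k then 1 else if k = n then - (a i n / a n n) else 0)"
  define b where "b = (\<lambda>i j. a i j - a i n * a n j / a n n)"
  have cU: "U \<in> carrier_mat (Suc n) (Suc n)" and cA: "A \<in> carrier_mat (Suc n) (Suc n)"
    by (auto simp: U_def A_def)
  have "upper_triangular U"
    by (auto simp: U_def upper_triangular_def)
  then have "Determinant.det U = prod_list (diag_mat U)"
    using cU by (rule det_upper_triangular)
  also have "diag_mat U = replicate (Suc n) 1"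
    by (intro nth_equalityI) (auto simp: diag_mat_def U_def nth_append simp del: upt_Suc replicate_Suc)
  finally have detU: "Determinant.det U = 1"
    by (simp add: prod_list_replicate)
  have "U * A = four_block_mat (mat n n (\<lambda>(i, j). b i j)) (0\<^sub>m n 1) (mat 1 n (\<lambda>(i, j). a n j)) (mat 1 1 (\<lambda>_. a n n))"
    (is "_ = ?B")
  proof (rule eq_matI)
    fix i j assume "i < dim_row ?B" "j < dim_col ?B"
    then have ij: "i < Suc n" "j < Suc n" by auto
    have "(U * A) $$ (i, j) = (\<Sum>k<Suc n. U $$ (i, k) * A $$ (k, j))"
      using ij cU cA by (simp add: times_mat_def scalar_prod_def atLeast0LessThan del: sum.lessThan_Suc)
    also have "\<dots> = (\<Sum>k<Suc n. (if k = i then a i j else 0) + (if k = n \<and> i \<noteq> n then - (a i n / a n n) * a n j else 0))"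
      using ij by (intro sum.cong) (auto simp: U_def A_def)
    also have "\<dots> = a i j + (if i \<noteq> n then - (a i n / a n n) * a n j else 0)"
      using ij by (simp add: sum.distrib)
    also have "\<dots> = ?B $$ (i, j)"
      using ij assms by (auto simp: b_def less_Suc_eq)
    finally show "(U * A) $$ (i, j) = ?B $$ (i, j)" .
  qed (auto simp: U_def A_def)
  then have "Determinant.det (U * A) = Determinant.det (mat n n (\<lambda>(i, j). b i j)) * a n n"
    by (simp add: det_four_block_mat_upper_right_zero_col[of _ n] det_single)
  then show ?thesis
    using det_mult[OF cU cA] detU unfolding leibniz_eq_det A_def b_def by simp
qed

text \<open>
  The rows are given by points \<open>(x i : z i)\<close> of the projective line, so that a row of ones is
  included as the point \<open>(1 : 0)\<close>. Eliminating the last row and column of a Cauchy matrix leaves a Cauchy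
  matrix with scaled rows and columns.
\<close>

lemma cauchy_determinant:
  assumes "\<And>i j. i < n \<Longrightarrow> j < n \<Longrightarrow> x i - z i * y j \<noteq> 0"
  shows "leibniz n (\<lambda>i j. 1 / (x i - z i * y j)) * (\<Prod>i<n. \<Prod>j<n. x i - z i * y j) =
    (\<Prod>j<n. \<Prod>i<j. (x i * z j - x j * z i) * (y j - y i))"
  using assms
proof (induction n)
  case 0
  then show ?case by (simp add: leibniz_def)
next
  case (Suc n)
  define d where "d = (\<lambda>i j. x i - z i * y j)"
  have nz: "d i j \<noteq> 0" if "i \<le> n" "j \<le> n" for i j
    using Suc.prems that by (auto simp: d_def)
  define c where "c = (\<lambda>i j. 1 / d i j)"
  define P where "P = (\<Prod>i<n. (x i * z n - x n * z i) * (y n - y i))"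
  define Q where "Q = (\<Prod>i<n. d i n) * (\<Prod>j<n. d n j)"
  have "leibniz (Suc n) c = c n n * leibniz n (\<lambda>i j. c i j - c i n * c n j / c n n)"
    using nz by (intro leibniz_Suc_eliminate) (auto simp: c_def)
  also have "leibniz n (\<lambda>i j. c i j - c i n * c n j / c n n) =
     leibniz n (\<lambda>i j. ((x i * z n - x n * z i) / d i n) * ((y n - y j) / d n j) * c i j)"
  proof (rule leibniz_cong)
    fix i j assume "i < n" "j < n"
    then have "d i j \<noteq> 0" "d i n \<noteq> 0" "d n j \<noteq> 0" "d n n \<noteq> 0" using nz by auto
    moreover have "d i n * d n j - d n n * d i j = (x i * z n - x n * z i) * (y n - y j)"
      by (simp add: d_def algebra_simps)
    ultimately show "c i j - c i n * c n j / c n n = (x i * z n - x n * z i) / d i n * ((y n - y j) / d n j) * c i j"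
      by (simp add: c_def field_simps)
  qed
  also have "\<dots> = P / Q * leibniz n c"
    by (simp only: leibniz_scale) (simp add: P_def Q_def prod.distrib prod_dividef)
  finally have *: "leibniz (Suc n) c = c n n * (P / Q * leibniz n c)" .
  have Q: "Q \<noteq> 0" using nz by (auto simp: Q_def)
  have "(\<Prod>i<Suc n. \<Prod>j<Suc n. d i j) = (\<Prod>i<n. \<Prod>j<n. d i j) * Q * d n n"
    by (simp add: Q_def prod.distrib mult_ac)
  moreover have "1 / d n n * (P / Q * u) * (v * Q * d n n) = P * (u * v)" for u v
    using Q nz[of n n] by simp
  ultimately have "leibniz (Suc n) c * (\<Prod>i<Suc n. \<Prod>j<Suc n. d i j) = P * (leibniz n c * (\<Prod>i<n. \<Prod>j<n. d i j))"
    unfolding * by (simp only: c_def)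
  also have "leibniz n c * (\<Prod>i<n. \<Prod>j<n. d i j) = (\<Prod>j<n. \<Prod>i<j. (x i * z j - x j * z i) * (y j - y i))"
    using Suc by (simp add: c_def d_def)
  finally show ?case
    by (simp add: P_def c_def d_def mult_ac)
qed

text \<open>
  \<open>I\<close> is the set of rows from which the second summand is taken.
\<close>

lemma leibniz_add_rows:
  "leibniz n (\<lambda>i j. a i j + w * b i j) =
    (\<Sum>I\<in>Pow {..<n}. w ^ card I * leibniz n (\<lambda>i j. if i \<in> I then b i j else a i j))"
proof -
  have *: "(\<Prod>i<n. a i (p i) + w * b i (p i)) =
      (\<Sum>I\<in>Pow {..<n}. w ^ card I * (\<Prod>i<n. if i \<in> I then b i (p i) else a i (p i)))" for p
  proof -
    have "(\<Prod>i<n. w * b i (p i) + a i (p i)) =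
      (\<Sum>I\<in>Pow {..<n}. (\<Prod>i\<in>I. w * b i (p i)) * (\<Prod>i\<in>{..<n} - I. a i (p i)))"
      by (rule prod_add) simp
    also have "\<dots> = (\<Sum>I\<in>Pow {..<n}. w ^ card I * (\<Prod>i<n. if i \<in> I then b i (p i) else a i (p i)))"
    proof (rule sum.cong[OF refl])
      fix I assume I: "I \<in> Pow {..<n}"
      then have fin: "finite I" by (auto intro: finite_subset)
      have "(\<Prod>i<n. if i \<in> I then b i (p i) else a i (p i)) =
        (\<Prod>i\<in>{..<n} \<inter> I. b i (p i)) * (\<Prod>i\<in>{..<n} \<inter> - I. a i (p i))"
        by (subst prod.If_cases) (auto simp: Collect_mem_eq)
      moreover have "{..<n} \<inter> I = I" "{..<n} \<inter> - I = {..<n} - I" using I by auto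
      ultimately show "(\<Prod>i\<in>I. w * b i (p i)) * (\<Prod>i\<in>{..<n} - I. a i (p i)) = 
          w ^ card I * (\<Prod>i<n. if i \<in> I then b i (p i) else a i (p i))"
        by (simp add: prod.distrib)
    qed
    finally show ?thesis by (simp add: add.commute)
  qed
  show ?thesis
    unfolding leibniz_def * sum_distrib_left
    by (subst sum.swap) (simp add: mult_ac)
qed

lemma leibniz_add_columns:
  "leibniz n (\<lambda>i j. a i j + w * b i j) =
    (\<Sum>J\<in>Pow {..<n}. w ^ card J * leibniz n (\<lambda>i j. if j \<in> J then b i j else a i j))"
proof -
  have "leibniz n (\<lambda>i j. a i j + w * b i j) = leibniz n (\<lambda>i j. a j i + w * b j i)"
    by (rule leibniz_transpose[symmetric])
  also have "\<dots> = (\<Sum>J\<in>Pow {..<n}. w ^ card J * leibniz n (\<lambda>i j. if i \<in> J then b j i else a j i))"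
    by (rule leibniz_add_rows)
  also have "\<dots> = (\<Sum>J\<in>Pow {..<n}. w ^ card J * leibniz n (\<lambda>i j. if j \<in> J then b i j else a i j))"
    by (intro sum.cong refl arg_cong2[of _ _ _ _ "(*)"]) (subst leibniz_transpose[symmetric], simp)
  finally show ?thesis .
qed

definition scale_on :: "real \<Rightarrow> nat set \<Rightarrow> (nat \<Rightarrow> real) \<Rightarrow> nat \<Rightarrow> real" where
  "scale_on s I u i = (if i \<in> I then s * u i else u i)"

text \<open>
  The expansion along columns of the determinant with the entries
  \<open>1 / (x i - z i * y j) + w / (x i - s * z i * y j)\<close>, multiplied by all denominators. For the columns in \<open>J\<close> the
  second summand is chosen, which replaces \<open>y j\<close> by \<open>s * y j\<close> in the Cauchy determinant and leaves the
  denominators of the first summand uncancelled; therefore the last product scales the complement of \<open>J\<close>.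
\<close>

definition cauchy_sum :: "real \<Rightarrow> real \<Rightarrow> nat \<Rightarrow> (nat \<Rightarrow> real) \<Rightarrow> (nat \<Rightarrow> real) \<Rightarrow> (nat \<Rightarrow> real) \<Rightarrow> real" where
  "cauchy_sum s w n x z y = (\<Sum>J\<in>Pow {..<n}. w ^ card J *
     (\<Prod>j<n. \<Prod>i<j. (x i * z j - x j * z i) * (scale_on s J y j - scale_on s J y i)) *
     (\<Prod>i<n. \<Prod>j<n. x i - z i * scale_on s (- J) y j))"

text \<open>
  The expansion of the same determinant along rows: \<open>z i\<close> is replaced by \<open>s * z i\<close> for \<open>i\<close> in \<open>I\<close>.
\<close>

definition dual_cauchy_sum :: "real \<Rightarrow> real \<Rightarrow> nat \<Rightarrow> (nat \<Rightarrow> real) \<Rightarrow> (nat \<Rightarrow> real) \<Rightarrow> (nat \<Rightarrow> real) \<Rightarrow> real" where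
  "dual_cauchy_sum s w n x z y = (\<Sum>I\<in>Pow {..<n}. w ^ card I *
     (\<Prod>j<n. \<Prod>i<j. (x i * scale_on s I z j - x j * scale_on s I z i) * (y j - y i)) *
     (\<Prod>i<n. \<Prod>j<n. x i - scale_on s (- I) z i * y j))"

context
  fixes s :: real and n :: nat and x y z :: "nat \<Rightarrow> real"
  assumes nz: "\<And>i j. i < n \<Longrightarrow> j < n \<Longrightarrow> x i - z i * y j \<noteq> 0"
    and nzs: "\<And>i j. i < n \<Longrightarrow> j < n \<Longrightarrow> x i - s * z i * y j \<noteq> 0"
begin

abbreviation (input) "den \<equiv> (\<Prod>i<n. \<Prod>j<n. x i - z i * y j) * (\<Prod>i<n. \<Prod>j<n. x i - s * z i * y j)"

lemma cauchy_sum_eq_leibniz: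
  "cauchy_sum s w n x z y = den * leibniz n (\<lambda>i j. 1 / (x i - z i * y j) + w * (1 / (x i - s * z i * y j)))"
proof -
  have *: "(\<Prod>j<n. \<Prod>i<j. (x i * z j - x j * z i) * (scale_on s J y j - scale_on s J y i)) *
     (\<Prod>i<n. \<Prod>j<n. x i - z i * scale_on s (- J) y j) =
     den * leibniz n (\<lambda>i j. if j \<in> J then 1 / (x i - s * z i * y j) else 1 / (x i - z i * y j))" for J
  proof -
    have 1: "leibniz n (\<lambda>i j. if j \<in> J then 1 / (x i - s * z i * y j) else 1 / (x i - z i * y j)) =
      leibniz n (\<lambda>i j. 1 / (x i - z i * scale_on s J y j))"
      by (intro leibniz_cong) (auto simp: scale_on_def mult_ac)
    have 2: "leibniz n (\<lambda>i j. 1 / (x i - z i * scale_on s J y j)) * (\<Prod>i<n. \<Prod>j<n. x i - z i * scale_on s J y j) =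
      (\<Prod>j<n. \<Prod>i<j. (x i * z j - x j * z i) * (scale_on s J y j - scale_on s J y i))"
      by (intro cauchy_determinant) (use nz nzs in \<open>auto simp: scale_on_def mult_ac\<close>)
    have 3: "den = (\<Prod>i<n. \<Prod>j<n. x i - z i * scale_on s J y j) * (\<Prod>i<n. \<Prod>j<n. x i - z i * scale_on s (- J) y j)"
      unfolding prod.distrib[symmetric] by (intro prod.cong) (auto simp: scale_on_def mult_ac)
    show ?thesis
      unfolding 1 2[symmetric] 3 by (simp only: mult_ac)
  qed
  show ?thesis
    unfolding cauchy_sum_def mult.assoc[of "w ^ _"] * leibniz_add_columns sum_distrib_left
    by (intro sum.cong) (auto simp: mult_ac)
qed

lemma dual_cauchy_sum_eq_leibniz:
  "dual_cauchy_sum s w n x z y = den * leibniz n (\<lambda>i j. 1 / (x i - z i * y j) + w * (1 / (x i - s * z i * y j)))"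
proof -
  have *: "(\<Prod>j<n. \<Prod>i<j. (x i * scale_on s I z j - x j * scale_on s I z i) * (y j - y i)) *
     (\<Prod>i<n. \<Prod>j<n. x i - scale_on s (- I) z i * y j) =
     den * leibniz n (\<lambda>i j. if i \<in> I then 1 / (x i - s * z i * y j) else 1 / (x i - z i * y j))" for I
  proof -
    have 1: "leibniz n (\<lambda>i j. if i \<in> I then 1 / (x i - s * z i * y j) else 1 / (x i - z i * y j)) =
      leibniz n (\<lambda>i j. 1 / (x i - scale_on s I z i * y j))"
      by (intro leibniz_cong) (auto simp: scale_on_def mult_ac)
    have 2: "leibniz n (\<lambda>i j. 1 / (x i - scale_on s I z i * y j)) * (\<Prod>i<n. \<Prod>j<n. x i - scale_on s I z i * y j) =
      (\<Prod>j<n. \<Prod>i<j. (x i * scale_on s I z j - x j * scale_on s I z i) * (y j - y i))"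
      by (intro cauchy_determinant) (use nz nzs in \<open>auto simp: scale_on_def mult_ac\<close>)
    have 3: "den = (\<Prod>i<n. \<Prod>j<n. x i - scale_on s I z i * y j) * (\<Prod>i<n. \<Prod>j<n. x i - scale_on s (- I) z i * y j)"
      unfolding prod.distrib[symmetric] by (intro prod.cong) (auto simp: scale_on_def mult_ac)
    show ?thesis
      unfolding 1 2[symmetric] 3 by (simp only: mult_ac)
  qed
  show ?thesis
    unfolding dual_cauchy_sum_def mult.assoc[of "w ^ _"] * leibniz_add_rows sum_distrib_left
    by (intro sum.cong) (auto simp: mult_ac)
qed

text \<open>
  For \<open>w = -1\<close> and for \<open>w = -s\<close> the two fractions of an entry add up to one fraction with
  numerator \<open>(1 - s) * y j\<close> and \<open>(1 - s) * x i\<close>. These can be taken out of the columns and of the rows, and the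
  same determinant remains.
\<close>

lemma cauchy_sum_special_generic:
  assumes "\<And>i. i < n \<Longrightarrow> z i = 1"
  shows "(\<Prod>i<n. x i) * cauchy_sum s (- 1) n x z y = (\<Prod>j<n. y j) * cauchy_sum s (- s) n x z y"
proof -
  define D where "D = leibniz n (\<lambda>i j. 1 / ((x i - z i * y j) * (x i - s * z i * y j)))"
  have "leibniz n (\<lambda>i j. 1 / (x i - z i * y j) + (-1) * (1 / (x i - s * z i * y j))) =
    leibniz n (\<lambda>i j. (1 - s) * y j * (1 / ((x i - z i * y j) * (x i - s * z i * y j))))"
    using nz nzs assms by (intro leibniz_cong) (simp add: field_simps)
  also have "\<dots> = (1 - s) ^ n * (\<Prod>j<n. y j) * D"
    by (subst leibniz_scale) (simp add: D_def)
  finally have 1: "leibniz n (\<lambda>i j. 1 / (x i - z i * y j) + (-1) * (1 / (x i - s * z i * y j))) = \<dots>" .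
  have "leibniz n (\<lambda>i j. 1 / (x i - z i * y j) + (-s) * (1 / (x i - s * z i * y j))) =
    leibniz n (\<lambda>i j. ((1 - s) * x i) * 1 * (1 / ((x i - z i * y j) * (x i - s * z i * y j))))"
    using nz nzs assms by (intro leibniz_cong) (simp add: field_simps)
  also have "\<dots> = (1 - s) ^ n * (\<Prod>i<n. x i) * D"
    by (subst leibniz_scale) (simp add: D_def prod.distrib)
  finally have 2: "leibniz n (\<lambda>i j. 1 / (x i - z i * y j) + (-s) * (1 / (x i - s * z i * y j))) = \<dots>" .
  show ?thesis
    unfolding cauchy_sum_eq_leibniz 1 2 by (simp add: mult_ac)
qed

end

lemma eventually_shift_nonzero:
  fixes c :: "nat \<Rightarrow> nat \<Rightarrow> real"
  shows "\<forall>\<^sub>F e in at 0. \<forall>i<n. \<forall>j<n. x i + e - c i j \<noteq> 0"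
proof -
  have "\<forall>\<^sub>F e in at 0. e \<noteq> c i j - x i" for i j
    by (rule eventually_neq_at_within)
  then have "\<forall>\<^sub>F e in at 0. \<forall>i\<in>{..<n}. \<forall>j\<in>{..<n}. e \<noteq> c i j - x i"
    by (intro eventually_ball_finite ballI) auto
  then show ?thesis
    by eventually_elim (auto simp: algebra_simps)
qed

text \<open>
  The Cauchy sums are polynomials, so their identities extend to points where denominators of
  the determinant vanish. Adding the same small number to all \<open>x i\<close> makes all denominators nonzero.
\<close>

lemma polynomial_identity_from_generic:
  fixes F G :: "(nat \<Rightarrow> real) \<Rightarrow> real" and z y :: "nat \<Rightarrow> real"
  assumes F: "((\<lambda>e. F (\<lambda>i. x i + e)) \<longlongrightarrow> F x) (at 0)" and G: "((\<lambda>e. G (\<lambda>i. x i + e)) \<longlongrightarrow> G x) (at 0)"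
    and eq: "\<And>x'. (\<And>i j. i < n \<Longrightarrow> j < n \<Longrightarrow> x' i - z i * y j \<noteq> 0) \<Longrightarrow>
      (\<And>i j. i < n \<Longrightarrow> j < n \<Longrightarrow> x' i - s * z i * y j \<noteq> 0) \<Longrightarrow> F x' = G x'"
  shows "F x = G x"
proof -
  have "\<forall>\<^sub>F e in at 0. F (\<lambda>i. x i + e) = G (\<lambda>i. x i + e)"
    using eventually_shift_nonzero[of n x "\<lambda>i j. z i * y j"] eventually_shift_nonzero[of n x "\<lambda>i j. s * z i * y j"]
    by eventually_elim (rule eq, auto)
  then have "((\<lambda>e. G (\<lambda>i. x i + e)) \<longlongrightarrow> F x) (at 0)"
    using F by (simp cong: tendsto_cong)
  then show ?thesis
    using G by (rule tendsto_unique[rotated]) simp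
qed

lemma tendsto_cauchy_sum:
  "((\<lambda>e. cauchy_sum s w n (\<lambda>i. x i + e) z y) \<longlongrightarrow> cauchy_sum s w n x z y) (at 0)"
  unfolding cauchy_sum_def by (auto intro!: tendsto_eq_intros)

lemma tendsto_dual_cauchy_sum:
  "((\<lambda>e. dual_cauchy_sum s w n (\<lambda>i. x i + e) z y) \<longlongrightarrow> dual_cauchy_sum s w n x z y) (at 0)"
  unfolding dual_cauchy_sum_def by (auto intro!: tendsto_eq_intros)

lemma cauchy_sum_duality: "cauchy_sum s w n x z y = dual_cauchy_sum s w n x z y"
  using tendsto_cauchy_sum tendsto_dual_cauchy_sum
  by (rule polynomial_identity_from_generic[where z = z and y = y and s = s and n = n])
    (simp add: cauchy_sum_eq_leibniz dual_cauchy_sum_eq_leibniz)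

lemma cauchy_sum_special:
  assumes "\<And>i. i < n \<Longrightarrow> z i = 1"
  shows "(\<Prod>i<n. x i) * cauchy_sum s (- 1) n x z y = (\<Prod>j<n. y j) * cauchy_sum s (- s) n x z y"
proof (rule polynomial_identity_from_generic[where z = z and y = y and s = s and n = n
      and F = "\<lambda>x. (\<Prod>i<n. x i) * cauchy_sum s (- 1) n x z y"
      and G = "\<lambda>x. (\<Prod>j<n. y j) * cauchy_sum s (- s) n x z y"])
  show "((\<lambda>e. (\<Prod>i<n. x i + e) * cauchy_sum s (- 1) n (\<lambda>i. x i + e) z y) \<longlongrightarrow>
      (\<Prod>i<n. x i) * cauchy_sum s (- 1) n x z y) (at 0)"
    by (rule tendsto_mult[OF _ tendsto_cauchy_sum]) (auto intro!: tendsto_eq_intros)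
  show "((\<lambda>e. (\<Prod>i<n. y i) * cauchy_sum s (- s) n (\<lambda>i. x i + e) z y) \<longlongrightarrow>
      (\<Prod>i<n. y i) * cauchy_sum s (- s) n x z y) (at 0)"
    by (rule tendsto_mult[OF _ tendsto_cauchy_sum]) simp
qed (rule cauchy_sum_special_generic, auto simp: assms)

section \<open>The weights of branching and of horizontal strips\<close>

lemma convergent_qpoch:
  fixes a q :: real assumes "\<bar>q\<bar> < 1"
  shows "convergent_prod (\<lambda>i. 1 - a * q ^ i)"
proof -
  have "summable (\<lambda>i. norm (1 - a * q ^ i - 1))"
    using assms by (auto simp: abs_mult power_abs intro!: summable_mult summable_geometric)
  then show ?thesis
    by (intro abs_convergent_prod_imp_convergent_prod summable_imp_abs_convergent_prod)
qed

lemma qpoch_limit: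
  assumes "\<bar>q\<bar> < 1"
  shows "(\<lambda>n. \<Prod>i\<le>n. 1 - a * q ^ i) \<longlonglongrightarrow> qpoch a q"
  unfolding qpoch_def by (rule convergent_prod_LIMSEQ[OF convergent_qpoch[OF assms]])

lemma qpoch_rec:
  assumes "\<bar>q\<bar> < 1"
  shows "qpoch a q = (1 - a) * qpoch (q * a) q"
proof -
  have "(\<Prod>i\<le>Suc n. 1 - a * q ^ i) = (1 - a) * (\<Prod>i\<le>n. 1 - q * a * q ^ i)" for n
    by (subst prod.atMost_Suc_shift) (simp add: mult_ac)
  then have "(\<lambda>n. \<Prod>i\<le>Suc n. 1 - a * q ^ i) \<longlonglongrightarrow> (1 - a) * qpoch (q * a) q"
    using tendsto_mult_left[OF qpoch_limit[OF assms, of "q * a"], of "1 - a"] by simp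
  then show ?thesis
    using LIMSEQ_Suc[OF qpoch_limit[OF assms, of a]] by (rule LIMSEQ_unique[rotated])
qed

lemma qpoch_nonzero:
  assumes "\<bar>q\<bar> < 1" "\<And>i. a * q ^ i \<noteq> 1"
  shows "qpoch a q \<noteq> 0"
proof -
  have "1 - a * q ^ i \<noteq> 0" for i
    using assms(2)[of i] by simp
  then show ?thesis
    unfolding qpoch_def by (intro prodinf_nonzero convergent_qpoch[OF assms(1)])
qed

lemma qpoch_eq_0:
  assumes "\<bar>q\<bar> < 1" "a * q ^ k = 1"
  shows "qpoch a q = 0"
proof -
  have "(\<Prod>i\<le>n. 1 - a * q ^ i) = 0" if "n \<ge> k" for n
    using that assms(2) by (intro prod_zero) auto
  then have "\<forall>\<^sub>F n in sequentially. (\<Prod>i\<le>n. 1 - a * q ^ i) = 0"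
    by (auto simp: eventually_sequentially)
  then have "(\<lambda>n. \<Prod>i\<le>n. 1 - a * q ^ i) \<longlonglongrightarrow> 0"
    by (rule tendsto_eventually)
  then show ?thesis
    by (rule LIMSEQ_unique[OF qpoch_limit[OF assms(1)]])
qed

lemma mac_f_rec:
  assumes "\<bar>q\<bar> < 1"
  shows "mac_f q t u = (1 - t * u) / (1 - q * u) * mac_f q t (q * u)"
  unfolding mac_f_def qpoch_rec[OF assms, of "t * u"] qpoch_rec[OF assms, of "q * u"]
  by (simp add: mult_ac)

lemma mac_f_nonzero:
  assumes "\<bar>q\<bar> < 1" "\<bar>t\<bar> < 1" "\<bar>u\<bar> \<le> 1"
  shows "mac_f q t u \<noteq> 0"
proof -
  have 1: "\<bar>a * u * q ^ i\<bar> < 1" if "\<bar>a\<bar> < 1" for a i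
  proof -
    have "\<bar>q ^ i\<bar> \<le> 1"
      using assms(1) by (simp add: power_abs power_le_one)
    then have "\<bar>u * q ^ i\<bar> \<le> 1"
      using mult_mono[OF assms(3), of "\<bar>q ^ i\<bar>" 1] by (simp add: abs_mult)
    then have "\<bar>a\<bar> * \<bar>u * q ^ i\<bar> \<le> \<bar>a\<bar> * 1"
      by (intro mult_left_mono) auto
    then show ?thesis
      using that by (simp add: abs_mult mult_ac)
  qed
  then have "qpoch (a * u) q \<noteq> 0" if "\<bar>a\<bar> < 1" for a
    using assms that 1[OF that] by (intro qpoch_nonzero) (auto dest!: arg_cong[of _ 1 abs] simp: less_le)
  then show ?thesis
    using assms by (simp add: mac_f_def)
qed

text \<open>
  The quotient \<open>f(u) / f(q\<^sup>m u)\<close>. Unlike \<open>f\<close> it is a rational function, so that limits in all arguments are easy.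
\<close>

definition f_ratio :: "real \<Rightarrow> real \<Rightarrow> real \<Rightarrow> nat \<Rightarrow> real" where
  "f_ratio q t u m = (\<Prod>i<m. (1 - t * (q ^ i * u)) / (1 - q * (q ^ i * u)))"

lemma mac_f_eq_ratio:
  assumes "\<bar>q\<bar> < 1"
  shows "mac_f q t u = f_ratio q t u m * mac_f q t (q ^ m * u)"
proof (induction m)
  case (Suc m)
  then show ?case
    using mac_f_rec[OF assms, of t "q ^ m * u"] by (simp add: f_ratio_def mult_ac)
qed (simp add: f_ratio_def)

lemma tendsto_f_ratio:
  assumes "(Q \<longlongrightarrow> q) F" "(T \<longlongrightarrow> t) F" "(U \<longlongrightarrow> u) F" "\<bar>q\<bar> < 1" "\<bar>u\<bar> \<le> 1"
  shows "((\<lambda>x. f_ratio (Q x) (T x) (U x) m) \<longlongrightarrow> f_ratio q t u m) F"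
proof -
  have "1 - q * (q ^ i * u) \<noteq> 0" for i
  proof -
    have "\<bar>q ^ i\<bar> \<le> 1"
      using assms by (simp add: power_abs power_le_one)
    then have "\<bar>q ^ i * u\<bar> \<le> 1"
      using mult_mono[of "\<bar>q ^ i\<bar>" 1 "\<bar>u\<bar>" 1] assms by (simp add: abs_mult)
    then have "\<bar>q\<bar> * \<bar>q ^ i * u\<bar> \<le> \<bar>q\<bar> * 1"
      by (intro mult_left_mono) auto
    then have "\<bar>q * (q ^ i * u)\<bar> < 1"
      using assms by (simp add: abs_mult)
    then show ?thesis by auto
  qed
  then show ?thesis
    unfolding f_ratio_def using assms by (auto intro!: tendsto_intros)
qed

lemma f_ratio_nonzero:
  assumes "\<bar>q\<bar> < 1" "\<bar>t\<bar> < 1" "\<bar>u\<bar> \<le> 1"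
  shows "f_ratio q t u m \<noteq> 0"
  using mac_f_eq_ratio[OF assms(1), of t u m] mac_f_nonzero[OF assms] by auto

lemma f_ratio_0 [simp]: "f_ratio q t 0 m = 1"
  by (simp add: f_ratio_def)

text \<open>
  The weight of the step from the signature \<open>l\<close> of length \<open>n\<close> to the signature \<open>m\<close> of length \<open>p\<close>. Only
  positions with equal values of \<open>h\<close> interact: this is the limit of the weight when the parts in position \<open>i\<close>
  move with velocity \<open>h i\<close> (\<open>tendsto_skew_coeff_shift\<close>). If \<open>h\<close> is constant, \<open>p = n - 1\<close> gives the branching
  coefficient \<open>\<psi>\<close> (\<open>mac_psi_eq_skew_coeff\<close>), and \<open>p = n\<close> the coefficient in the Pieri rule \<open>g_pieri\<close>.
\<close>

definition skew_coeff :: "real \<Rightarrow> real \<Rightarrow> (nat \<Rightarrow> int) \<Rightarrow> nat \<Rightarrow> nat \<Rightarrow> (nat \<Rightarrow> int) \<Rightarrow> (nat \<Rightarrow> int) \<Rightarrow> real" where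
  "skew_coeff q t h n p l m =
     (\<Prod>j<p. \<Prod>i\<le>j. if h i = h j then f_ratio q t (t ^ (j - i) * q powi (m i - m j)) (nat (l i - m i)) else 1) /
     (\<Prod>j<n. \<Prod>i<j. if h i = h j then f_ratio q t (t ^ (j - i - 1) * q powi (m i - l j)) (nat (l i - m i)) else 1)"

text \<open>
  The conditions for a step that survive when the parts in position \<open>i\<close> move with velocity \<open>h i\<close>. For \<open>p = n\<close> and
  constant \<open>h\<close> they describe horizontal strips.
\<close>

definition interlacing :: "(nat \<Rightarrow> int) \<Rightarrow> nat \<Rightarrow> nat \<Rightarrow> (nat \<Rightarrow> int) \<Rightarrow> (nat \<Rightarrow> int) \<Rightarrow> bool" where
  "interlacing h n p l m \<longleftrightarrow> (\<forall>i<p. m i \<le> l i) \<and> (\<forall>i. Suc i < n \<and> h i = h (Suc i) \<longrightarrow> l (Suc i) \<le> m i)"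

lemma powi_nonneg_le_1:
  fixes q :: real assumes "\<bar>q\<bar> < 1" "a \<ge> 0"
  shows "\<bar>q powi a\<bar> \<le> 1"
  using assms by (simp add: power_int_def power_abs power_le_one)

lemma power_powi_le_1:
  fixes q t :: real assumes "\<bar>q\<bar> < 1" "\<bar>t\<bar> < 1" "a \<ge> 0"
  shows "\<bar>t ^ k * q powi a\<bar> \<le> 1"
  using mult_mono[OF _ powi_nonneg_le_1[OF assms(1,3)], of "\<bar>t ^ k\<bar>" 1] assms
  by (simp add: abs_mult power_abs power_le_one)

lemma powi_add_nonneg:
  fixes q :: real assumes "a \<ge> 0" "b \<ge> 0"
  shows "q powi (a + b) = q ^ nat b * q powi a"
  using assms by (simp add: power_int_def nat_add_distrib power_add)

lemma interlacing_chain: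
  assumes "interlacing h n p l m" "\<And>i j. i \<le> j \<Longrightarrow> j < n \<Longrightarrow> h j \<le> h i" "n \<le> Suc p"
    "i < j" "j < n" "h i = h j"
  shows "l j \<le> m i"
  using assms(4-6)
proof (induction j)
  case (Suc j)
  have hj: "h j = h (Suc j)"
    using assms(2)[of i j] assms(2)[of j "Suc j"] Suc.prems by auto
  have *: "l (Suc j) \<le> m j"
    using assms(1) Suc.prems hj by (auto simp: interlacing_def)
  show ?case
  proof (cases "i = j")
    case False
    then have "l j \<le> m i" using Suc hj by auto
    moreover have "m j \<le> l j" using assms(1,3) Suc.prems by (auto simp: interlacing_def)
    ultimately show ?thesis using * by linarith
  qed (use * in auto)
qed simp

lemma interlacing_chain':
  assumes "interlacing h n p l m" "\<And>i j. i \<le> j \<Longrightarrow> j < n \<Longrightarrow> h j \<le> h i" "n \<le> Suc p"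
    "i \<le> j" "j < p" "p \<le> n" "h i = h j"
  shows "m j \<le> m i"
proof (cases "i = j")
  case False
  then have "l j \<le> m i" using interlacing_chain[OF assms(1-3)] assms by auto
  moreover have "m j \<le> l j" using assms by (auto simp: interlacing_def)
  ultimately show ?thesis by linarith
qed simp

lemma prod_triangle: "(\<Prod>(i, j)\<in>{(i, j). i \<le> j \<and> j < n}. g i j) = (\<Prod>j<n. \<Prod>i\<le>j. g i j)" for n :: nat
proof -
  have "(\<Prod>j<n. \<Prod>i\<le>j. g i j) = (\<Prod>(j, i)\<in>(SIGMA j:{..<n}. {..j}). g i j)"
    by (rule prod.Sigma) auto
  also have "\<dots> = (\<Prod>(i, j)\<in>{(i, j). i \<le> j \<and> j < n}. g i j)"
    by (rule prod.reindex_bij_witness[of _ "\<lambda>(i, j). (j, i)" "\<lambda>(j, i). (i, j)"]) auto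
  finally show ?thesis ..
qed

text \<open>
  Expressed by \<open>f\<close> itself, every factor depends on the ratio of only two of the parts, so that it is easy to follow
  a change of a single part.
\<close>

lemma skew_coeff_eq_mac_f:
  assumes q: "\<bar>q\<bar> < 1" and t: "\<bar>t\<bar> < 1"
    and il: "interlacing h n p l m" and h: "\<And>i j. h i = h j" and np: "n \<le> Suc p" "p \<le> n"
  shows "skew_coeff q t h n p l m =
    (\<Prod>j<p. \<Prod>i\<le>j. mac_f q t (t ^ (j - i) * q powi (m i - m j)) / mac_f q t (t ^ (j - i) * q powi (l i - m j))) *
    (\<Prod>j<n. \<Prod>i<j. mac_f q t (t ^ (j - i - 1) * q powi (l i - l j)) / mac_f q t (t ^ (j - i - 1) * q powi (m i - l j)))"
proof -
  have ml: "m i \<le> l i" if "i < p" for i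
    using il that by (auto simp: interlacing_def)
  have chain: "l j \<le> m i" if "i < j" "j < n" for i j
    using interlacing_chain[OF il eq_refl[OF h] np(1) that h] .
  have chain': "m j \<le> m i" if "i \<le> j" "j < p" for i j
    using interlacing_chain'[OF il eq_refl[OF h] np(1) that np(2) h] .
  have 1: "f_ratio q t (t ^ k * q powi (m i - a)) (nat (l i - m i)) =
      mac_f q t (t ^ k * q powi (m i - a)) / mac_f q t (t ^ k * q powi (l i - a))"
    if "i < p" "a \<le> m i" for k i a
  proof -
    have "q powi (l i - a) = q ^ nat (l i - m i) * q powi (m i - a)"
      using powi_add_nonneg[of "m i - a" "l i - m i" q] ml[of i] that by simp
    moreover have "mac_f q t (t ^ k * q powi (l i - a)) \<noteq> 0"
      using ml[of i] that by (intro mac_f_nonzero power_powi_le_1 q t) auto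
    ultimately show ?thesis
      using mac_f_eq_ratio[OF q, of t "t ^ k * q powi (m i - a)" "nat (l i - m i)"] by (simp add: mult_ac)
  qed
  have "(\<Prod>j<p. \<Prod>i\<le>j. if h i = h j then f_ratio q t (t ^ (j - i) * q powi (m i - m j)) (nat (l i - m i)) else 1) =
    (\<Prod>j<p. \<Prod>i\<le>j. mac_f q t (t ^ (j - i) * q powi (m i - m j)) / mac_f q t (t ^ (j - i) * q powi (l i - m j)))"
    using h by (intro prod.cong refl) (auto intro!: 1 chain')
  moreover have "(\<Prod>j<n. \<Prod>i<j. if h i = h j then f_ratio q t (t ^ (j - i - 1) * q powi (m i - l j)) (nat (l i - m i)) else 1) =
    (\<Prod>j<n. \<Prod>i<j. inverse (mac_f q t (t ^ (j - i - 1) * q powi (l i - l j)) / mac_f q t (t ^ (j - i - 1) * q powi (m i - l j))))"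
    using h np by (intro prod.cong refl) (auto simp: 1 chain)
  moreover have "(\<Prod>j<n. \<Prod>i<j. inverse (g i j)) = inverse (\<Prod>j<n. \<Prod>i<j. g i j)" for g :: "nat \<Rightarrow> nat \<Rightarrow> real"
    by (simp add: prod_inversef[unfolded o_def])
  ultimately show ?thesis
    unfolding skew_coeff_def by (simp only: divide_inverse inverse_inverse_eq)
qed

lemma mac_psi_eq_skew_coeff:
  assumes q: "\<bar>q\<bar> < 1" and t: "\<bar>t\<bar> < 1" and il: "\<mu> \<prec>\<^sub>P lam"
  shows "mac_psi q t lam \<mu> = skew_coeff q t (\<lambda>_. c) (length lam) (length \<mu>) ((!) lam) ((!) \<mu>)"
proof -
  define p where "p = length \<mu>"
  have len: "length lam = Suc p" using il by (simp add: interlace_def p_def)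
  let ?f = "mac_f q t"
  have "mac_psi q t lam \<mu> = (\<Prod>j<p. \<Prod>i\<le>j.
        (?f (t ^ (j - i) * q powi (\<mu> ! i - \<mu> ! j)) / ?f (t ^ (j - i) * q powi (lam ! i - \<mu> ! j))) *
        (?f (t ^ (j - i) * q powi (lam ! i - lam ! Suc j)) / ?f (t ^ (j - i) * q powi (\<mu> ! i - lam ! Suc j))))"
    unfolding mac_psi_def p_def by (subst prod_triangle) simp
  also have "\<dots> = (\<Prod>j<p. \<Prod>i\<le>j. (?f (t ^ (j - i) * q powi (\<mu> ! i - \<mu> ! j)) / ?f (t ^ (j - i) * q powi (lam ! i - \<mu> ! j)))) *
     (\<Prod>j<p. \<Prod>i\<le>j. (?f (t ^ (j - i) * q powi (lam ! i - lam ! Suc j)) / ?f (t ^ (j - i) * q powi (\<mu> ! i - lam ! Suc j))))"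
    by (simp only: prod.distrib)
  also have "(\<Prod>j<p. \<Prod>i\<le>j. (?f (t ^ (j - i) * q powi (lam ! i - lam ! Suc j)) / ?f (t ^ (j - i) * q powi (\<mu> ! i - lam ! Suc j)))) =
     (\<Prod>j<Suc p. \<Prod>i<j. (?f (t ^ (j - i - 1) * q powi (lam ! i - lam ! j)) / ?f (t ^ (j - i - 1) * q powi (\<mu> ! i - lam ! j))))"
    by (subst prod.lessThan_Suc_shift) (simp add: lessThan_Suc_atMost)
  finally show ?thesis
    using il unfolding len p_def[symmetric]
    by (subst skew_coeff_eq_mac_f[OF q t]) (auto simp: interlacing_def interlace_def p_def)
qed

section \<open>Two summation identities for generic parameters\<close>

definition lower :: "nat set \<Rightarrow> (nat \<Rightarrow> int) \<Rightarrow> nat \<Rightarrow> int" where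
  "lower J l i = (if i \<in> J then l i - 1 else l i)"

definition raise :: "nat set \<Rightarrow> (nat \<Rightarrow> int) \<Rightarrow> nat \<Rightarrow> int" where
  "raise J l i = (if i \<in> J then l i + 1 else l i)"

definition e_factor :: "real \<Rightarrow> real \<Rightarrow> real \<Rightarrow> real" where
  "e_factor q t u = ((1 - u / t) * (1 - t / q * u)) / ((1 - u) * (1 - u / q))"

text \<open>
  The coefficient of the signature with lowered parts in \<open>J\<close> in the Pieri rule \<open>e_pieri\<close>.
\<close>

definition e_coeff :: "real \<Rightarrow> real \<Rightarrow> nat \<Rightarrow> (nat \<Rightarrow> int) \<Rightarrow> nat set \<Rightarrow> real" where
  "e_coeff q t n l J = (\<Prod>j<n. \<Prod>i<j. if i \<in> J \<and> j \<notin> J then e_factor q t (t ^ (j - i) * q powi (l i - l j)) else 1)"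

definition skew_coeff0 :: "real \<Rightarrow> real \<Rightarrow> nat \<Rightarrow> nat \<Rightarrow> (nat \<Rightarrow> int) \<Rightarrow> (nat \<Rightarrow> int) \<Rightarrow> real" where
  "skew_coeff0 q t n p l m = (if interlacing (\<lambda>_. 0) n p l m then skew_coeff q t (\<lambda>_. 0) n p l m else 0)"

text \<open>
  The last assumption, together with \<open>q_powi_eq_1\<close>, excludes all monomial relations between \<open>q\<close> and \<open>t\<close>. This keeps
  the denominators nonzero in the changes of variables below.
\<close>

locale generic_params =
  fixes q t :: real
  assumes abs_q: "\<bar>q\<bar> < 1" and q0 [simp]: "q \<noteq> 0"
    and abs_t: "\<bar>t\<bar> < 1" and t0 [simp]: "t \<noteq> 0"
    and independent: "\<And>a b. q powi a * t powi b = 1 \<Longrightarrow> b = 0"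
begin

abbreviation f where "f \<equiv> mac_f q t"
definition s where "s = t / q"

text \<open>
  The variable that represents the part in position \<open>j\<close>. The arguments of \<open>f\<close> in the weights are ratios of such
  variables, and adding \<open>1\<close> to a part multiplies its variable by \<open>q\<close>.
\<close>

definition pt :: "(nat \<Rightarrow> int) \<Rightarrow> nat \<Rightarrow> real" where
  "pt l j = q powi l j * t powi (- int j)"

lemma s0 [simp]: "s \<noteq> 0" by (simp add: s_def)
lemma pt0 [simp]: "pt l j \<noteq> 0" by (simp add: pt_def)

lemma t_exponents_eq: "q powi a * t powi b = q powi c * t powi d \<Longrightarrow> b = d"
  using independent[of "a - c" "b - d"] by (simp add: power_int_diff field_simps)

lemma q_powi_eq_1: 
  assumes "q powi a = 1" shows "a = 0"
proof -
  have *: "n = 0" if "q ^ n = 1" for n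
  proof (rule ccontr)
    assume "n \<noteq> 0"
    then have "\<bar>q\<bar> ^ n < 1" using abs_q by (simp add: power_less_one_iff)
    then show False using that by (simp flip: power_abs)
  qed
  show ?thesis
    using assms *[of "nat a"] *[of "nat (- a)"] by (auto simp: power_int_def power_inverse split: if_splits)
qed

lemma ratio_pt: "i \<le> j \<Longrightarrow> t ^ (j - i) * q powi (l i - m j) = pt l i / pt m j"
proof -
  assume "i \<le> j"
  then have "t ^ (j - i) = t powi (int j - int i)" by (simp add: power_int_def nat_diff_distrib)
  then show ?thesis
    by (simp add: pt_def power_int_diff power_int_minus field_simps)
qed

lemma ratio_pt': "i < j \<Longrightarrow> t ^ (j - i - 1) * q powi (l i - m j) = pt l i / (t * pt m j)"
proof -
  assume "i < j"
  then have "j - i = Suc (j - i - 1)" by simp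
  then have "t ^ (j - i) = t * t ^ (j - i - 1)" by (metis power_Suc)
  with ratio_pt[of i j l m] \<open>i < j\<close> show ?thesis by (simp add: field_simps)
qed

text \<open>
  The variables in different positions carry different powers of \<open>t\<close>, so they stay different when
  multiplied by powers of \<open>q\<close>.
\<close>

lemma pt_neq:
  assumes "q powi a * t powi b * pt l i = q powi c * t powi d * pt m j"
  shows "b - int i = d - int j"
proof -
  have "q powi (a + l i) * t powi (b - int i) = q powi (c + m j) * t powi (d - int j)"
    using assms by (simp add: pt_def power_int_add power_int_diff power_int_minus field_simps)
  then show ?thesis by (rule t_exponents_eq)
qed

lemma pt_neq_pt: "i \<noteq> j \<Longrightarrow> pt l i \<noteq> pt m j"
  using pt_neq[of 0 0 l i 0 0 m j] by auto

lemma pt_neq_q_pt: "i \<noteq> j \<Longrightarrow> pt l i \<noteq> q * pt m j"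
  using pt_neq[of 0 0 l i 1 0 m j] by auto

lemma pt_neq_s_pt: "j \<le> k \<Longrightarrow> pt m k \<noteq> s * pt l j"
  using pt_neq[of 0 0 m k "- 1" 1 l j] by (auto simp: s_def power_int_minus divide_inverse mult_ac)

lemma pt_neq_t_pt: "i < j \<Longrightarrow> t * pt l i \<noteq> pt m j"
  using pt_neq[of 0 1 l i 0 0 m j] by auto

lemma pt_lower: "pt (lower J l) j = (if j \<in> J then pt l j / q else pt l j)"
  by (simp add: pt_def lower_def power_int_diff)

lemma pt_raise: "pt (raise J l) j = (if j \<in> J then q * pt l j else pt l j)"
  by (simp add: pt_def raise_def power_int_add)

text \<open>
  The factor of a weight that couples the variable \<open>x\<close> of the larger signature, in position \<open>j\<close>, with the
  variable \<open>r\<close> of the smaller one, in position \<open>k\<close>.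
\<close>

definition mixed :: "real \<Rightarrow> real \<Rightarrow> nat \<Rightarrow> nat \<Rightarrow> real" where
  "mixed x r k j = (if j \<le> k then 1 / f (x / r) else 1 / f (r / (t * x)))"

definition mixed_base :: "real \<Rightarrow> real \<Rightarrow> nat \<Rightarrow> nat \<Rightarrow> real" where
  "mixed_base x r k j = (if j \<le> k then 1 / f (x / r) / (r - s * x) else 1 / f (q * r / (t * x)) / (r - x))"

text \<open>
  Lowering a part of the larger signature and raising one of the smaller signature have the same effect, division of
  \<open>x / r\<close> by \<open>q\<close>. It replaces the factor \<open>r - s * x\<close> by \<open>r - x\<close>, no matter which position comes first. For \<open>k < j\<close> the
  base is taken at the shifted point, since the value at the original point vanishes if \<open>q * r = t * x\<close>.
\<close>

lemma mixed_shift: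
  assumes "x \<noteq> 0" "r \<noteq> 0" "j \<le> k \<Longrightarrow> r \<noteq> s * x" "k < j \<Longrightarrow> r \<noteq> x"
  shows "mixed (if b then x / q else x) r k j =
    mixed_base x r k j * (if b then r - x else (if j \<le> k then 1 else 1 / s) * (r - s * x))"
proof (cases "j \<le> k")
  case True
  have "f (x / q / r) = (1 - t * (x / q / r)) / (1 - x / r) * f (x / r)"
    using mac_f_rec[OF abs_q, of t "x / q / r"] by simp
  also have "(1 - t * (x / q / r)) / (1 - x / r) = (r - s * x) / (r - x)"
    using assms by (simp add: s_def divide_simps)
  finally show ?thesis
    using True assms by (auto simp: mixed_def mixed_base_def)
next
  case False
  have "f (r / (t * x)) = (1 - r / x) / (1 - q * (r / (t * x))) * f (q * r / (t * x))"
    using mac_f_rec[OF abs_q, of t "r / (t * x)"] by simp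
  also have "(1 - r / x) / (1 - q * (r / (t * x))) = (r - x) / (1 / s * (r - s * x))"
  proof -
    have "(1 - r / x) / (1 - q * (r / (t * x))) = (- x * (1 - r / x)) / (- x * (1 - q * (r / (t * x))))"
      using assms by (intro mult_divide_mult_cancel_left[symmetric]) simp
    moreover have "- x * (1 - r / x) = r - x"
      using assms by (simp add: field_simps)
    moreover have "- x * (1 - q * (r / (t * x))) = 1 / s * (r - s * x)"
      using assms by (simp add: s_def field_simps)
    ultimately show ?thesis by (simp only:)
  qed
  finally show ?thesis
    using False assms by (auto simp: mixed_def mixed_base_def mult.commute[of r q])
qed

definition mixed_prod :: "nat \<Rightarrow> nat \<Rightarrow> (nat \<Rightarrow> real) \<Rightarrow> (nat \<Rightarrow> real) \<Rightarrow> real" where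
  "mixed_prod n p X R = (\<Prod>k<p. \<Prod>j<n. mixed (X j) (R k) k j)"

lemma skew_coeff_pt:
  assumes il: "interlacing (\<lambda>_. 0) n p l m" and np: "n \<le> Suc p" "p \<le> n"
  shows "skew_coeff q t (\<lambda>_. 0) n p l m =
    (\<Prod>j<p. \<Prod>i\<le>j. f (pt m i / pt m j)) * (\<Prod>j<n. \<Prod>i<j. f (pt l i / (t * pt l j))) * mixed_prod n p (pt l) (pt m)"
proof -
  have "mixed_prod n p (pt l) (pt m) = (\<Prod>k<p. \<Prod>j<n. (if j \<le> k then 1 / f (pt l j / pt m k) else 1) *
      (if k < j then 1 / f (pt m k / (t * pt l j)) else 1))"
    unfolding mixed_prod_def by (intro prod.cong) (auto simp: mixed_def)
  also have "\<dots> = (\<Prod>k<p. \<Prod>j<n. if j \<le> k then 1 / f (pt l j / pt m k) else 1) *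
      (\<Prod>j<n. \<Prod>k<p. if k < j then 1 / f (pt m k / (t * pt l j)) else 1)"
    unfolding prod.distrib by (subst (2) prod.swap) (rule refl)
  also have "(\<Prod>k<p. \<Prod>j<n. if j \<le> k then 1 / f (pt l j / pt m k) else 1) = (\<Prod>k<p. \<Prod>j\<le>k. 1 / f (pt l j / pt m k))"
    using np by (intro prod.cong refl prod.mono_neutral_cong_right) auto
  also have "(\<Prod>j<n. \<Prod>k<p. if k < j then 1 / f (pt m k / (t * pt l j)) else 1) =
      (\<Prod>j<n. \<Prod>k<j. 1 / f (pt m k / (t * pt l j)))"
    using np by (intro prod.cong refl prod.mono_neutral_cong_right) auto
  finally have 1: "mixed_prod n p (pt l) (pt m) = (\<Prod>j<p. \<Prod>i\<le>j. 1 / f (pt l i / pt m j)) * (\<Prod>j<n. \<Prod>i<j. 1 / f (pt m i / (t * pt l j)))" .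
  have "skew_coeff q t (\<lambda>_. 0) n p l m =
    (\<Prod>j<p. \<Prod>i\<le>j. f (t ^ (j - i) * q powi (m i - m j)) / f (t ^ (j - i) * q powi (l i - m j))) *
    (\<Prod>j<n. \<Prod>i<j. f (t ^ (j - i - 1) * q powi (l i - l j)) / f (t ^ (j - i - 1) * q powi (m i - l j)))"
    by (rule skew_coeff_eq_mac_f[OF abs_q abs_t il _ np]) simp
  also have "\<dots> = (\<Prod>j<p. \<Prod>i\<le>j. f (pt m i / pt m j) * (1 / f (pt l i / pt m j))) *
    (\<Prod>j<n. \<Prod>i<j. f (pt l i / (t * pt l j)) * (1 / f (pt m i / (t * pt l j))))"
    by (intro arg_cong2[of _ _ _ _ "(*)"] prod.cong refl) (simp_all only: lessThan_iff atMost_iff ratio_pt ratio_pt' times_divide_eq_right mult_1_right)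
  finally show ?thesis
    unfolding 1 prod.distrib by (simp only: mult_ac)
qed

text \<open>
  At negative powers of \<open>q\<close> the function \<open>f\<close> has a pole, which appears as the value \<open>0\<close> since division by zero yields
  zero. Either way the reciprocal, which is what occurs in \<open>mixed\<close>, is \<open>0\<close>.
\<close>

lemma mac_f_negative_power: "a < 0 \<Longrightarrow> f (q powi a) = 0"
proof -
  assume "a < 0"
  then have "q ^ nat (- a - 1) = q powi (- a - 1)"
    by (simp add: power_int_def)
  moreover have "q powi (1 + a + (- a - 1)) = q * q powi a * q powi (- a - 1)"
    by (simp only: power_int_add q0 simp_thms power_int_1_right)
  ultimately have "q * q powi a * q ^ nat (- a - 1) = 1"
    by simp
  then show ?thesis
    by (simp add: mac_f_def qpoch_eq_0[OF abs_q])
qed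

text \<open>
  Hence pairs that do not interlace drop out of the sums by themselves.
\<close>

lemma mixed_prod_eq_0:
  assumes "\<not> interlacing (\<lambda>_. 0) n p l m" "n \<le> Suc p" "p \<le> n"
  shows "mixed_prod n p (pt l) (pt m) = 0"
proof -
  consider k where "k < p" "l k < m k" | k where "Suc k < n" "m k < l (Suc k)"
    using assms(1) by (auto simp: interlacing_def not_le)
  then show ?thesis
  proof cases
    case 1
    then have "mixed (pt l k) (pt m k) k k = 0"
      using mac_f_negative_power[of "l k - m k"] ratio_pt[of k k l m] by (simp add: mixed_def)
    then have *: "(\<Prod>j<n. mixed (pt l j) (pt m k) k j) = 0"
      using 1 assms by (intro prod_zero bexI[of _ k]) auto
    show ?thesis
      unfolding mixed_prod_def by (rule prod_zero, simp, rule bexI[of _ k], rule *) (use 1 in auto)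
  next
    case 2
    then have "mixed (pt l (Suc k)) (pt m k) k (Suc k) = 0"
      using mac_f_negative_power[of "m k - l (Suc k)"] ratio_pt'[of k "Suc k" m l] by (simp add: mixed_def)
    then have *: "(\<Prod>j<n. mixed (pt l j) (pt m k) k j) = 0"
      using 2 by (intro prod_zero bexI[of _ "Suc k"]) auto
    show ?thesis
      unfolding mixed_prod_def by (rule prod_zero, simp, rule bexI[of _ k], rule *) (use 2 assms in auto)
  qed
qed

text \<open>
  The factors of a weight that couple two parts of the larger signature change, when some parts are lowered, in the
  same way as the corresponding factors of a Vandermonde product whose variables are multiplied by \<open>s\<close>;
  \<open>e_coeff\<close> is made to achieve this.
\<close>

lemma column_pair:
  assumes nz: "x \<noteq> 0" "y \<noteq> 0" and neq: "x \<noteq> y" "x \<noteq> q * y" "x \<noteq> s * y"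
    and adm: "a \<and> \<not> b \<Longrightarrow> x \<noteq> t * y"
  shows "(if a \<and> \<not> b then e_factor q t (x / y) else 1) *
      f ((if a then x / q else x) / (t * (if b then y / q else y))) * ((y - x) * (if b then s else 1)) =
    f (x / (t * y)) * ((if b then s * y else y) - (if a then s * x else x))"
proof -
  consider "a" "b" | "\<not> a" "\<not> b" | "a" "\<not> b" | "\<not> a" "b" by blast
  then show ?thesis
  proof cases
    case 3
    define u where "u = x / y"
    have u: "u \<noteq> 1" "u \<noteq> q" "u \<noteq> t" "x = u * y"
      using assms 3 by (auto simp: u_def field_simps)
    have "f (u / q / t) = (1 - u / q) / (1 - u / t) * f (u / t)"
      using mac_f_rec[OF abs_q, of t "u / q / t"] by simp
    then have "e_factor q t u * f (u / q / t) = (1 - s * u) / (1 - u) * f (u / t)"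
      using u by (simp add: e_factor_def s_def)
    moreover have "y - s * x = (1 - s * u) / (1 - u) * (y - x)"
      using u by (simp add: divide_simps) (simp add: algebra_simps)
    moreover have "x / q / (t * y) = u / q / t" "x / (t * y) = u / t" "x / y = u"
      by (simp_all add: u_def mult_ac)
    ultimately show ?thesis
      using 3 by (simp only: simp_thms if_True if_False mult_1_right) (simp only: mult_ac)
  next
    case 4
    define u where "u = x / y"
    have u: "u \<noteq> 1" "u \<noteq> s" "x = u * y"
      using assms by (auto simp: u_def field_simps)
    have "1 - q * (u / t) \<noteq> 0"
      using u(2) by (auto simp: s_def field_simps)
    moreover have "f (u / t) = (1 - u) / (1 - q * (u / t)) * f (q * u / t)"
      using mac_f_rec[OF abs_q, of t "u / t"] by simp
    ultimately have "f (q * u / t) = (1 - q * (u / t)) / (1 - u) * f (u / t)"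
      using u by (simp add: field_simps)
    moreover have "s * y - x = (1 - q * (u / t)) / (1 - u) * ((y - x) * s)"
      using u by (simp add: s_def divide_simps) (simp add: algebra_simps)
    moreover have "x / (t * (y / q)) = q * u / t" "x / (t * y) = u / t"
      by (simp_all add: u_def mult_ac)
    ultimately show ?thesis
      using 4 by (simp only: simp_thms if_True if_False mult_1_right mult_1_left) (simp only: mult_ac)
  qed (simp_all add: algebra_simps)
qed

text \<open>
  The same for two raised parts of the smaller signature. The Vandermonde product is now that of the
  projective points \<open>(x : 1)\<close>, with the second coordinate multiplied by \<open>s\<close>.
\<close>

lemma row_pair:
  assumes nz: "x \<noteq> 0" "y \<noteq> 0" and neq: "x \<noteq> y" "q * x \<noteq> y" "t * x \<noteq> y"
  shows "(if a \<and> \<not> b then e_factor q t ((if a then q * x else x) / (if b then q * y else y)) else 1) *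
      f ((if a then q * x else x) / (if b then q * y else y)) * ((x - y) * (if a then s else 1)) =
    f (x / y) * (x * (if b then s else 1) - y * (if a then s else 1))"
proof -
  define u where "u = x / y"
  have u: "u \<noteq> 1" "q * u \<noteq> 1" "t * u \<noteq> 1" "x = u * y"
    using assms by (auto simp: u_def field_simps)
  consider "a" "b" | "\<not> a" "\<not> b" | "a" "\<not> b" | "\<not> a" "b" by blast
  then show ?thesis
  proof cases
    case 3
    have "f u = (1 - t * u) / (1 - q * u) * f (q * u)"
      by (rule mac_f_rec[OF abs_q])
    then have "f (q * u) = (1 - q * u) / (1 - t * u) * f u"
      using u by (simp add: field_simps)
    moreover have "e_factor q t (q * u) = (1 - u / s) * (1 - t * u) / ((1 - q * u) * (1 - u))"
      by (simp add: e_factor_def s_def mult_ac)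
    ultimately have "e_factor q t (q * u) * f (q * u) = (1 - u / s) / (1 - u) * f u"
      using u by simp
    moreover have "x - y * s = (1 - u / s) / (1 - u) * ((x - y) * s)"
      using u by (simp add: divide_simps) (simp add: algebra_simps)
    moreover have "q * x / y = q * u" "x / y = u"
      by (simp_all add: u_def)
    ultimately show ?thesis
      using 3 by (simp only: simp_thms if_True if_False mult_1_right) (simp only: mult_ac)
  next
    case 4
    have "f (u / q) = (1 - s * u) / (1 - u) * f u"
      using mac_f_rec[OF abs_q, of t "u / q"] by (simp add: s_def)
    moreover have "x * s - y = (1 - s * u) / (1 - u) * (x - y)"
      using u by (simp add: divide_simps) (simp add: algebra_simps)
    moreover have "x / (q * y) = u / q" "x / y = u"
      by (simp_all add: u_def)
    ultimately show ?thesis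
      using 4 by (simp only: simp_thms if_True if_False mult_1_right mult_1_left) (simp only: mult_ac)
  qed (simp_all add: algebra_simps)
qed

text \<open>
  What the terms of the sums over all sets of lowered or raised positions have in common.
\<close>

definition term_const :: "nat \<Rightarrow> nat \<Rightarrow> (nat \<Rightarrow> int) \<Rightarrow> (nat \<Rightarrow> int) \<Rightarrow> real" where
  "term_const n p l m = (\<Prod>j<p. \<Prod>i\<le>j. f (pt m i / pt m j)) * (\<Prod>j<n. \<Prod>i<j. f (pt l i / (t * pt l j))) *
     (\<Prod>k<p. \<Prod>j<n. mixed_base (pt l j) (pt m k) k j)"

text \<open>
  Counts the pairs \<open>k < j\<close> for the powers of \<open>s\<close> produced by \<open>mixed_shift\<close>.
\<close>

lemma s_power_strict_triangle:
  "(\<Prod>k<p. \<Prod>j<n. if j \<le> k then 1 else 1 / s) * s ^ c = 1" if "c = (\<Sum>j<n. j)" "p \<le> n" "n \<le> Suc p" 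
proof -
  have "(\<Prod>k<p. \<Prod>j<n. if j \<le> k then 1 else 1 / s) = (\<Prod>j<n. \<Prod>k<p. if j \<le> k then 1 else 1 / s)"
    by (rule prod.swap)
  also have "\<dots> = (\<Prod>j<n. \<Prod>k<j. 1 / s)"
    using that by (intro prod.cong refl prod.mono_neutral_cong_right) auto
  also have "\<dots> = (\<Prod>j<n. (1 / s) ^ j)"
    by simp
  also have "\<dots> = (1 / s) ^ c"
    by (simp only: that power_sum)
  finally show ?thesis
    by (simp add: power_one_over)
qed

lemma column_mixed_prod:
  assumes "p \<le> n" "n \<le> Suc p"
  shows "mixed_prod n p (pt (lower J l)) (pt m) * s ^ (\<Sum>j<n. j) =
    (\<Prod>k<p. \<Prod>j<n. mixed_base (pt l j) (pt m k) k j) * s ^ (\<Sum>j\<in>{..<n} \<inter> J. j) * (\<Prod>k<p. \<Prod>j<n. pt m k - scale_on s (- J) (pt l) j)"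
proof -
  have 1: "mixed (pt (lower J l) j) (pt m k) k j = mixed_base (pt l j) (pt m k) k j *
      (pt m k - scale_on s (- J) (pt l) j) * ((if j \<le> k then 1 else 1 / s) * (if j \<in> J \<and> k < j then s else 1))" for k j
    using mixed_shift[of "pt l j" "pt m k" j k "j \<in> J"] pt_neq_s_pt[of j k m l] pt_neq_pt[of k j m l]
    by (auto simp: pt_lower scale_on_def)
  have "(\<Prod>k<p. \<Prod>j<n. if j \<in> J \<and> k < j then s else 1) = (\<Prod>j<n. \<Prod>k<p. if j \<in> J \<and> k < j then s else 1)"
    by (rule prod.swap)
  also have "\<dots> = (\<Prod>j<n. if j \<in> J then s ^ j else 1)"
  proof (rule prod.cong[OF refl])
    fix j assume "j \<in> {..<n}"
    then have "{..<p} \<inter> {k. k < j} = {..<j}" using assms by auto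
    then show "(\<Prod>k<p. if j \<in> J \<and> k < j then s else 1) = (if j \<in> J then s ^ j else 1)"
      by (simp add: prod.If_cases)
  qed
  also have "\<dots> = (\<Prod>j\<in>{..<n} \<inter> J. s ^ j)"
    by (simp add: prod.If_cases Collect_mem_eq)
  also have "\<dots> = s ^ (\<Sum>j\<in>{..<n} \<inter> J. j)"
    by (simp only: power_sum)
  finally have 2: "(\<Prod>k<p. \<Prod>j<n. if j \<in> J \<and> k < j then s else 1) = s ^ (\<Sum>j\<in>{..<n} \<inter> J. j)" .
  show ?thesis
    unfolding mixed_prod_def 1 prod.distrib 2
    using s_power_strict_triangle[OF refl assms] by (simp add: mult_ac)
qed

lemma column_two_body:
  assumes l: "\<And>i j. i \<le> j \<Longrightarrow> j < n \<Longrightarrow> l j \<le> l i" and np: "p \<le> n" "n \<le> Suc p"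
    and il: "interlacing (\<lambda>_. 0) n p (lower J l) m"
  shows "e_coeff q t n l J * (\<Prod>j<n. \<Prod>i<j. f (pt (lower J l) i / (t * pt (lower J l) j))) *
      ((\<Prod>j<n. \<Prod>i<j. pt l j - pt l i) * s ^ (\<Sum>j\<in>{..<n} \<inter> J. j)) =
    (\<Prod>j<n. \<Prod>i<j. f (pt l i / (t * pt l j))) * (\<Prod>j<n. \<Prod>i<j. scale_on s J (pt l) j - scale_on s J (pt l) i)"
proof -
  have "s ^ (\<Sum>j\<in>{..<n} \<inter> J. j) = (\<Prod>j\<in>{..<n} \<inter> J. s ^ j)"
    by (simp only: power_sum)
  also have "\<dots> = (\<Prod>j<n. if j \<in> J then s ^ j else 1)"
    by (simp add: prod.If_cases Collect_mem_eq)
  also have "\<dots> = (\<Prod>j<n. \<Prod>i<j. if j \<in> J then s else 1)"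
    by (intro prod.cong) auto
  finally have 1: "s ^ (\<Sum>j\<in>{..<n} \<inter> J. j) = \<dots>" .
  have 2: "(if i \<in> J \<and> j \<notin> J then e_factor q t (t ^ (j - i) * q powi (l i - l j)) else 1) *
      f (pt (lower J l) i / (t * pt (lower J l) j)) * ((pt l j - pt l i) * (if j \<in> J then s else 1)) =
    f (pt l i / (t * pt l j)) * (scale_on s J (pt l) j - scale_on s J (pt l) i)" if ij: "i < j" "j < n" for i j
  proof -
    have neq_s: "pt l i \<noteq> s * pt l j"
    proof
      assume *: "pt l i = s * pt l j"
      then have "- int i = 1 - int j"
        using pt_neq[of 0 0 l i "- 1" 1 l j] by (auto simp: s_def power_int_minus divide_inverse mult_ac)
      then have j: "j = Suc i" using ij by simp
      have "q powi (l i + 1 - l j) = 1"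
        using * by (simp add: j pt_def s_def power_int_add power_int_diff power_int_minus field_simps)
      then show False
        using q_powi_eq_1[of "l i + 1 - l j"] l[of i j] ij by simp
    qed
    \<comment> \<open>The numerator of \<open>e_factor\<close> vanishes if \<open>l i = l j\<close> with \<open>j = Suc i\<close>. Lowering the part \<open>i\<close> only
      would then destroy the order, which is excluded by interlacing.\<close>
    have adm: "pt l i \<noteq> t * pt l j" if "i \<in> J" "j \<notin> J"
    proof
      assume *: "pt l i = t * pt l j"
      then have "- int i = 1 - int j"
        using pt_neq[of 0 0 l i 0 1 l j] by auto
      then have j: "j = Suc i" using ij by simp
      have "q powi (l i - l j) = 1"
        using * by (simp add: j pt_def power_int_add power_int_diff power_int_minus field_simps)
      then have "l i = l j"
        using q_powi_eq_1[of "l i - l j"] by simp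
      then have "lower J l i < lower J l j"
        using that by (simp add: lower_def)
      moreover have "lower J l j \<le> m i" "m i \<le> lower J l i"
        using il ij np by (auto simp: interlacing_def j)
      ultimately show False by simp
    qed
    show ?thesis
      unfolding pt_lower scale_on_def ratio_pt[OF less_imp_le[OF ij(1)]]
      by (rule column_pair) (use ij neq_s adm in \<open>auto simp: pt_neq_pt pt_neq_q_pt\<close>)
  qed
  have "e_coeff q t n l J * (\<Prod>j<n. \<Prod>i<j. f (pt (lower J l) i / (t * pt (lower J l) j))) *
      ((\<Prod>j<n. \<Prod>i<j. pt l j - pt l i) * s ^ (\<Sum>j\<in>{..<n} \<inter> J. j)) =
    (\<Prod>j<n. \<Prod>i<j. (if i \<in> J \<and> j \<notin> J then e_factor q t (t ^ (j - i) * q powi (l i - l j)) else 1) *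
      f (pt (lower J l) i / (t * pt (lower J l) j)) * ((pt l j - pt l i) * (if j \<in> J then s else 1)))"
    unfolding e_coeff_def 1 prod.distrib by (simp only: mult_ac)
  also have "\<dots> = (\<Prod>j<n. \<Prod>i<j. f (pt l i / (t * pt l j)) * (scale_on s J (pt l) j - scale_on s J (pt l) i))"
    using 2 by (intro prod.cong refl) auto
  finally show ?thesis by (simp only: prod.distrib)
qed

text \<open>
  Up to a factor that does not depend on \<open>J\<close>, a term of the sum over lowered positions is a term of a Cauchy sum
  with \<open>x = pt m\<close> and \<open>y = pt l\<close>. For pairs that do not interlace both sides are zero.
\<close>

lemma column_term:
  assumes l: "\<And>i j. i \<le> j \<Longrightarrow> j < n \<Longrightarrow> l j \<le> l i" and np: "p \<le> n" "n \<le> Suc p"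
  shows "e_coeff q t n l J * skew_coeff0 q t n p (lower J l) m * (s ^ (\<Sum>j<n. j) * (\<Prod>j<n. \<Prod>i<j. pt l j - pt l i)) =
    term_const n p l m * (\<Prod>j<n. \<Prod>i<j. scale_on s J (pt l) j - scale_on s J (pt l) i) *
    (\<Prod>k<p. \<Prod>j<n. pt m k - scale_on s (- J) (pt l) j)"
proof (cases "interlacing (\<lambda>_. 0) n p (lower J l) m")
  case True
  define S where "S = s ^ (\<Sum>j\<in>{..<n} \<inter> J. j)"
  have S: "S \<noteq> 0" by (simp add: S_def)
  note two = column_two_body[OF l np True, folded S_def]
  note mix = column_mixed_prod[OF np, of J l m, folded S_def]
  have regroup: "A * (B * D) * (C * S * E) = A * B * C * D * E * S" for A B C D E
    by (simp only: mult_ac)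
  have "e_coeff q t n l J * skew_coeff0 q t n p (lower J l) m * (s ^ (\<Sum>j<n. j) * (\<Prod>j<n. \<Prod>i<j. pt l j - pt l i)) * S =
    (\<Prod>j<p. \<Prod>i\<le>j. f (pt m i / pt m j)) *
    (e_coeff q t n l J * (\<Prod>j<n. \<Prod>i<j. f (pt (lower J l) i / (t * pt (lower J l) j))) * ((\<Prod>j<n. \<Prod>i<j. pt l j - pt l i) * S)) *
    (mixed_prod n p (pt (lower J l)) (pt m) * s ^ (\<Sum>j<n. j))"
    using True unfolding skew_coeff0_def by (simp only: if_True skew_coeff_pt[OF True np(2,1)]) (simp only: mult_ac)
  also have "\<dots> = term_const n p l m * (\<Prod>j<n. \<Prod>i<j. scale_on s J (pt l) j - scale_on s J (pt l) i) *
    (\<Prod>k<p. \<Prod>j<n. pt m k - scale_on s (- J) (pt l) j) * S"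
    unfolding term_const_def
    by (rule trans[OF arg_cong2[of _ _ _ _ "(*)", OF arg_cong2[of _ _ _ _ "(*)", OF refl two] mix]], assumption, assumption, rule regroup)
  finally show ?thesis using S by simp
next
  case False
  have "(\<Prod>k<p. \<Prod>j<n. mixed_base (pt l j) (pt m k) k j) * (\<Prod>k<p. \<Prod>j<n. pt m k - scale_on s (- J) (pt l) j) = 0"
    using column_mixed_prod[OF np, of J l m] mixed_prod_eq_0[OF False np(2,1)] by auto
  then have "term_const n p l m * X * (\<Prod>k<p. \<Prod>j<n. pt m k - scale_on s (- J) (pt l) j) = 0" for X
    by (rule disjE[OF mult_eq_0_iff[THEN iffD1]]) (simp_all only: term_const_def mult_zero_left mult_zero_right)
  then show ?thesis
    using False by (simp only: skew_coeff0_def if_False mult_zero_left mult_zero_right)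
qed

lemma row_mixed_prod:
  assumes "n = Suc p" "I \<subseteq> {..<p}"
  shows "mixed_prod n p (pt l) (pt (raise I m)) * s ^ (\<Sum>j<n. j) =
    (\<Prod>k<p. \<Prod>j<n. mixed_base (pt l j) (pt m k) k j) * s ^ (\<Sum>i\<in>I. p - i) *
    (\<Prod>k<p. \<Prod>j<n. pt m k - scale_on s (- I) (\<lambda>_. 1) k * pt l j)"
proof -
  have 1: "mixed (pt l j) (pt (raise I m) k) k j = mixed_base (pt l j) (pt m k) k j *
      (pt m k - scale_on s (- I) (\<lambda>_. 1) k * pt l j) * ((if j \<le> k then 1 else 1 / s) * (if k \<in> I \<and> k < j then s else 1))" for k j
  proof -
    have "mixed (pt l j) (pt (raise I m) k) k j = mixed (if k \<in> I then pt l j / q else pt l j) (pt m k) k j"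
      by (simp add: mixed_def pt_raise mult_ac)
    then show ?thesis
      using mixed_shift[of "pt l j" "pt m k" j k "k \<in> I"] pt_neq_s_pt[of j k m l] pt_neq_pt[of k j m l]
      by (auto simp: scale_on_def)
  qed
  have "(\<Prod>k<p. \<Prod>j<n. if k \<in> I \<and> k < j then s else 1) = (\<Prod>k<p. if k \<in> I then s ^ (p - k) else 1)"
  proof (rule prod.cong[OF refl])
    fix k assume "k \<in> {..<p}"
    then have "{..<n} \<inter> {j. k < j} = {k<..p}" using assms by auto
    then show "(\<Prod>j<n. if k \<in> I \<and> k < j then s else 1) = (if k \<in> I then s ^ (p - k) else 1)"
      by (simp add: prod.If_cases)
  qed
  also have "\<dots> = (\<Prod>k\<in>{..<p} \<inter> I. s ^ (p - k))"
    by (simp add: prod.If_cases Collect_mem_eq)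
  also have "{..<p} \<inter> I = I" using assms(2) by auto
  also have "(\<Prod>k\<in>I. s ^ (p - k)) = s ^ (\<Sum>i\<in>I. p - i)"
    by (simp only: power_sum)
  finally have 2: "(\<Prod>k<p. \<Prod>j<n. if k \<in> I \<and> k < j then s else 1) = s ^ (\<Sum>i\<in>I. p - i)" .
  have *: "(\<Prod>k<p. \<Prod>j<n. if j \<le> k then 1 else 1 / s) * s ^ (\<Sum>j<n. j) = 1"
    by (rule s_power_strict_triangle[OF refl]) (use assms in auto)
  have regroup: "A * B * (E * C) * D = A * C * B * (E * D)" for A B C D E :: real
    by (simp only: mult_ac)
  show ?thesis
    unfolding mixed_prod_def 1 prod.distrib 2 by (subst regroup) (simp only: * mult_1_right)
qed

lemma row_two_body:
  assumes I: "I \<subseteq> {..<p}"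
  shows "e_coeff q t p (raise I m) I * (\<Prod>j<p. \<Prod>i\<le>j. f (pt (raise I m) i / pt (raise I m) j)) *
      ((\<Prod>j<p. \<Prod>i<j. pt m i - pt m j) * s ^ (\<Sum>i\<in>I. p - i)) =
    (\<Prod>j<p. \<Prod>i\<le>j. f (pt m i / pt m j)) *
      ((\<Prod>j<p. \<Prod>i<j. pt m i * scale_on s I (\<lambda>_. 1) j - pt m j * scale_on s I (\<lambda>_. 1) i) * (\<Prod>i<p. scale_on s I (\<lambda>_. 1) i))"
proof -
  have "s ^ (\<Sum>i\<in>I. p - i) = (\<Prod>i\<in>{..<p} \<inter> I. s ^ (p - i))"
    using I by (simp add: power_sum Int_absorb1)
  also have "\<dots> = (\<Prod>i<p. if i \<in> I then s ^ (p - i) else 1)"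
    by (simp add: prod.If_cases Collect_mem_eq)
  also have "\<dots> = (\<Prod>i<p. (\<Prod>j<p. if i < j then if i \<in> I then s else 1 else 1) * scale_on s I (\<lambda>_. 1) i)"
  proof (rule prod.cong[OF refl])
    fix i assume i: "i \<in> {..<p}"
    then have "{..<p} \<inter> {j. i < j} = {i<..<p}" by auto
    moreover have "p - i = Suc (p - Suc i)" using i by auto
    ultimately show "(if i \<in> I then s ^ (p - i) else 1) = (\<Prod>j<p. if i < j then if i \<in> I then s else 1 else 1) * scale_on s I (\<lambda>_. 1) i"
      by (simp add: prod.If_cases scale_on_def)
  qed
  also have "\<dots> = (\<Prod>j<p. \<Prod>i<p. if i < j then if i \<in> I then s else 1 else 1) * (\<Prod>i<p. scale_on s I (\<lambda>_. 1) i)"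
    by (simp only: prod.distrib) (subst prod.swap, rule refl)
  also have "(\<Prod>j<p. \<Prod>i<p. if i < j then if i \<in> I then s else 1 else 1) = (\<Prod>j<p. \<Prod>i<j. if i \<in> I then s else 1)"
    by (intro prod.cong refl prod.mono_neutral_cong_right) auto
  finally have 1: "s ^ (\<Sum>i\<in>I. p - i) = (\<Prod>j<p. \<Prod>i<j. if i \<in> I then s else 1) * (\<Prod>i<p. scale_on s I (\<lambda>_. 1) i)" .
  have 2: "(if i \<in> I \<and> j \<notin> I then e_factor q t (t ^ (j - i) * q powi (raise I m i - raise I m j)) else 1) *
      f (pt (raise I m) i / pt (raise I m) j) * ((pt m i - pt m j) * (if i \<in> I then s else 1)) =
    f (pt m i / pt m j) * (pt m i * scale_on s I (\<lambda>_. 1) j - pt m j * scale_on s I (\<lambda>_. 1) i)" if ij: "i < j" for i j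
    unfolding pt_raise scale_on_def ratio_pt[OF less_imp_le[OF ij]] mult_1_right
    by (rule row_pair) (use ij pt_neq_q_pt[of j i m m] in \<open>auto simp: pt_neq_pt pt_neq_t_pt\<close>)
  have diag: "(\<Prod>j<p. \<Prod>i\<le>j. f (pt m' i / pt m' j)) = (\<Prod>j<p. \<Prod>i<j. f (pt m' i / pt m' j)) * (\<Prod>j<p. f 1)" for m'
    unfolding prod.distrib[symmetric] by (intro prod.cong) (simp_all flip: lessThan_Suc_atMost)
  have "e_coeff q t p (raise I m) I * (\<Prod>j<p. \<Prod>i<j. f (pt (raise I m) i / pt (raise I m) j)) *
      ((\<Prod>j<p. \<Prod>i<j. pt m i - pt m j) * (\<Prod>j<p. \<Prod>i<j. if i \<in> I then s else 1)) =
    (\<Prod>j<p. \<Prod>i<j. (if i \<in> I \<and> j \<notin> I then e_factor q t (t ^ (j - i) * q powi (raise I m i - raise I m j)) else 1) *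
      f (pt (raise I m) i / pt (raise I m) j) * ((pt m i - pt m j) * (if i \<in> I then s else 1)))"
    unfolding e_coeff_def prod.distrib by (simp only: mult_ac)
  also have "\<dots> = (\<Prod>j<p. \<Prod>i<j. f (pt m i / pt m j) * (pt m i * scale_on s I (\<lambda>_. 1) j - pt m j * scale_on s I (\<lambda>_. 1) i))"
    using 2 by (intro prod.cong refl) auto
  finally have 3: "e_coeff q t p (raise I m) I * (\<Prod>j<p. \<Prod>i<j. f (pt (raise I m) i / pt (raise I m) j)) *
      ((\<Prod>j<p. \<Prod>i<j. pt m i - pt m j) * (\<Prod>j<p. \<Prod>i<j. if i \<in> I then s else 1)) =
      (\<Prod>j<p. \<Prod>i<j. f (pt m i / pt m j)) * (\<Prod>j<p. \<Prod>i<j. pt m i * scale_on s I (\<lambda>_. 1) j - pt m j * scale_on s I (\<lambda>_. 1) i)"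
    by (simp only: prod.distrib)
  have regroup: "e * (F * z) * (D * (S * T)) = (e * F * (D * S)) * (z * T)" "F * z * (D * T) = F * D * (z * T)" for e F z D S T :: real
    by (simp_all only: mult_ac)
  show ?thesis
    unfolding diag 1 by (subst regroup(1), subst 3, rule regroup(2)[symmetric])
qed

text \<open>
  Likewise, a term of the sum over raised positions is a term of a dual Cauchy sum, up to the same factor.
\<close>

lemma row_term:
  assumes np: "n = Suc p" and I: "I \<subseteq> {..<p}"
  shows "e_coeff q t p (raise I m) I * skew_coeff0 q t n p l (raise I m) * (s ^ (\<Sum>j<n. j) * (\<Prod>j<p. \<Prod>i<j. pt m i - pt m j)) =
    term_const n p l m * ((\<Prod>j<p. \<Prod>i<j. pt m i * scale_on s I (\<lambda>_. 1) j - pt m j * scale_on s I (\<lambda>_. 1) i) * (\<Prod>i<p. scale_on s I (\<lambda>_. 1) i)) *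
    (\<Prod>k<p. \<Prod>j<n. pt m k - scale_on s (- I) (\<lambda>_. 1) k * pt l j)"
proof (cases "interlacing (\<lambda>_. 0) n p l (raise I m)")
  case True
  have np': "n \<le> Suc p" "p \<le> n" using np by auto
  define S where "S = s ^ (\<Sum>i\<in>I. p - i)"
  have S: "S \<noteq> 0" by (simp add: S_def)
  note two = row_two_body[OF I, of m, folded S_def]
  note mix = row_mixed_prod[OF np I, of l m, folded S_def]
  have regroup: "A * B * X * (C * S * E) = A * X * C * B * E * S" for A B C X E
    by (simp only: mult_ac)
  have "e_coeff q t p (raise I m) I * skew_coeff0 q t n p l (raise I m) * (s ^ (\<Sum>j<n. j) * (\<Prod>j<p. \<Prod>i<j. pt m i - pt m j)) * S =
    (e_coeff q t p (raise I m) I * (\<Prod>j<p. \<Prod>i\<le>j. f (pt (raise I m) i / pt (raise I m) j)) * ((\<Prod>j<p. \<Prod>i<j. pt m i - pt m j) * S)) *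
    (\<Prod>j<n. \<Prod>i<j. f (pt l i / (t * pt l j))) *
    (mixed_prod n p (pt l) (pt (raise I m)) * s ^ (\<Sum>j<n. j))"
    using True unfolding skew_coeff0_def by (simp only: if_True skew_coeff_pt[OF True np']) (simp only: mult_ac)
  also have "\<dots> = term_const n p l m * ((\<Prod>j<p. \<Prod>i<j. pt m i * scale_on s I (\<lambda>_. 1) j - pt m j * scale_on s I (\<lambda>_. 1) i) * (\<Prod>i<p. scale_on s I (\<lambda>_. 1) i)) *
    (\<Prod>k<p. \<Prod>j<n. pt m k - scale_on s (- I) (\<lambda>_. 1) k * pt l j) * S"
    unfolding term_const_def
    by (rule trans[OF arg_cong2[of _ _ _ _ "(*)", OF arg_cong2[of _ _ _ _ "(*)", OF two refl] mix] regroup])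
  finally show ?thesis using S by simp
next
  case False
  have np': "n \<le> Suc p" "p \<le> n" using np by auto
  have "(\<Prod>k<p. \<Prod>j<n. mixed_base (pt l j) (pt m k) k j) * (\<Prod>k<p. \<Prod>j<n. pt m k - scale_on s (- I) (\<lambda>_. 1) k * pt l j) = 0"
    using row_mixed_prod[OF np I, of l m] mixed_prod_eq_0[OF False np'] by auto
  then have "term_const n p l m * X * (\<Prod>k<p. \<Prod>j<n. pt m k - scale_on s (- I) (\<lambda>_. 1) k * pt l j) = 0" for X
    by (rule disjE[OF mult_eq_0_iff[THEN iffD1]]) (simp_all only: term_const_def mult_zero_left mult_zero_right)
  then show ?thesis
    using False by (simp only: skew_coeff0_def if_False mult_zero_left mult_zero_right)
qed

lemma pt_differences_nonzero: "(\<Prod>j<n. \<Prod>i<j. pt l j - pt l i) \<noteq> 0" "(\<Prod>j<n. \<Prod>i<j. pt l i - pt l j) \<noteq> 0"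
  using pt_neq_pt[of _ _ l l] by (fastforce simp: prod_zero_iff)+

text \<open>
  Up to a common factor both sides are the Cauchy sum for the rows \<open>(pt m i : 1)\<close>, one further row \<open>(1 : 0)\<close>, and the columns \<open>pt l j\<close>. Scaling
  leaves the point \<open>(1 : 0)\<close> fixed, so in the expansion along rows each set of the other rows occurs twice, once with
  and once without the last row, which accounts for the factor \<open>1 + w\<close>.
\<close>

lemma e_branching_polynomial:
  assumes l: "\<And>i j. i \<le> j \<Longrightarrow> j < Suc p \<Longrightarrow> l j \<le> l i"
  shows "(1 + w) * (\<Sum>I\<in>Pow {..<p}. w ^ card I * (e_coeff q t p (raise I m) I * skew_coeff0 q t (Suc p) p l (raise I m))) =
    (\<Sum>J\<in>Pow {..<Suc p}. w ^ card J * (e_coeff q t (Suc p) l J * skew_coeff0 q t (Suc p) p (lower J l) m))"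
proof -
  define x where "x = (\<lambda>i. if i < p then pt m i else 1)"
  define z where "z = (\<lambda>i. if i < p then 1 else (0::real))"
  define DX where "DX = (\<Prod>j<Suc p. \<Prod>i<j. pt l j - pt l i)"
  define DR where "DR = (\<Prod>j<p. \<Prod>i<j. pt m i - pt m j)"
  define c where "c = s ^ (\<Sum>j<Suc p. j)"
  define C where "C = term_const (Suc p) p l m"
  have nz: "DX \<noteq> 0" "DR \<noteq> 0" "c \<noteq> 0"
    by (simp_all add: DX_def DR_def c_def pt_differences_nonzero del: prod.lessThan_Suc)
  have col: "C * cauchy_sum s w (Suc p) x z (pt l) =
    (\<Sum>J\<in>Pow {..<Suc p}. w ^ card J * (e_coeff q t (Suc p) l J * skew_coeff0 q t (Suc p) p (lower J l) m)) * (c * DX * DR * (- 1) ^ p)"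
  proof -
    have "(\<Prod>j<Suc p. \<Prod>i<j. x i * z j - x j * z i) = DR * (- 1) ^ p"
      by (simp add: x_def z_def DR_def)
    moreover have "(\<Prod>k<Suc p. \<Prod>j<Suc p. x k - z k * scale_on s (- J) (pt l) j) =
      (\<Prod>k<p. \<Prod>j<Suc p. pt m k - scale_on s (- J) (pt l) j)" for J
      by (simp add: x_def z_def)
    ultimately have "C * (w ^ card J * (\<Prod>j<Suc p. \<Prod>i<j. (x i * z j - x j * z i) * (scale_on s J (pt l) j - scale_on s J (pt l) i)) *
       (\<Prod>i<Suc p. \<Prod>j<Suc p. x i - z i * scale_on s (- J) (pt l) j)) =
      w ^ card J * (e_coeff q t (Suc p) l J * skew_coeff0 q t (Suc p) p (lower J l) m) * (c * DX * DR * (- 1) ^ p)" for J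
      using column_term[of "Suc p" l p J m, OF l, folded DX_def c_def C_def]
      by (simp add: prod.distrib mult_ac del: prod.lessThan_Suc sum.lessThan_Suc)
    then show ?thesis
      unfolding cauchy_sum_def sum_distrib_left sum_distrib_right by (intro sum.cong) auto
  qed
  have row: "C * dual_cauchy_sum s w (Suc p) x z (pt l) =
    (1 + w) * (\<Sum>I\<in>Pow {..<p}. w ^ card I * (e_coeff q t p (raise I m) I * skew_coeff0 q t (Suc p) p l (raise I m))) * (c * DX * DR * (- 1) ^ p)"
  proof -
    define T where "T = (\<lambda>I. (\<Prod>j<Suc p. \<Prod>i<j. (x i * scale_on s I z j - x j * scale_on s I z i) * (pt l j - pt l i)) *
       (\<Prod>i<Suc p. \<Prod>j<Suc p. x i - scale_on s (- I) z i * pt l j))"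
    \<comment> \<open>Since \<open>z p = 0\<close>, scaling in the last row has no effect.\<close>
    have T_insert: "T (insert p I) = T I" if "I \<subseteq> {..<p}" for I
    proof -
      have "scale_on s (insert p I) z = scale_on s I z" "scale_on s (- insert p I) z = scale_on s (- I) z"
        by (auto simp: scale_on_def z_def fun_eq_iff)
      then show ?thesis by (simp only: T_def)
    qed
    have T: "C * T I = e_coeff q t p (raise I m) I * skew_coeff0 q t (Suc p) p l (raise I m) * (c * DX * DR * (- 1) ^ p)" if "I \<subseteq> {..<p}" for I
    proof -
      have sc: "scale_on s I z i = (if i < p then scale_on s I (\<lambda>_. 1) i else 0)" for I i
        by (simp add: scale_on_def z_def)
      have "(\<Prod>j<Suc p. \<Prod>i<j. x i * scale_on s I z j - x j * scale_on s I z i) =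
        (\<Prod>j<p. \<Prod>i<j. pt m i * scale_on s I (\<lambda>_. 1) j - pt m j * scale_on s I (\<lambda>_. 1) i) * (\<Prod>i<p. scale_on s I (\<lambda>_. 1) i) * (- 1) ^ p"
        by (simp add: sc x_def prod_uminus)
      moreover have "(\<Prod>k<Suc p. \<Prod>j<Suc p. x k - scale_on s (- I) z k * pt l j) =
        (\<Prod>k<p. \<Prod>j<Suc p. pt m k - scale_on s (- I) (\<lambda>_. 1) k * pt l j)"
        by (simp add: sc x_def)
      ultimately show ?thesis
        using row_term[OF refl that, of m l, folded DR_def c_def C_def]
        unfolding T_def DX_def[symmetric] prod.distrib by (simp add: mult_ac del: prod.lessThan_Suc sum.lessThan_Suc)
    qed
    have "dual_cauchy_sum s w (Suc p) x z (pt l) = (\<Sum>I\<in>Pow {..<Suc p}. w ^ card I * T I)"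
      by (simp add: dual_cauchy_sum_def T_def mult.assoc)
    also have "Pow {..<Suc p} = Pow {..<p} \<union> insert p ` Pow {..<p}"
      by (simp add: lessThan_Suc Pow_insert)
    also have "(\<Sum>I\<in>Pow {..<p} \<union> insert p ` Pow {..<p}. w ^ card I * T I) =
      (\<Sum>I\<in>Pow {..<p}. w ^ card I * T I) + (\<Sum>I\<in>insert p ` Pow {..<p}. w ^ card I * T I)"
      by (rule sum.union_disjoint) auto
    also have "(\<Sum>I\<in>insert p ` Pow {..<p}. w ^ card I * T I) = (\<Sum>I\<in>Pow {..<p}. w ^ card (insert p I) * T (insert p I))"
      by (rule sum.reindex[unfolded o_def]) (auto simp: inj_on_def)
    also have "\<dots> = (\<Sum>I\<in>Pow {..<p}. w * (w ^ card I * T I))"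
    proof (rule sum.cong[OF refl])
      fix I assume "I \<in> Pow {..<p}"
      then have "finite I" "p \<notin> I" "I \<subseteq> {..<p}" by (auto intro: finite_subset)
      then show "w ^ card (insert p I) * T (insert p I) = w * (w ^ card I * T I)"
        using T_insert[of I] by simp
    qed
    finally have "dual_cauchy_sum s w (Suc p) x z (pt l) = (1 + w) * (\<Sum>I\<in>Pow {..<p}. w ^ card I * T I)"
      by (simp only: distrib_right mult_1_left sum_distrib_left sum.distrib)
    then have "C * dual_cauchy_sum s w (Suc p) x z (pt l) = (1 + w) * (\<Sum>I\<in>Pow {..<p}. w ^ card I * (C * T I))"
      by (simp add: sum_distrib_left mult_ac)
    also have "\<dots> = (1 + w) * (\<Sum>I\<in>Pow {..<p}. w ^ card I * (e_coeff q t p (raise I m) I * skew_coeff0 q t (Suc p) p l (raise I m) * (c * DX * DR * (- 1) ^ p)))"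
      by (rule arg_cong[of _ _ "(*) (1 + w)"], rule sum.cong[OF refl]) (simp only: T Pow_iff)
    finally show ?thesis by (simp only: sum_distrib_left sum_distrib_right mult_ac)
  qed
  show ?thesis
    using col row nz unfolding cauchy_sum_duality by simp
qed

text \<open>
  Up to a common factor of both sides this is \<open>cauchy_sum_special\<close>: the quotient of the products of all \<open>pt l i\<close> and all \<open>pt m i\<close> is a power of \<open>q\<close>, as the
  powers of \<open>t\<close> cancel.
\<close>

lemma lowering_alternating_sum:
  assumes l: "\<And>i j. i \<le> j \<Longrightarrow> j < n \<Longrightarrow> l j \<le> l i"
  shows "(\<Sum>J\<in>Pow {..<n}. (- 1) ^ card J * (e_coeff q t n l J * skew_coeff0 q t n n (lower J l) m)) =
    q powi (\<Sum>i<n. l i - m i) * (\<Sum>J\<in>Pow {..<n}. (- s) ^ card J * (e_coeff q t n l J * skew_coeff0 q t n n (lower J l) m))"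
proof -
  define DX where "DX = (\<Prod>j<n. \<Prod>i<j. pt l j - pt l i)"
  define DR where "DR = (\<Prod>j<n. \<Prod>i<j. pt m i - pt m j)"
  define c where "c = s ^ (\<Sum>j<n. j)"
  define C where "C = term_const n n l m"
  have nz: "DX \<noteq> 0" "DR \<noteq> 0" "c \<noteq> 0"
    by (simp_all add: DX_def DR_def c_def pt_differences_nonzero)
  have col: "C * cauchy_sum s w n (pt m) (\<lambda>_. 1) (pt l) =
    (\<Sum>J\<in>Pow {..<n}. w ^ card J * (e_coeff q t n l J * skew_coeff0 q t n n (lower J l) m)) * (c * DX * DR)" for w
  proof -
    have "C * (w ^ card J * (\<Prod>j<n. \<Prod>i<j. (pt m i * 1 - pt m j * 1) * (scale_on s J (pt l) j - scale_on s J (pt l) i)) *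
       (\<Prod>i<n. \<Prod>j<n. pt m i - 1 * scale_on s (- J) (pt l) j)) =
      w ^ card J * (e_coeff q t n l J * skew_coeff0 q t n n (lower J l) m) * (c * DX * DR)" for J
      using column_term[of n l n J m, OF l, folded DX_def c_def C_def]
      by (simp add: prod.distrib mult_ac DR_def)
    then show ?thesis
      unfolding cauchy_sum_def sum_distrib_left sum_distrib_right by (intro sum.cong) auto
  qed
  have *: "q powi (\<Sum>i<n. l i - m i) * (\<Prod>i<n. pt m i) = (\<Prod>i<n. pt l i)"
  proof (induction n)
    case (Suc n)
    have "q powi (l n - m n) * pt m n = pt l n"
      by (simp add: pt_def power_int_diff)
    with Suc show ?case by (simp add: power_int_add mult_ac)
  qed simp
  have "(\<Prod>i<n. pt m i) * cauchy_sum s (- 1) n (pt m) (\<lambda>_. 1) (pt l) = (\<Prod>i<n. pt l i) * cauchy_sum s (- s) n (pt m) (\<lambda>_. 1) (pt l)"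
    by (rule cauchy_sum_special) simp
  also have "\<dots> = (\<Prod>i<n. pt m i) * (q powi (\<Sum>i<n. l i - m i) * cauchy_sum s (- s) n (pt m) (\<lambda>_. 1) (pt l))"
    unfolding *[symmetric] by (simp only: mult_ac)
  finally have "(\<Prod>i<n. pt m i) * cauchy_sum s (- 1) n (pt m) (\<lambda>_. 1) (pt l) = \<dots>" .
  moreover have "(\<Prod>i<n. pt m i) \<noteq> 0"
    by simp
  ultimately have "cauchy_sum s (- 1) n (pt m) (\<lambda>_. 1) (pt l) = q powi (\<Sum>i<n. l i - m i) * cauchy_sum s (- s) n (pt m) (\<lambda>_. 1) (pt l)"
    by (simp only: mult_left_cancel simp_thms)
  then have "C * cauchy_sum s (- 1) n (pt m) (\<lambda>_. 1) (pt l) = q powi (\<Sum>i<n. l i - m i) * (C * cauchy_sum s (- s) n (pt m) (\<lambda>_. 1) (pt l))"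
    by simp
  then show ?thesis
    unfolding col using nz by simp
qed

end

section \<open>Laurent polynomials and the branching rule\<close>

abbreviation (input) lookup :: "('a \<Rightarrow>\<^sub>0 'b :: zero) \<Rightarrow> 'a \<Rightarrow> 'b" where "lookup \<equiv> Poly_Mapping.lookup"
abbreviation (input) single :: "'a \<Rightarrow> 'b \<Rightarrow> 'a \<Rightarrow>\<^sub>0 'b :: zero" where "single \<equiv> Poly_Mapping.single"
abbreviation (input) keys :: "('a \<Rightarrow>\<^sub>0 'b :: zero) \<Rightarrow> 'a set" where "keys \<equiv> Poly_Mapping.keys"

lemma lookup_single_mult:
  fixes p :: laurent_poly
  shows "lookup (single a c * p) d = c * lookup p (d - a)"
proof -
  have "(\<Sum>b. lookup p b when d = a + b) = lookup p (d - a)"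
  proof -
    have "(d = a + b) = (b = d - a)" for b by (auto simp: algebra_simps)
    then show ?thesis by simp
  qed
  then show ?thesis
    by (simp add: lookup_mult lookup_single when_mult)
qed

lemma lookup_const_mult: "lookup (const c * p) d = c * lookup p d"
  by (simp add: const_def lookup_single_mult)

lemma lookup_x_pow_mult: "lookup (x_pow i e * p) d = lookup p (d - single i e)"
  by (simp add: x_pow_def lookup_single_mult)

lemma const_0 [simp]: "const 0 = 0" by (simp add: const_def)
lemma const_1 [simp]: "const 1 = 1" by (simp add: const_def)
lemma const_mult: "const (a * b) = const a * const b" by (simp add: const_def mult_single)
lemma const_power: "const (a ^ n) = const a ^ n" by (induction n) (auto simp: const_mult)
lemma const_add: "const (a + b) = const a + const b" by (simp add: const_def single_add)
lemma const_uminus: "const (- a) = - const a" by (simp add: const_def single_uminus)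
lemma const_diff: "const (a - b) = const a - const b" by (simp add: const_def single_diff)
lemma const_sum: "const (sum f A) = (\<Sum>x\<in>A. const (f x))"
  by (induction A rule: infinite_finite_induct) (auto simp: const_add)
lemma x_pow_add: "x_pow i (a + b) = x_pow i a * x_pow i b"
  by (simp add: x_pow_def mult_single single_add)
lemma x_pow_0 [simp]: "x_pow i 0 = 1" by (simp add: x_pow_def)

lemma const_mult_cancel: "c \<noteq> 0 \<Longrightarrow> const c * a = const c * b \<Longrightarrow> a = b"
  by (intro poly_mapping_eqI) (metis lookup_const_mult mult_left_cancel)

lemma finite_interlace: "finite {\<mu>. \<mu> \<prec>\<^sub>P lam}"
proof (rule finite_subset)
  show "{\<mu>. \<mu> \<prec>\<^sub>P lam} \<subseteq> {\<mu>. set \<mu> \<subseteq> {Min (set lam)..Max (set lam)} \<and> length \<mu> = length lam - 1}"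
  proof (intro subsetI CollectI conjI)
    fix \<mu> x assume "\<mu> \<in> {\<mu>. \<mu> \<prec>\<^sub>P lam}" and x: "x \<in> set \<mu>"
    then have il: "\<mu> \<prec>\<^sub>P lam" by simp
    then obtain i where i: "i < length \<mu>" "x = \<mu> ! i" using x by (auto simp: in_set_conv_nth)
    then have "lam ! Suc i \<le> x" "x \<le> lam ! i" "lam ! i \<in> set lam" "lam ! Suc i \<in> set lam"
      using il by (auto simp: interlace_def)
    then show "x \<in> {Min (set lam)..Max (set lam)}"
      by (meson List.finite_set Max_ge Min_le atLeastAtMost_iff order_trans)
  qed (auto simp: interlace_def)
  show "finite {\<mu>. set \<mu> \<subseteq> {Min (set lam)..Max (set lam)} \<and> length \<mu> = length lam - 1}"
    by (rule finite_lists_length_eq) simp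
qed

lemma Sig_nth: "lam \<in> Sig n \<Longrightarrow> i \<le> j \<Longrightarrow> j < n \<Longrightarrow> lam ! j \<le> lam ! i"
  by (cases "i = j") (auto simp: Sig_def sorted_wrt_iff_nth_less)

lemma SigI:
  assumes "length lam = n" "\<And>i. Suc i < n \<Longrightarrow> lam ! Suc i \<le> lam ! i"
  shows "lam \<in> Sig n"
proof -
  have "lam ! j \<le> lam ! i" if "i \<le> j" "j < n" for i j
    using that by (induction j rule: dec_induct) (use assms(2) in \<open>force intro: order_trans\<close>)+
  then show ?thesis
    using assms(1) by (auto simp: Sig_def sorted_wrt_iff_nth_less)
qed

lemma interlace_Sig:
  assumes "\<mu> \<prec>\<^sub>P lam"
  shows "lam \<in> Sig (length lam)" "\<mu> \<in> Sig (length \<mu>)"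
proof -
  have *: "lam ! Suc i \<le> \<mu> ! i" "\<mu> ! i \<le> lam ! i" if "i < length \<mu>" for i
    using assms that by (auto simp: interlace_def)
  have len: "length lam = Suc (length \<mu>)"
    using assms by (simp add: interlace_def)
  show "lam \<in> Sig (length lam)"
    using * len by (intro SigI) (auto intro: order_trans)
  show "\<mu> \<in> Sig (length \<mu>)"
    by (intro SigI order_trans[OF *(2) *(1)]) auto
qed

lemma chains_Nil: "chains [] = {[[]]}"
  by (auto simp: chains_def length_Suc_conv Sig_def)

lemma macdonald_P_Nil [simp]: "macdonald_P q t [] vs = 1"
  by (simp add: macdonald_P_def chains_Nil)

lemma macdonald_P_not_Sig: "lam \<notin> Sig (length lam) \<Longrightarrow> macdonald_P q t lam vs = 0"
  by (auto simp: macdonald_P_def chains_def intro!: sum.neutral)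

text \<open>
  Chains are built up by appending the last signature.
\<close>

lemma chains_snoc_bij:
  assumes len: "length lam = Suc n"
  shows "bij_betw (\<lambda>(\<mu>, \<Lambda>). \<Lambda> @ [lam]) (SIGMA \<mu>:{\<mu>. \<mu> \<prec>\<^sub>P lam}. chains \<mu>) (chains lam)"
proof (rule bij_betwI[where g = "\<lambda>\<Lambda>. (\<Lambda> ! n, butlast \<Lambda>)"])
  show "(\<lambda>(\<mu>, \<Lambda>). \<Lambda> @ [lam]) \<in> (SIGMA \<mu>:{\<mu>. \<mu> \<prec>\<^sub>P lam}. chains \<mu>) \<rightarrow> chains lam"
  proof safe
    fix \<mu> \<Lambda> assume il: "\<mu> \<prec>\<^sub>P lam" and \<Lambda>: "\<Lambda> \<in> chains \<mu>"
    have "length \<mu> = n" using il len by (simp add: interlace_def)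
    with \<Lambda> il interlace_Sig[OF il] len show "\<Lambda> @ [lam] \<in> chains lam"
      by (auto simp: chains_def nth_append less_Suc_eq le_Suc_eq)
  qed
  show "(\<lambda>\<Lambda>. (\<Lambda> ! n, butlast \<Lambda>)) \<in> chains lam \<rightarrow> (SIGMA \<mu>:{\<mu>. \<mu> \<prec>\<^sub>P lam}. chains \<mu>)"
  proof
    fix \<Lambda> assume \<Lambda>: "\<Lambda> \<in> chains lam"
    then have "length (\<Lambda> ! n) = n" "\<Lambda> ! n \<prec>\<^sub>P lam"
      using len by (auto simp: chains_def Sig_def)
    moreover from this \<Lambda> have "butlast \<Lambda> \<in> chains (\<Lambda> ! n)"
      using len by (auto simp: chains_def nth_butlast)
    ultimately show "(\<Lambda> ! n, butlast \<Lambda>) \<in> (SIGMA \<mu>:{\<mu>. \<mu> \<prec>\<^sub>P lam}. chains \<mu>)"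
      by auto
  qed
next
  fix x assume "x \<in> (SIGMA \<mu>:{\<mu>. \<mu> \<prec>\<^sub>P lam}. chains \<mu>)"
  show "(((case x of (\<mu>, \<Lambda>) \<Rightarrow> \<Lambda> @ [lam]) ! n), butlast (case x of (\<mu>, \<Lambda>) \<Rightarrow> \<Lambda> @ [lam])) = x"
    using \<open>x \<in> _\<close> len by (auto simp: chains_def interlace_def nth_append)
next
  fix \<Lambda> assume "\<Lambda> \<in> chains lam"
  then have "length \<Lambda> = Suc (Suc n)" "\<Lambda> ! Suc n = lam"
    using len by (auto simp: chains_def)
  then show "(case (\<Lambda> ! n, butlast \<Lambda>) of (\<mu>, \<Lambda>) \<Rightarrow> \<Lambda> @ [lam]) = \<Lambda>"
    by (cases \<Lambda> rule: rev_cases) (auto simp: nth_append)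
qed

lemma macdonald_P_branching:
  assumes len: "length lam = Suc n"
  shows "macdonald_P q t lam vs = (\<Sum>\<mu> | \<mu> \<prec>\<^sub>P lam.
     const (mac_psi q t lam \<mu>) * x_pow (vs ! n) (sum_list lam - sum_list \<mu>) * macdonald_P q t \<mu> vs)"
proof -
  define w where "w = (\<lambda>\<Lambda> i. const (mac_psi q t (\<Lambda> ! Suc i) (\<Lambda> ! i)) * x_pow (vs ! i) (sum_list (\<Lambda> ! Suc i) - sum_list (\<Lambda> ! i)))"
  have "macdonald_P q t lam vs = (\<Sum>\<Lambda>\<in>chains lam. \<Prod>i<Suc n. w \<Lambda> i)"
    by (simp add: macdonald_P_def w_def len)
  also have "\<dots> = (\<Sum>(\<mu>, \<Lambda>)\<in>(SIGMA \<mu>:{\<mu>. \<mu> \<prec>\<^sub>P lam}. chains \<mu>). \<Prod>i<Suc n. w (\<Lambda> @ [lam]) i)"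
    using sum.reindex_bij_betw[OF chains_snoc_bij[OF len], of "\<lambda>\<Lambda>. \<Prod>i<Suc n. w \<Lambda> i"]
    by (simp add: case_prod_unfold del: prod.lessThan_Suc)
  also have "\<dots> = (\<Sum>\<mu> | \<mu> \<prec>\<^sub>P lam. \<Sum>\<Lambda>\<in>chains \<mu>. \<Prod>i<Suc n. w (\<Lambda> @ [lam]) i)"
    by (subst sum.Sigma) (auto simp: finite_interlace finite_chains)
  also have "\<dots> = (\<Sum>\<mu> | \<mu> \<prec>\<^sub>P lam.
     const (mac_psi q t lam \<mu>) * x_pow (vs ! n) (sum_list lam - sum_list \<mu>) * macdonald_P q t \<mu> vs)"
  proof (rule sum.cong[OF refl])
    fix \<mu> assume "\<mu> \<in> {\<mu>. \<mu> \<prec>\<^sub>P lam}"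
    then have n: "length \<mu> = n" using len by (simp add: interlace_def)
    have "(\<Prod>i<Suc n. w (\<Lambda> @ [lam]) i) = const (mac_psi q t lam \<mu>) * x_pow (vs ! n) (sum_list lam - sum_list \<mu>) * (\<Prod>i<n. w \<Lambda> i)"
      if \<Lambda>: "\<Lambda> \<in> chains \<mu>" for \<Lambda>
    proof -
      have l: "length \<Lambda> = Suc n" "\<Lambda> ! n = \<mu>" using \<Lambda> n by (auto simp: chains_def)
      then have "(\<Prod>i<n. w (\<Lambda> @ [lam]) i) = (\<Prod>i<n. w \<Lambda> i)"
        by (intro prod.cong) (auto simp: w_def nth_append)
      moreover have "w (\<Lambda> @ [lam]) n = const (mac_psi q t lam \<mu>) * x_pow (vs ! n) (sum_list lam - sum_list \<mu>)"
        using l by (simp add: w_def nth_append)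
      ultimately show ?thesis by (simp add: mult_ac)
    qed
    then show "(\<Sum>\<Lambda>\<in>chains \<mu>. \<Prod>i<Suc n. w (\<Lambda> @ [lam]) i) =
      const (mac_psi q t lam \<mu>) * x_pow (vs ! n) (sum_list lam - sum_list \<mu>) * macdonald_P q t \<mu> vs"
      by (simp add: macdonald_P_def sum_distrib_left n w_def del: prod.lessThan_Suc)
  qed
  finally show ?thesis .
qed

section \<open>The Pieri rule for elementary symmetric polynomials\<close>

definition lower_list :: "nat set \<Rightarrow> int list \<Rightarrow> int list" where
  "lower_list J lam = map (lower J ((!) lam)) [0..<length lam]"

definition raise_list :: "nat set \<Rightarrow> int list \<Rightarrow> int list" where
  "raise_list J lam = map (raise J ((!) lam)) [0..<length lam]"

lemma length_lower_list [simp]: "length (lower_list J lam) = length lam" by (simp add: lower_list_def)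
lemma length_raise_list [simp]: "length (raise_list J lam) = length lam" by (simp add: raise_list_def)
lemma nth_lower_list: "i < length lam \<Longrightarrow> lower_list J lam ! i = lower J ((!) lam) i" by (simp add: lower_list_def)
lemma nth_raise_list: "i < length lam \<Longrightarrow> raise_list J lam ! i = raise J ((!) lam) i" by (simp add: raise_list_def)

lemma lower_raise_list [simp]: "lower_list J (raise_list J lam) = lam"
  by (intro nth_equalityI) (auto simp: nth_lower_list nth_raise_list lower_def raise_def)
lemma raise_lower_list [simp]: "raise_list J (lower_list J lam) = lam"
  by (intro nth_equalityI) (auto simp: nth_lower_list nth_raise_list lower_def raise_def)

lemma sum_list_lower_list:
  assumes "J \<subseteq> {..<length lam}"
  shows "sum_list (lower_list J lam) = sum_list lam - int (card J)"
proof -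
  have "sum_list (lower_list J lam) = (\<Sum>i<length lam. lam ! i - (if i \<in> J then 1 else 0))"
    by (simp add: lower_list_def interv_sum_list_conv_sum_set_nat atLeast0LessThan lower_def cong: sum.cong)
      (intro sum.cong, auto)
  also have "\<dots> = sum_list lam - (\<Sum>i<length lam. if i \<in> J then 1 else 0)"
    by (simp add: sum_subtractf sum_list_sum_nth atLeast0LessThan)
  also have "(\<Sum>i<length lam. if i \<in> J then 1 else 0) = int (card J)"
    using assms by (simp add: sum.If_cases Collect_mem_eq Int_absorb1)
  finally show ?thesis .
qed

lemma sum_list_raise_list: "J \<subseteq> {..<length lam} \<Longrightarrow> sum_list (raise_list J lam) = sum_list lam + int (card J)"
  using sum_list_lower_list[of J "raise_list J lam"] by simp

lemma skew_coeff_cong: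
  assumes "\<And>i. i < n \<Longrightarrow> l i = l' i" "\<And>i. i < p \<Longrightarrow> m i = m' i" "n \<le> Suc p" "p \<le> n"
  shows "skew_coeff q t h n p l m = skew_coeff q t h n p l' m'"
  unfolding skew_coeff_def using assms
  by (intro arg_cong2[of _ _ _ _ "(/)"] prod.cong refl if_cong arg_cong2[of _ _ _ _ "f_ratio q t"]) auto

lemma interlacing_cong:
  assumes "\<And>i. i < n \<Longrightarrow> l i = l' i" "\<And>i. i < p \<Longrightarrow> m i = m' i" "n \<le> Suc p" "p \<le> n"
  shows "interlacing h n p l m = interlacing h n p l' m'"
  unfolding interlacing_def using assms by auto

lemma skew_coeff0_cong:
  assumes "\<And>i. i < n \<Longrightarrow> l i = l' i" "\<And>i. i < p \<Longrightarrow> m i = m' i" "n \<le> Suc p" "p \<le> n"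
  shows "skew_coeff0 q t n p l m = skew_coeff0 q t n p l' m'"
  unfolding skew_coeff0_def using interlacing_cong[of n l l' p m m'] skew_coeff_cong[of n l l' p m m'] assms by simp

lemma e_coeff_cong: "(\<And>i. i < n \<Longrightarrow> l i = l' i) \<Longrightarrow> e_coeff q t n l J = e_coeff q t n l' J"
  unfolding e_coeff_def by (intro prod.cong refl) auto

lemma interlace_iff_interlacing:
  "length lam = Suc (length \<mu>) \<Longrightarrow> \<mu> \<prec>\<^sub>P lam \<longleftrightarrow> interlacing (\<lambda>_. 0) (length lam) (length \<mu>) ((!) lam) ((!) \<mu>)"
  by (auto simp: interlace_def interlacing_def)

text \<open>
  The sum may run over any larger finite set, because \<open>skew_coeff0\<close> vanishes on pairs that do not interlace.
\<close>

lemma macdonald_P_branching':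
  assumes "\<bar>q\<bar> < 1" "\<bar>t\<bar> < 1" "length lam = Suc n" "finite Y" "\<And>\<mu>. \<mu> \<prec>\<^sub>P lam \<Longrightarrow> \<mu> \<in> Y" "\<And>\<mu>. \<mu> \<in> Y \<Longrightarrow> length \<mu> = n"
  shows "macdonald_P q t lam vs = (\<Sum>\<mu>\<in>Y.
     const (skew_coeff0 q t (Suc n) n ((!) lam) ((!) \<mu>)) * x_pow (vs ! n) (sum_list lam - sum_list \<mu>) * macdonald_P q t \<mu> vs)"
  unfolding macdonald_P_branching[OF assms(3)]
proof (rule sum.mono_neutral_cong_left)
  show "\<forall>\<mu>\<in>Y - {\<mu>. \<mu> \<prec>\<^sub>P lam}. const (skew_coeff0 q t (Suc n) n ((!) lam) ((!) \<mu>)) * x_pow (vs ! n) (sum_list lam - sum_list \<mu>) *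
      macdonald_P q t \<mu> vs = 0"
  proof
    fix \<mu> assume "\<mu> \<in> Y - {\<mu>. \<mu> \<prec>\<^sub>P lam}"
    then have "\<not> \<mu> \<prec>\<^sub>P lam" "length \<mu> = n" using assms(6) by auto
    then have "skew_coeff0 q t (Suc n) n ((!) lam) ((!) \<mu>) = 0"
      using interlace_iff_interlacing[of lam \<mu>] assms(3) by (simp add: skew_coeff0_def)
    then show "const (skew_coeff0 q t (Suc n) n ((!) lam) ((!) \<mu>)) * x_pow (vs ! n) (sum_list lam - sum_list \<mu>) *
      macdonald_P q t \<mu> vs = 0" by simp
  qed
next
  show "finite Y" by (rule assms(4))
  show "{\<mu>. \<mu> \<prec>\<^sub>P lam} \<subseteq> Y" using assms(5) by blast
next
  fix \<mu> assume "\<mu> \<in> {\<mu>. \<mu> \<prec>\<^sub>P lam}"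
  then have il: "\<mu> \<prec>\<^sub>P lam" by simp
  then have "length \<mu> = n" using assms(3) by (simp add: interlace_def)
  then have "mac_psi q t lam \<mu> = skew_coeff0 q t (Suc n) n ((!) lam) ((!) \<mu>)"
    using mac_psi_eq_skew_coeff[OF assms(1,2) il, of 0] interlace_iff_interlacing[of lam \<mu>] il assms(3)
    by (simp add: skew_coeff0_def)
  then show "const (mac_psi q t lam \<mu>) * x_pow (vs ! n) (sum_list lam - sum_list \<mu>) * macdonald_P q t \<mu> vs =
      const (skew_coeff0 q t (Suc n) n ((!) lam) ((!) \<mu>)) * x_pow (vs ! n) (sum_list lam - sum_list \<mu>) * macdonald_P q t \<mu> vs"
    by simp
qed

text \<open>
  The generating function of the elementary symmetric polynomials in the inverses of the variables \<open>v 0, \<dots>, v (n - 1)\<close>.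
\<close>

definition e_series :: "(nat \<Rightarrow> nat) \<Rightarrow> nat \<Rightarrow> laurent_poly fps" where
  "e_series v n = (\<Prod>i<n. 1 + fps_const (x_pow (v i) (- 1)) * fps_X)"

lemma e_series_0: "fps_nth (e_series v n) 0 = 1"
  by (induction n) (auto simp: e_series_def)

lemma e_series_Suc: "fps_nth (e_series v (Suc n)) (Suc r) = fps_nth (e_series v n) (Suc r) + x_pow (v n) (- 1) * fps_nth (e_series v n) r"
proof -
  have "e_series v (Suc n) = e_series v n + fps_const (x_pow (v n) (- 1)) * (e_series v n * fps_X)"
    by (simp add: e_series_def algebra_simps)
  then show ?thesis by simp
qed

context generic_params
begin

text \<open>
  Comparison of the coefficients of a power of \<open>w\<close> in \<open>e_branching_polynomial\<close>.
\<close>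

lemma e_branching_coeff:
  assumes l: "\<And>i j. i \<le> j \<Longrightarrow> j < Suc p \<Longrightarrow> l j \<le> l i"
  shows "(\<Sum>I | I \<subseteq> {..<p} \<and> card I = Suc r. e_coeff q t p (raise I m) I * skew_coeff0 q t (Suc p) p l (raise I m)) +
      (\<Sum>I | I \<subseteq> {..<p} \<and> card I = r. e_coeff q t p (raise I m) I * skew_coeff0 q t (Suc p) p l (raise I m)) =
    (\<Sum>J | J \<subseteq> {..<Suc p} \<and> card J = Suc r. e_coeff q t (Suc p) l J * skew_coeff0 q t (Suc p) p (lower J l) m)"
proof -
  define A where "A = (\<lambda>I. e_coeff q t p (raise I m) I * skew_coeff0 q t (Suc p) p l (raise I m))"
  define C where "C = (\<lambda>J. e_coeff q t (Suc p) l J * skew_coeff0 q t (Suc p) p (lower J l) m)"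
  define PA where "PA = (\<Sum>I\<in>Pow {..<p}. monom (A I) (card I))"
  define PC where "PC = (\<Sum>J\<in>Pow {..<Suc p}. monom (C J) (card J))"
  have cA: "coeff PA k = (\<Sum>I | I \<subseteq> {..<p} \<and> card I = k. A I)" for k
  proof -
    have "coeff PA k = (\<Sum>I\<in>Pow {..<p}. if card I = k then A I else 0)"
      by (simp add: PA_def coeff_sum)
    also have "\<dots> = (\<Sum>I\<in>{I \<in> Pow {..<p}. card I = k}. A I)"
      by (rule sum.inter_filter[symmetric]) simp
    finally show ?thesis by simp
  qed
  have cC: "coeff PC k = (\<Sum>J | J \<subseteq> {..<Suc p} \<and> card J = k. C J)" for k
  proof -
    have "coeff PC k = (\<Sum>I\<in>Pow {..<Suc p}. if card I = k then C I else 0)"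
      by (simp add: PC_def coeff_sum)
    also have "\<dots> = (\<Sum>I\<in>{I \<in> Pow {..<Suc p}. card I = k}. C I)"
      by (rule sum.inter_filter[symmetric]) simp
    finally show ?thesis by simp
  qed
  have "poly ([:1, 1:] * PA) w = poly PC w" for w
    using e_branching_polynomial[of p l w m, OF l]
    by (simp add: PA_def PC_def A_def C_def poly_sum poly_monom mult.commute[of _ "w ^ _"] distrib_right del: Pow_insert)
  then have "[:1, 1:] * PA = PC"
    by (simp add: poly_eq_poly_eq_iff[symmetric] fun_eq_iff)
  then have "coeff PC (Suc r) = coeff ([:1, 1:] * PA) (Suc r)"
    by simp
  also have "\<dots> = coeff PA (Suc r) + coeff PA r"
    by simp
  finally show ?thesis
    unfolding cA cC by (simp add: A_def C_def)
qed

text \<open>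
  By induction on the number of variables: one may branch first and apply the rule to the remaining variables, or
  apply the rule first and then branch. The two results agree, for every signature that remains at the end, by
  \<open>e_branching_coeff\<close>. Sets \<open>J\<close> for which \<open>lower_list J lam\<close> is not a signature contribute zero.
\<close>

theorem e_pieri:
  "lam \<in> Sig n \<Longrightarrow> fps_nth (e_series ((!) vs) n) r * macdonald_P q t lam vs =
    (\<Sum>J | J \<subseteq> {..<n} \<and> card J = r. const (e_coeff q t n ((!) lam) J) * macdonald_P q t (lower_list J lam) vs)"
proof (induction n arbitrary: lam r)
  case 0
  then have lam: "lam = []" by (simp add: Sig_def)
  have *: "{J. J \<subseteq> {..<0::nat} \<and> card J = r} = (if r = 0 then {{}} else {})" by (auto simp: lessThan_0)
  show ?case
    unfolding * by (simp add: lam e_series_def lower_list_def e_coeff_def)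
next
  case (Suc p)
  have len: "length lam = Suc p" and dec: "\<And>i j. i \<le> j \<Longrightarrow> j < Suc p \<Longrightarrow> lam ! j \<le> lam ! i"
    using Suc.prems Sig_nth[of lam "Suc p"] by (auto simp: Sig_def)
  define x where "x = vs ! p"
  define P where "P = (\<lambda>\<mu>. macdonald_P q t \<mu> vs)"
  define e where "e = (\<lambda>n \<mu> J. e_coeff q t n ((!) \<mu>) J)"
  define sk where "sk = (\<lambda>lam \<mu>. skew_coeff0 q t (Suc p) p ((!) lam) ((!) \<mu>))"
  define Y where "Y = {\<rho>. length \<rho> = p \<and> set \<rho> \<subseteq> {lam ! p - 1..lam ! 0}}"
  have finY: "finite Y"
    unfolding Y_def using finite_lists_length_eq[of "{lam ! p - 1..lam ! 0}" p] by (simp add: conj_commute)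
  show ?case
  proof (cases r)
    case 0
    have *: "{J. J \<subseteq> {..<Suc p} \<and> card J = 0} = {{}}"
      using finite_subset[of _ "{..<Suc p}"] by auto
    have "lower_list {} lam = lam"
      by (intro nth_equalityI) (auto simp: nth_lower_list lower_def)
    then show ?thesis
      unfolding 0 * by (simp add: e_series_0 e_coeff_def)
  next
    case r: (Suc r')
    \<comment> \<open>All three sums become sums over the signatures \<open>\<rho>\<close> that remain after branching and lowering.
      The lower bound for the entries in \<open>Y\<close> leaves room for one lowering.\<close>
    define g where "g = (\<lambda>k \<rho>. \<Sum>I | I \<subseteq> {..<p} \<and> card I = k. e_coeff q t p (raise I ((!) \<rho>)) I *
        skew_coeff0 q t (Suc p) p ((!) lam) (raise I ((!) \<rho>)))"
    have Y_raise: "\<rho> \<in> Y" if "I \<subseteq> {..<p}" "raise_list I \<rho> \<prec>\<^sub>P lam" for I \<rho>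
    proof -
      have l: "length \<rho> = p" using that(2) len by (simp add: interlace_def)
      have "lam ! p - 1 \<le> \<rho> ! i \<and> \<rho> ! i \<le> lam ! 0" if i: "i < p" for i
      proof -
        have "lam ! Suc i \<le> raise I ((!) \<rho>) i" "raise I ((!) \<rho>) i \<le> lam ! i"
          using \<open>raise_list I \<rho> \<prec>\<^sub>P lam\<close> i l by (auto simp: interlace_def nth_raise_list)
        moreover have "lam ! p \<le> lam ! Suc i" "lam ! i \<le> lam ! 0" using dec i by auto
        ultimately show ?thesis by (auto simp: raise_def split: if_splits)
      qed
      then show ?thesis using l by (auto simp: Y_def in_set_conv_nth)
    qed
    have lower_sum: "x_pow x b * (fps_nth (e_series ((!) vs) p) k * P lam) =
      (\<Sum>\<rho>\<in>Y. const (g k \<rho>) * x_pow x (b + sum_list lam - sum_list \<rho> - int k) * P \<rho>)" for b k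
    proof -
      define G where "G = (\<lambda>I \<mu>. const (sk lam \<mu> * e p \<mu> I) * x_pow x (b + sum_list lam - sum_list \<mu>) * P (lower_list I \<mu>))"
      have "P lam = (\<Sum>\<mu> | \<mu> \<prec>\<^sub>P lam. const (sk lam \<mu>) * x_pow x (sum_list lam - sum_list \<mu>) * P \<mu>)"
        unfolding P_def sk_def x_def
        by (rule macdonald_P_branching'[OF abs_q abs_t len finite_interlace]) (auto simp: interlace_def len)
      then have "x_pow x b * (fps_nth (e_series ((!) vs) p) k * P lam) =
        (\<Sum>\<mu> | \<mu> \<prec>\<^sub>P lam. const (sk lam \<mu>) * x_pow x (b + (sum_list lam - sum_list \<mu>)) * (fps_nth (e_series ((!) vs) p) k * P \<mu>))"
        by (simp add: sum_distrib_left mult_ac x_pow_add)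
      also have "\<dots> = (\<Sum>\<mu> | \<mu> \<prec>\<^sub>P lam. \<Sum>I | I \<subseteq> {..<p} \<and> card I = k. G I \<mu>)"
      proof (rule sum.cong[OF refl])
        fix \<mu> assume "\<mu> \<in> {\<mu>. \<mu> \<prec>\<^sub>P lam}"
        then have "\<mu> \<in> Sig p" using interlace_Sig(2)[of \<mu> lam] len by (simp add: interlace_def)
        then have "fps_nth (e_series ((!) vs) p) k * P \<mu> = (\<Sum>I | I \<subseteq> {..<p} \<and> card I = k. const (e p \<mu> I) * P (lower_list I \<mu>))"
          unfolding P_def e_def by (rule Suc.IH)
        then show "const (sk lam \<mu>) * x_pow x (b + (sum_list lam - sum_list \<mu>)) * (fps_nth (e_series ((!) vs) p) k * P \<mu>) =
            (\<Sum>I | I \<subseteq> {..<p} \<and> card I = k. G I \<mu>)"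
          by (simp add: sum_distrib_left G_def const_mult mult_ac add_diff_eq)
      qed
      also have "\<dots> = (\<Sum>I | I \<subseteq> {..<p} \<and> card I = k. \<Sum>\<mu> | \<mu> \<prec>\<^sub>P lam. G I \<mu>)"
        by (rule sum.swap)
      also have "\<dots> = (\<Sum>I | I \<subseteq> {..<p} \<and> card I = k. \<Sum>\<rho>\<in>Y. const (e_coeff q t p (raise I ((!) \<rho>)) I *
        skew_coeff0 q t (Suc p) p ((!) lam) (raise I ((!) \<rho>))) * x_pow x (b + sum_list lam - sum_list \<rho> - int k) * P \<rho>)"
      proof (rule sum.cong[OF refl])
        fix I assume "I \<in> {I. I \<subseteq> {..<p} \<and> card I = k}"
        then have I: "I \<subseteq> {..<p}" "card I = k" by auto
        have "(\<Sum>\<mu> | \<mu> \<prec>\<^sub>P lam. G I \<mu>) = (\<Sum>\<rho> | \<rho> \<in> Y \<and> raise_list I \<rho> \<prec>\<^sub>P lam. G I (raise_list I \<rho>))"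
          by (rule sum.reindex_bij_witness[of _ "raise_list I" "lower_list I"]) (auto intro: Y_raise[OF I(1)])
        also have "\<dots> = (\<Sum>\<rho>\<in>Y. const (e_coeff q t p (raise I ((!) \<rho>)) I *
          skew_coeff0 q t (Suc p) p ((!) lam) (raise I ((!) \<rho>))) * x_pow x (b + sum_list lam - sum_list \<rho> - int k) * P \<rho>)"
        proof (rule sum.mono_neutral_cong_left[OF finY])
          have sk_eq: "sk lam (raise_list I \<rho>) = skew_coeff0 q t (Suc p) p ((!) lam) (raise I ((!) \<rho>))"
            and e_eq: "e p (raise_list I \<rho>) I = e_coeff q t p (raise I ((!) \<rho>)) I" if "\<rho> \<in> Y" for \<rho>
            unfolding sk_def e_def using that
            by (auto simp: Y_def nth_raise_list intro!: skew_coeff0_cong e_coeff_cong)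
          show "\<forall>\<rho>\<in>Y - {\<rho> \<in> Y. raise_list I \<rho> \<prec>\<^sub>P lam}. const (e_coeff q t p (raise I ((!) \<rho>)) I *
            skew_coeff0 q t (Suc p) p ((!) lam) (raise I ((!) \<rho>))) * x_pow x (b + sum_list lam - sum_list \<rho> - int k) * P \<rho> = 0"
          proof
            fix \<rho> assume \<rho>: "\<rho> \<in> Y - {\<rho> \<in> Y. raise_list I \<rho> \<prec>\<^sub>P lam}"
            then have "sk lam (raise_list I \<rho>) = 0"
              using interlace_iff_interlacing[of lam "raise_list I \<rho>"] len by (simp add: sk_def skew_coeff0_def Y_def)
            then show "const (e_coeff q t p (raise I ((!) \<rho>)) I *
              skew_coeff0 q t (Suc p) p ((!) lam) (raise I ((!) \<rho>))) * x_pow x (b + sum_list lam - sum_list \<rho> - int k) * P \<rho> = 0"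
              using sk_eq[of \<rho>] \<rho> by simp
          qed
          fix \<rho> assume \<rho>: "\<rho> \<in> {\<rho> \<in> Y. raise_list I \<rho> \<prec>\<^sub>P lam}"
          then have "sum_list (raise_list I \<rho>) = sum_list \<rho> + int k"
            using I by (subst sum_list_raise_list) (auto simp: Y_def)
          then show "G I (raise_list I \<rho>) = const (e_coeff q t p (raise I ((!) \<rho>)) I *
              skew_coeff0 q t (Suc p) p ((!) lam) (raise I ((!) \<rho>))) * x_pow x (b + sum_list lam - sum_list \<rho> - int k) * P \<rho>"
            using \<rho> sk_eq[of \<rho>] e_eq[of \<rho>] by (simp add: G_def algebra_simps)
        qed auto
        finally show "(\<Sum>\<mu> | \<mu> \<prec>\<^sub>P lam. G I \<mu>) = \<dots>" .
      qed
      also have "\<dots> = (\<Sum>\<rho>\<in>Y. const (g k \<rho>) * x_pow x (b + sum_list lam - sum_list \<rho> - int k) * P \<rho>)"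
        by (subst sum.swap) (simp add: g_def const_sum sum_distrib_right)
      finally show ?thesis .
    qed
    have "fps_nth (e_series ((!) vs) (Suc p)) r * P lam =
      x_pow x 0 * (fps_nth (e_series ((!) vs) p) r * P lam) + x_pow x (- 1) * (fps_nth (e_series ((!) vs) p) r' * P lam)"
      by (simp add: r e_series_Suc algebra_simps x_def)
    also have "\<dots> = (\<Sum>\<rho>\<in>Y. const (g r \<rho> + g r' \<rho>) * x_pow x (sum_list lam - sum_list \<rho> - int r) * P \<rho>)"
      unfolding lower_sum by (simp add: r const_add distrib_right sum.distrib algebra_simps)
    also have "\<dots> = (\<Sum>\<rho>\<in>Y. const (\<Sum>J | J \<subseteq> {..<Suc p} \<and> card J = r. e_coeff q t (Suc p) ((!) lam) J *
        skew_coeff0 q t (Suc p) p (lower J ((!) lam)) ((!) \<rho>)) * x_pow x (sum_list lam - sum_list \<rho> - int r) * P \<rho>)"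
      unfolding g_def r by (subst e_branching_coeff) (use dec in auto)
    also have "\<dots> = (\<Sum>J | J \<subseteq> {..<Suc p} \<and> card J = r. const (e_coeff q t (Suc p) ((!) lam) J) *
       (\<Sum>\<rho>\<in>Y. const (skew_coeff0 q t (Suc p) p (lower J ((!) lam)) ((!) \<rho>)) * x_pow x (sum_list lam - sum_list \<rho> - int r) * P \<rho>))"
      unfolding const_sum sum_distrib_right sum_distrib_left by (subst sum.swap) (simp only: const_mult mult_ac)
    also have "\<dots> = (\<Sum>J | J \<subseteq> {..<Suc p} \<and> card J = r. const (e_coeff q t (Suc p) ((!) lam) J) * P (lower_list J lam))"
    proof (rule sum.cong[OF refl])
      fix J assume "J \<in> {J. J \<subseteq> {..<Suc p} \<and> card J = r}"
      then have J: "J \<subseteq> {..<length lam}" "card J = r" using len by auto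
      have "P (lower_list J lam) = (\<Sum>\<rho>\<in>Y. const (skew_coeff0 q t (Suc p) p ((!) (lower_list J lam)) ((!) \<rho>)) *
          x_pow (vs ! p) (sum_list (lower_list J lam) - sum_list \<rho>) * P \<rho>)"
        unfolding P_def
      proof (rule macdonald_P_branching'[OF abs_q abs_t _ finY])
        fix \<rho> assume il: "\<rho> \<prec>\<^sub>P lower_list J lam"
        then have l: "length \<rho> = p" using len by (simp add: interlace_def)
        have "lam ! p - 1 \<le> \<rho> ! i \<and> \<rho> ! i \<le> lam ! 0" if i: "i < p" for i
        proof -
          have "lower J ((!) lam) (Suc i) \<le> \<rho> ! i" "\<rho> ! i \<le> lower J ((!) lam) i"
            using il i l len by (auto simp: interlace_def nth_lower_list)
          moreover have "lam ! p \<le> lam ! Suc i" "lam ! i \<le> lam ! 0" using dec i by auto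
          ultimately show ?thesis by (auto simp: lower_def split: if_splits)
        qed
        then show "\<rho> \<in> Y" using l by (auto simp: Y_def in_set_conv_nth)
      qed (auto simp: Y_def len)
      also have "\<dots> = (\<Sum>\<rho>\<in>Y. const (skew_coeff0 q t (Suc p) p (lower J ((!) lam)) ((!) \<rho>)) * x_pow x (sum_list lam - sum_list \<rho> - int r) * P \<rho>)"
      proof (rule sum.cong[OF refl])
        fix \<rho> assume "\<rho> \<in> Y"
        have "skew_coeff0 q t (Suc p) p ((!) (lower_list J lam)) ((!) \<rho>) = skew_coeff0 q t (Suc p) p (lower J ((!) lam)) ((!) \<rho>)"
          by (rule skew_coeff0_cong) (auto simp: nth_lower_list len)
        then show "const (skew_coeff0 q t (Suc p) p ((!) (lower_list J lam)) ((!) \<rho>)) *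
          x_pow (vs ! p) (sum_list (lower_list J lam) - sum_list \<rho>) * P \<rho> =
          const (skew_coeff0 q t (Suc p) p (lower J ((!) lam)) ((!) \<rho>)) * x_pow x (sum_list lam - sum_list \<rho> - int r) * P \<rho>"
          using sum_list_lower_list[OF J(1)] J(2) by (simp add: x_def diff_diff_eq add.commute)
      qed
      finally show "const (e_coeff q t (Suc p) ((!) lam) J) *
       (\<Sum>\<rho>\<in>Y. const (skew_coeff0 q t (Suc p) p (lower J ((!) lam)) ((!) \<rho>)) * x_pow x (sum_list lam - sum_list \<rho> - int r) * P \<rho>) =
       const (e_coeff q t (Suc p) ((!) lam) J) * P (lower_list J lam)" by simp
    qed
    finally show ?thesis by (simp add: P_def)
  qed
qed

end

section \<open>The Pieri rule for the one-variable Cauchy kernel\<close>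

text \<open>
  \<open>(t; q)\<^sub>m / (q; q)\<^sub>m\<close>
\<close>

definition g_coeff :: "real \<Rightarrow> real \<Rightarrow> nat \<Rightarrow> real" where
  "g_coeff q t m = (\<Prod>i<m. (1 - t * q ^ i) / (1 - q ^ Suc i))"

text \<open>
  The expansion of \<open>\<Prod>\<^sub>i (t y/x\<^sub>i; q)\<^sub>\<infinity> / (y/x\<^sub>i; q)\<^sub>\<infinity>\<close> in powers of \<open>y\<close>.
\<close>

definition g_series :: "real \<Rightarrow> real \<Rightarrow> (nat \<Rightarrow> nat) \<Rightarrow> nat \<Rightarrow> laurent_poly fps" where
  "g_series q t v n = (\<Prod>i<n. Abs_fps (\<lambda>m. const (g_coeff q t m) * x_pow (v i) (- int m)))"

text \<open>
  The substitution of \<open>c * X\<close> for \<open>X\<close>.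
\<close>

definition fps_dilate :: "'a :: comm_ring_1 \<Rightarrow> 'a fps \<Rightarrow> 'a fps" where
  "fps_dilate c A = Abs_fps (\<lambda>m. c ^ m * fps_nth A m)"

lemma fps_dilate_mult: "fps_dilate c (A * B) = fps_dilate c A * fps_dilate c B"
proof (rule fps_ext)
  fix n
  have "c ^ n * (fps_nth A i * fps_nth B (n - i)) = c ^ i * fps_nth A i * (c ^ (n - i) * fps_nth B (n - i))"
    if "i \<le> n" for i
    using power_add[of c i "n - i"] that by (simp add: mult_ac)
  then show "fps_nth (fps_dilate c (A * B)) n = fps_nth (fps_dilate c A * fps_dilate c B) n"
    unfolding fps_dilate_def fps_mult_nth fps_nth_Abs_fps sum_distrib_left by (intro sum.cong) auto
qed

lemma fps_dilate_one [simp]: "fps_dilate c 1 = 1"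
  by (rule fps_ext) (simp add: fps_dilate_def)

lemma abs_power_less_1: "\<bar>q\<bar> < 1 \<Longrightarrow> \<bar>q ^ Suc i\<bar> < (1 :: real)"
  unfolding power_abs by (simp add: power_less_one_iff del: power_Suc)

lemma g_coeff_Suc: "\<bar>q\<bar> < 1 \<Longrightarrow> (1 - q ^ Suc m) * g_coeff q t (Suc m) = (1 - t * q ^ m) * g_coeff q t m"
proof -
  assume "\<bar>q\<bar> < 1"
  then have "q ^ Suc m \<noteq> 1" using abs_power_less_1[of q m] by auto
  then show ?thesis by (simp add: g_coeff_def field_simps)
qed

text \<open>
  In one variable this says \<open>(1 - t y) g(q y) = (1 - y) g(y)\<close>, the recursion of the coefficients \<open>g_coeff\<close>. Both sides
  are multiplicative in the variables.
\<close>

lemma g_series_e_series: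
  assumes "\<bar>q\<bar> < 1"
  shows "fps_dilate (const q) (g_series q t v n) * fps_dilate (const (- t)) (e_series v n) = g_series q t v n * fps_dilate (const (- 1)) (e_series v n)"
proof -
  have single: "fps_dilate (const q) (Abs_fps (\<lambda>m. const (g_coeff q t m) * x_pow i (- int m))) * fps_dilate (const (- t)) (1 + fps_const (x_pow i (- 1)) * fps_X) =
      Abs_fps (\<lambda>m. const (g_coeff q t m) * x_pow i (- int m)) * fps_dilate (const (- 1)) (1 + fps_const (x_pow i (- 1)) * fps_X)" for i
  proof (rule fps_ext)
    fix n
    have dil: "fps_dilate (const c) (1 + fps_const (x_pow i (- 1)) * fps_X) = 1 + fps_const (const c * x_pow i (- 1)) * fps_X" for c
      by (rule fps_ext) (simp add: fps_dilate_def fps_X_def)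
    have expand: "fps_nth (A * (1 + fps_const y * fps_X)) n = fps_nth A n + (if n = 0 then 0 else fps_nth A (n - 1) * y)" for A :: "laurent_poly fps" and y
      by (simp add: distrib_left mult.assoc[symmetric])
    show "fps_nth (fps_dilate (const q) (Abs_fps (\<lambda>m. const (g_coeff q t m) * x_pow i (- int m))) * fps_dilate (const (- t)) (1 + fps_const (x_pow i (- 1)) * fps_X)) n =
      fps_nth (Abs_fps (\<lambda>m. const (g_coeff q t m) * x_pow i (- int m)) * fps_dilate (const (- 1)) (1 + fps_const (x_pow i (- 1)) * fps_X)) n"
    proof (cases n)
      case 0
      then show ?thesis unfolding dil expand by (simp add: fps_dilate_def)
    next
      case (Suc m)
      have "q ^ Suc m * g_coeff q t (Suc m) + q ^ m * g_coeff q t m * (- t) = g_coeff q t (Suc m) + g_coeff q t m * (- 1)"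
        using g_coeff_Suc[OF assms, of m t] by (simp add: algebra_simps)
      then have "const (q ^ Suc m * g_coeff q t (Suc m) + q ^ m * g_coeff q t m * (- t)) = const (g_coeff q t (Suc m) + g_coeff q t m * (- 1))"
        by (rule arg_cong)
      then have key: "const (q ^ Suc m) * const (g_coeff q t (Suc m)) + const (q ^ m) * const (g_coeff q t m) * const (- t) =
          const (g_coeff q t (Suc m)) + const (g_coeff q t m) * const (- 1)"
        by (simp only: const_add const_mult)
      have "- int (Suc m) = - int m + (- 1)" by simp
      then have z: "x_pow i (- int (Suc m)) = x_pow i (- int m) * x_pow i (- 1)"
        by (simp only: x_pow_add)
      have regroup: "a * (b * (y * x)) + c * (d * y) * (e * x) = (a * b + c * d * e) * (y * x)"
        "b * (y * x) + d * y * (e * x) = (b + d * e) * (y * x)" for a b c d e x y :: laurent_poly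
        by (simp_all add: algebra_simps)
      show ?thesis
        unfolding dil expand
        unfolding fps_dilate_def fps_nth_Abs_fps Suc diff_Suc_1 z const_power[symmetric]
        by (simp only: nat.distinct if_False regroup key)
    qed
  qed
  show ?thesis
  proof (induction n)
    case (Suc n)
    have regroup: "A * B * (C * D) = (A * C) * (B * D)" for A B C D :: "laurent_poly fps"
      by (simp only: mult_ac)
    have g: "g_series q t v (Suc n) = g_series q t v n * Abs_fps (\<lambda>m. const (g_coeff q t m) * x_pow (v n) (- int m))"
      and e: "e_series v (Suc n) = e_series v n * (1 + fps_const (x_pow (v n) (- 1)) * fps_X)"
      by (simp_all add: g_series_def e_series_def)
    show ?case
      unfolding g e fps_dilate_mult regroup Suc single ..
  qed (simp add: g_series_def e_series_def)
qed

lemma g_series_rec: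
  assumes "\<bar>q\<bar> < 1"
  shows "const (1 - q ^ M) * fps_nth (g_series q t v n) M =
    (\<Sum>r = 1..M. const ((- 1) ^ (r - 1) * (1 - q ^ (M - r) * t ^ r)) * (fps_nth (g_series q t v n) (M - r) * fps_nth (e_series v n) r))"
proof -
  define G where "G = fps_nth (g_series q t v n)"
  define E where "E = fps_nth (e_series v n)"
  have "(\<Sum>r = 0..M. const (q ^ (M - r)) * G (M - r) * (const ((- t) ^ r) * E r)) = (\<Sum>r = 0..M. G (M - r) * (const ((- 1) ^ r) * E r))"
  proof -
    have flip: "(\<Sum>r = 0..M. a (M - r) * b r) = fps_nth (Abs_fps a * Abs_fps b) M" for a b :: "nat \<Rightarrow> laurent_poly"
      by (simp add: mult.commute[of "Abs_fps a"] fps_mult_nth mult.commute[of "a _"])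
    have "(\<Sum>r = 0..M. const (q ^ (M - r)) * G (M - r) * (const ((- t) ^ r) * E r)) =
      fps_nth (fps_dilate (const q) (g_series q t v n) * fps_dilate (const (- t)) (e_series v n)) M"
      using flip[of "\<lambda>i. const (q ^ i) * G i" "\<lambda>r. const ((- t) ^ r) * E r"] by (simp add: fps_dilate_def G_def E_def const_power)
    moreover have "(\<Sum>r = 0..M. G (M - r) * (const ((- 1) ^ r) * E r)) = fps_nth (g_series q t v n * fps_dilate (const (- 1)) (e_series v n)) M"
      using flip[of G "\<lambda>r. const ((- 1) ^ r) * E r"] by (simp add: fps_dilate_def G_def E_def const_power fps_nth_inverse)
    ultimately show ?thesis by (simp add: g_series_e_series[OF assms])
  qed
  then have "0 = (\<Sum>r = 0..M. G (M - r) * (const ((- 1) ^ r) * E r)) - (\<Sum>r = 0..M. const (q ^ (M - r)) * G (M - r) * (const ((- t) ^ r) * E r))"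
    by simp
  also have "\<dots> = (\<Sum>r = 0..M. const ((- 1) ^ r * (1 - q ^ (M - r) * t ^ r)) * (G (M - r) * E r))"
    unfolding sum_subtractf[symmetric]
  proof (rule sum.cong[OF refl])
    fix r
    have "(- 1) ^ r * (1 - q ^ (M - r) * t ^ r) = (- 1) ^ r - q ^ (M - r) * (- t) ^ r"
      by (simp add: power_minus[of t] algebra_simps)
    then show "G (M - r) * (const ((- 1) ^ r) * E r) - const (q ^ (M - r)) * G (M - r) * (const ((- t) ^ r) * E r) =
        const ((- 1) ^ r * (1 - q ^ (M - r) * t ^ r)) * (G (M - r) * E r)"
      by (simp only: const_diff const_mult) (simp add: algebra_simps)
  qed
  also have "\<dots> = const (1 - q ^ M) * G M + (\<Sum>r = 1..M. const ((- 1) ^ r * (1 - q ^ (M - r) * t ^ r)) * (G (M - r) * E r))"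
    by (subst sum.atLeast_Suc_atMost) (auto simp: E_def e_series_0)
  finally have "const (1 - q ^ M) * G M = - (\<Sum>r = 1..M. const ((- 1) ^ r * (1 - q ^ (M - r) * t ^ r)) * (G (M - r) * E r))"
    by (simp add: eq_neg_iff_add_eq_0)
  also have "\<dots> = (\<Sum>r = 1..M. const ((- 1) ^ (r - 1) * (1 - q ^ (M - r) * t ^ r)) * (G (M - r) * E r))"
    unfolding sum_negf[symmetric]
  proof (rule sum.cong[OF refl])
    fix r assume "r \<in> {1..M}"
    then obtain r' where "r = Suc r'" by (cases r) auto
    then show "- (const ((- 1) ^ r * (1 - q ^ (M - r) * t ^ r)) * (G (M - r) * E r)) =
        const ((- 1) ^ (r - 1) * (1 - q ^ (M - r) * t ^ r)) * (G (M - r) * E r)"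
      by (simp add: const_uminus)
  qed
  finally show ?thesis unfolding G_def E_def .
qed

definition strips :: "int list \<Rightarrow> nat \<Rightarrow> int list set" where
  "strips lam M = {\<sigma>. length \<sigma> = length lam \<and> interlacing (\<lambda>_. 0) (length lam) (length lam) ((!) lam) ((!) \<sigma>) \<and>
     sum_list lam - sum_list \<sigma> = int M}"

text \<open>
  Entries that are bounded above and have a fixed sum are bounded below as well.
\<close>

lemma finite_bounded_lists_fixed_sum:
  "finite {\<sigma> :: int list. length \<sigma> = n \<and> (\<forall>i<n. \<sigma> ! i \<le> b i) \<and> sum_list \<sigma> = c}" (is "finite ?Y")
proof (rule finite_subset)
  define B where "B = (\<Sum>i<n. \<bar>b i\<bar>) + \<bar>c\<bar>"
  show "?Y \<subseteq> {\<sigma>. set \<sigma> \<subseteq> {- B..B} \<and> length \<sigma> = n}"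
  proof (intro subsetI CollectI conjI)
    fix \<sigma> x assume "\<sigma> \<in> ?Y" and "x \<in> set \<sigma>"
    then obtain i where \<sigma>: "length \<sigma> = n" "\<And>i. i < n \<Longrightarrow> \<sigma> ! i \<le> b i" "sum_list \<sigma> = c" and i: "i < n" "x = \<sigma> ! i"
      by (auto simp: in_set_conv_nth)
    have split: "(\<Sum>j<n. g j) = g i + (\<Sum>j\<in>{..<n} - {i}. g j)" for g :: "nat \<Rightarrow> int"
      using i by (intro sum.remove) auto
    have "c = x + (\<Sum>j\<in>{..<n} - {i}. \<sigma> ! j)"
      using split[of "\<lambda>j. \<sigma> ! j"] \<sigma>(1,3) i(2) by (simp add: sum_list_sum_nth atLeast0LessThan)
    moreover have "(\<Sum>j\<in>{..<n} - {i}. \<sigma> ! j) \<le> (\<Sum>j\<in>{..<n} - {i}. \<bar>b j\<bar>)"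
      using \<sigma>(2) by (intro sum_mono) force
    moreover have "x \<le> \<bar>b i\<bar>"
      using \<sigma>(2)[OF i(1)] i(2) by linarith
    moreover have "0 \<le> (\<Sum>j\<in>{..<n} - {i}. \<bar>b j\<bar>)" by (simp add: sum_nonneg)
    ultimately show "x \<in> {- B..B}"
      unfolding B_def split[of "\<lambda>j. \<bar>b j\<bar>"] atLeastAtMost_iff by linarith
  qed auto
  show "finite {\<sigma>. set \<sigma> \<subseteq> {- B..B} \<and> length \<sigma> = n}"
    by (rule finite_lists_length_eq) simp
qed

lemma finite_strips: "finite (strips lam M)"
  by (rule finite_subset[OF _ finite_bounded_lists_fixed_sum[of "length lam" "(!) lam" "sum_list lam - int M"]])
    (auto simp: strips_def interlacing_def)

lemma strips_0:
  assumes "lam \<in> Sig n"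
  shows "strips lam 0 = {lam}"
proof -
  have n: "length lam = n" using assms by (simp add: Sig_def)
  have "\<sigma> = lam" if "length \<sigma> = n" "\<forall>i<n. \<sigma> ! i \<le> lam ! i" "sum_list \<sigma> = sum_list lam" for \<sigma>
  proof -
    have "(\<Sum>i<n. lam ! i - \<sigma> ! i) = 0"
      using that n by (simp add: sum_subtractf sum_list_sum_nth atLeast0LessThan)
    then have "\<forall>i\<in>{..<n}. lam ! i - \<sigma> ! i = 0"
      using that(2) by (subst (asm) sum_nonneg_eq_0_iff) auto
    then show ?thesis using that(1) n by (intro nth_equalityI) auto
  qed
  moreover have "interlacing (\<lambda>_. 0) n n ((!) lam) ((!) lam)"
    using Sig_nth[OF assms] by (auto simp: interlacing_def)
  ultimately show ?thesis
    using n by (auto simp: strips_def interlacing_def)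
qed

lemma skew_coeff_self: "skew_coeff q t h n n l l = 1"
  by (simp add: skew_coeff_def f_ratio_def cong: if_cong)

context generic_params
begin

lemma one_minus_q_power: "0 < M \<Longrightarrow> 1 - q ^ M \<noteq> 0"
  using q_powi_eq_1[of "int M"] by auto

text \<open>
  The counterpart of \<open>g_series_rec\<close> for the weights of horizontal strips. It is \<open>lowering_alternating_sum\<close>, sorted by the
  size of \<open>J\<close>: the right-hand side comes from \<open>J = {}\<close>.
\<close>

lemma lowering_recursion:
  assumes l: "\<And>i j. i \<le> j \<Longrightarrow> j < n \<Longrightarrow> l j \<le> l i" and M: "(\<Sum>i<n. l i - m i) = int M"
  shows "(\<Sum>r = 1..M. \<Sum>J | J \<subseteq> {..<n} \<and> card J = r. (- 1) ^ (r - 1) * (1 - q ^ (M - r) * t ^ r) *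
      (e_coeff q t n l J * skew_coeff0 q t n n (lower J l) m)) = (1 - q ^ M) * skew_coeff0 q t n n l m"
proof -
  define T where "T = (\<lambda>J. e_coeff q t n l J * skew_coeff0 q t n n (lower J l) m)"
  \<comment> \<open>No more than \<open>M\<close> parts can be lowered, which makes the truncated differences \<open>M - card J\<close> below harmless.\<close>
  have T0: "T J = 0" if "J \<subseteq> {..<n}" "M < card J" for J
  proof -
    have "\<not> interlacing (\<lambda>_. 0) n n (lower J l) m"
    proof
      assume "interlacing (\<lambda>_. 0) n n (lower J l) m"
      then have "0 \<le> (\<Sum>i<n. lower J l i - m i)"
        by (intro sum_nonneg) (auto simp: interlacing_def)
      also have "\<dots> = (\<Sum>i<n. (l i - m i) - (if i \<in> J then 1 else 0))"
        by (intro sum.cong) (auto simp: lower_def)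
      also have "\<dots> = int M - int (card J)"
        using that(1) by (simp add: sum_subtractf[of "\<lambda>i. l i - m i"] M sum.If_cases Collect_mem_eq Int_absorb1)
      finally show False using that(2) by simp
    qed
    then show ?thesis by (simp add: T_def skew_coeff0_def)
  qed
  have "lower {} l = l"
    by (simp add: lower_def fun_eq_iff)
  then have T_empty: "T {} = skew_coeff0 q t n n l m"
    by (simp add: T_def e_coeff_def)
  have "(\<Sum>J\<in>Pow {..<n}. (- 1) ^ card J * T J) = q ^ M * (\<Sum>J\<in>Pow {..<n}. (- s) ^ card J * T J)"
    using lowering_alternating_sum[of n l m, OF l] by (simp add: M T_def)
  also have "\<dots> = (\<Sum>J\<in>Pow {..<n}. (- 1) ^ card J * (q ^ M * s ^ card J) * T J)"
    by (simp add: sum_distrib_left power_minus[of s] mult_ac)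
  also have "\<dots> = (\<Sum>J\<in>Pow {..<n}. (- 1) ^ card J * (q ^ (M - card J) * t ^ card J) * T J)"
  proof (rule sum.cong[OF refl])
    fix J assume "J \<in> Pow {..<n}"
    then show "(- 1) ^ card J * (q ^ M * s ^ card J) * T J = (- 1) ^ card J * (q ^ (M - card J) * t ^ card J) * T J"
      using T0[of J] by (cases "M < card J") (auto simp: s_def power_divide power_diff field_simps)
  qed
  finally have "0 = (\<Sum>J\<in>Pow {..<n}. (- 1) ^ card J * T J) - (\<Sum>J\<in>Pow {..<n}. (- 1) ^ card J * (q ^ (M - card J) * t ^ card J) * T J)"
    by simp
  also have "\<dots> = (\<Sum>J\<in>Pow {..<n}. (- 1) ^ card J * (1 - q ^ (M - card J) * t ^ card J) * T J)"
    unfolding sum_subtractf[symmetric] by (intro sum.cong) (auto simp: algebra_simps)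
  also have "\<dots> = (\<Sum>J | J \<subseteq> {..<n} \<and> card J \<le> M. (- 1) ^ card J * (1 - q ^ (M - card J) * t ^ card J) * T J)"
  proof (rule sum.mono_neutral_right)
    show "\<forall>J\<in>Pow {..<n} - {J. J \<subseteq> {..<n} \<and> card J \<le> M}. (- 1) ^ card J * (1 - q ^ (M - card J) * t ^ card J) * T J = 0"
    proof
      fix J assume "J \<in> Pow {..<n} - {J. J \<subseteq> {..<n} \<and> card J \<le> M}"
      then have "J \<subseteq> {..<n}" "M < card J" by auto
      then show "(- 1) ^ card J * (1 - q ^ (M - card J) * t ^ card J) * T J = 0" by (simp add: T0)
    qed
  qed auto
  also have "\<dots> = (\<Sum>r\<in>{0..M}. \<Sum>J | J \<in> {J. J \<subseteq> {..<n} \<and> card J \<le> M} \<and> card J = r. (- 1) ^ card J * (1 - q ^ (M - card J) * t ^ card J) * T J)"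
    by (rule sum.group[symmetric]) auto
  also have "\<dots> = (\<Sum>r\<in>{0..M}. \<Sum>J | J \<subseteq> {..<n} \<and> card J = r. (- 1) ^ r * (1 - q ^ (M - r) * t ^ r) * T J)"
    by (intro sum.cong refl) auto
  also have "\<dots> = (1 - q ^ M) * T {} + (\<Sum>r = 1..M. \<Sum>J | J \<subseteq> {..<n} \<and> card J = r. (- 1) ^ r * (1 - q ^ (M - r) * t ^ r) * T J)"
  proof -
    have "{J. J \<subseteq> {..<n} \<and> card J = 0} = {{}}"
      using finite_subset[of _ "{..<n}"] by auto
    then show ?thesis
      by (subst sum.atLeast_Suc_atMost) simp_all
  qed
  finally have "(1 - q ^ M) * T {} = - (\<Sum>r = 1..M. \<Sum>J | J \<subseteq> {..<n} \<and> card J = r. (- 1) ^ r * (1 - q ^ (M - r) * t ^ r) * T J)"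
    by (simp add: eq_neg_iff_add_eq_0)
  also have "\<dots> = (\<Sum>r = 1..M. \<Sum>J | J \<subseteq> {..<n} \<and> card J = r. (- 1) ^ (r - 1) * (1 - q ^ (M - r) * t ^ r) * T J)"
    unfolding sum_negf[symmetric]
  proof (intro sum.cong refl)
    fix r J assume "r \<in> {1..M}"
    then obtain r' where "r = Suc r'" by (cases r) auto
    then show "- ((- 1) ^ r * (1 - q ^ (M - r) * t ^ r) * T J) = (- 1) ^ (r - 1) * (1 - q ^ (M - r) * t ^ r) * T J"
      by simp
  qed
  finally show ?thesis
    unfolding T_empty by (simp add: T_def)
qed

text \<open>
  Both sides satisfy the same recursion in \<open>M\<close>, by \<open>g_series_rec\<close> with \<open>e_pieri\<close> and by \<open>lowering_recursion\<close>.
\<close>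

theorem g_pieri_generic:
  "lam \<in> Sig n \<Longrightarrow> fps_nth (g_series q t ((!) vs) n) M * macdonald_P q t lam vs =
    (\<Sum>\<sigma>\<in>strips lam M. const (skew_coeff q t (\<lambda>_. 0) n n ((!) lam) ((!) \<sigma>)) * macdonald_P q t \<sigma> vs)"
proof (induction M arbitrary: lam rule: less_induct)
  case (less M)
  have n: "length lam = n" and dec: "\<And>i j. i \<le> j \<Longrightarrow> j < n \<Longrightarrow> lam ! j \<le> lam ! i"
    using less.prems Sig_nth[of lam n] by (auto simp: Sig_def)
  show ?case
  proof (cases "M = 0")
    case True
    have "fps_nth (g_series q t v n) 0 = 1" for v
      by (induction n) (auto simp: g_series_def g_coeff_def)
    then show ?thesis
      using strips_0[OF less.prems] by (simp add: True skew_coeff_self)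
  next
    case False
    define P where "P = (\<lambda>\<mu>. macdonald_P q t \<mu> vs)"
    define G where "G = fps_nth (g_series q t ((!) vs) n)"
    define E where "E = fps_nth (e_series ((!) vs) n)"
    define sk where "sk = (\<lambda>lam \<mu>. skew_coeff0 q t n n ((!) lam) ((!) \<mu>))"
    define Y where "Y = {\<sigma>. length \<sigma> = n \<and> (\<forall>i<n. \<sigma> ! i \<le> lam ! i) \<and> sum_list \<sigma> = sum_list lam - int M}"
    have finY: "finite Y" unfolding Y_def by (rule finite_bounded_lists_fixed_sum)
    have step: "G (M - r) * P (lower_list J lam) = (\<Sum>\<sigma>\<in>Y. const (sk (lower_list J lam) \<sigma>) * P \<sigma>)"
      if J: "J \<subseteq> {..<n}" "card J = r" and r: "r \<in> {1..M}" for J r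
    proof -
      have sub: "strips (lower_list J lam) (M - r) \<subseteq> Y"
      proof
        fix \<sigma> assume \<sigma>: "\<sigma> \<in> strips (lower_list J lam) (M - r)"
        have "\<sigma> ! i \<le> lam ! i" if "i < n" for i
        proof -
          have "\<sigma> ! i \<le> lower_list J lam ! i" using \<sigma> n that by (auto simp: strips_def interlacing_def)
          also have "\<dots> \<le> lam ! i" using that n by (auto simp: nth_lower_list lower_def)
          finally show ?thesis .
        qed
        then show "\<sigma> \<in> Y"
          using \<sigma> n J r sum_list_lower_list[of J lam] by (auto simp: Y_def strips_def of_nat_diff)
      qed
      show ?thesis
      proof (cases "lower_list J lam \<in> Sig n")
        case True
        have "G (M - r) * P (lower_list J lam) = (\<Sum>\<sigma>\<in>strips (lower_list J lam) (M - r).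
            const (skew_coeff q t (\<lambda>_. 0) n n ((!) (lower_list J lam)) ((!) \<sigma>)) * P \<sigma>)"
          unfolding G_def P_def using r by (intro less.IH True) auto
        also have "\<dots> = (\<Sum>\<sigma>\<in>Y. const (sk (lower_list J lam) \<sigma>) * P \<sigma>)"
        proof (rule sum.mono_neutral_cong_left[OF finY sub])
          show "\<forall>\<sigma>\<in>Y - strips (lower_list J lam) (M - r). const (sk (lower_list J lam) \<sigma>) * P \<sigma> = 0"
          proof
            fix \<sigma> assume "\<sigma> \<in> Y - strips (lower_list J lam) (M - r)"
            then have "\<not> interlacing (\<lambda>_. 0) n n ((!) (lower_list J lam)) ((!) \<sigma>)"
              using n J r sum_list_lower_list[of J lam] by (auto simp: Y_def strips_def of_nat_diff)
            then show "const (sk (lower_list J lam) \<sigma>) * P \<sigma> = 0"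
              by (simp add: sk_def skew_coeff0_def)
          qed
        qed (auto simp: sk_def skew_coeff0_def strips_def n)
        finally show ?thesis .
      next
        case False
        have "sk (lower_list J lam) \<sigma> = 0" for \<sigma>
        proof -
          have "\<not> interlacing (\<lambda>_. 0) n n ((!) (lower_list J lam)) ((!) \<sigma>)"
          proof
            assume *: "interlacing (\<lambda>_. 0) n n ((!) (lower_list J lam)) ((!) \<sigma>)"
            have "lower_list J lam \<in> Sig n"
            proof (rule SigI)
              fix i assume "Suc i < n"
              then have "lower_list J lam ! Suc i \<le> \<sigma> ! i" "\<sigma> ! i \<le> lower_list J lam ! i"
                using * by (auto simp: interlacing_def)
              then show "lower_list J lam ! Suc i \<le> lower_list J lam ! i" by linarith
            qed (simp add: n)
            with False show False ..
          qed
          then show ?thesis by (simp add: sk_def skew_coeff0_def)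
        qed
        then show ?thesis
          using False n macdonald_P_not_Sig[of "lower_list J lam" q t vs] by (simp add: P_def)
      qed
    qed
    have "const (1 - q ^ M) * (G M * P lam) = (const (1 - q ^ M) * G M) * P lam"
      by (simp only: mult_ac)
    also have "const (1 - q ^ M) * G M = (\<Sum>r = 1..M. const ((- 1) ^ (r - 1) * (1 - q ^ (M - r) * t ^ r)) * (G (M - r) * E r))"
      unfolding G_def E_def by (rule g_series_rec[OF abs_q])
    also have "\<dots> * P lam = (\<Sum>r = 1..M. const ((- 1) ^ (r - 1) * (1 - q ^ (M - r) * t ^ r)) * (G (M - r) * (E r * P lam)))"
      by (simp add: sum_distrib_right mult.assoc)
    also have "\<dots> = (\<Sum>r = 1..M. \<Sum>J | J \<subseteq> {..<n} \<and> card J = r. const ((- 1) ^ (r - 1) * (1 - q ^ (M - r) * t ^ r)) *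
        (const (e_coeff q t n ((!) lam) J) * (G (M - r) * P (lower_list J lam))))"
      unfolding E_def P_def e_pieri[OF less.prems] by (simp add: sum_distrib_left mult_ac)
    also have "\<dots> = (\<Sum>r = 1..M. \<Sum>J | J \<subseteq> {..<n} \<and> card J = r. \<Sum>\<sigma>\<in>Y. const ((- 1) ^ (r - 1) * (1 - q ^ (M - r) * t ^ r) *
        (e_coeff q t n ((!) lam) J * skew_coeff0 q t n n (lower J ((!) lam)) ((!) \<sigma>))) * P \<sigma>)"
    proof (intro sum.cong refl)
      fix r J assume r: "r \<in> {1..M}" and "J \<in> {J. J \<subseteq> {..<n} \<and> card J = r}"
      then have J: "J \<subseteq> {..<n}" "card J = r" by auto
      have sk_eq: "sk (lower_list J lam) \<sigma> = skew_coeff0 q t n n (lower J ((!) lam)) ((!) \<sigma>)" for \<sigma>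
        unfolding sk_def by (rule skew_coeff0_cong) (auto simp: nth_lower_list n)
      show "const ((- 1) ^ (r - 1) * (1 - q ^ (M - r) * t ^ r)) * (const (e_coeff q t n ((!) lam) J) * (G (M - r) * P (lower_list J lam))) =
        (\<Sum>\<sigma>\<in>Y. const ((- 1) ^ (r - 1) * (1 - q ^ (M - r) * t ^ r) *
        (e_coeff q t n ((!) lam) J * skew_coeff0 q t n n (lower J ((!) lam)) ((!) \<sigma>))) * P \<sigma>)"
        unfolding step[OF J r] sk_eq by (simp only: sum_distrib_left const_mult mult_ac)
    qed
    also have "\<dots> = (\<Sum>\<sigma>\<in>Y. const (\<Sum>r = 1..M. \<Sum>J | J \<subseteq> {..<n} \<and> card J = r. (- 1) ^ (r - 1) * (1 - q ^ (M - r) * t ^ r) *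
        (e_coeff q t n ((!) lam) J * skew_coeff0 q t n n (lower J ((!) lam)) ((!) \<sigma>))) * P \<sigma>)"
      by (simp only: const_sum sum_distrib_right sum.swap[of _ Y])
    also have "\<dots> = (\<Sum>\<sigma>\<in>Y. const ((1 - q ^ M) * skew_coeff0 q t n n ((!) lam) ((!) \<sigma>)) * P \<sigma>)"
    proof (rule sum.cong[OF refl])
      fix \<sigma> assume "\<sigma> \<in> Y"
      then have "(\<Sum>i<n. lam ! i - \<sigma> ! i) = int M"
        using n by (auto simp: Y_def sum_subtractf sum_list_sum_nth atLeast0LessThan)
      from lowering_recursion[OF dec this]
      show "const (\<Sum>r = 1..M. \<Sum>J | J \<subseteq> {..<n} \<and> card J = r. (- 1) ^ (r - 1) * (1 - q ^ (M - r) * t ^ r) *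
        (e_coeff q t n ((!) lam) J * skew_coeff0 q t n n (lower J ((!) lam)) ((!) \<sigma>))) * P \<sigma> =
        const ((1 - q ^ M) * skew_coeff0 q t n n ((!) lam) ((!) \<sigma>)) * P \<sigma>"
        by simp
    qed
    also have "\<dots> = const (1 - q ^ M) * (\<Sum>\<sigma>\<in>Y. const (sk lam \<sigma>) * P \<sigma>)"
      by (simp add: sk_def const_mult sum_distrib_left mult_ac)
    finally have eq: "const (1 - q ^ M) * (G M * P lam) = const (1 - q ^ M) * (\<Sum>\<sigma>\<in>Y. const (sk lam \<sigma>) * P \<sigma>)" .
    have "G M * P lam = (\<Sum>\<sigma>\<in>Y. const (sk lam \<sigma>) * P \<sigma>)"
      by (rule const_mult_cancel[OF one_minus_q_power eq]) (use False in simp)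
    also have "\<dots> = (\<Sum>\<sigma>\<in>strips lam M. const (skew_coeff q t (\<lambda>_. 0) n n ((!) lam) ((!) \<sigma>)) * P \<sigma>)"
      by (rule sum.mono_neutral_cong_right[OF finY])
        (auto simp: strips_def Y_def sk_def skew_coeff0_def n interlacing_def)
    finally show ?thesis by (simp add: G_def P_def)
  qed
qed

end

section \<open>Passage to arbitrary parameters\<close>

lemma finite_real_powi_roots:
  fixes c :: real assumes "b \<noteq> 0"
  shows "finite {t. t \<noteq> 0 \<and> t powi b = c}"
proof -
  have pos: "finite {t :: real. t ^ n = c}" if "n > 0" for n c
  proof -
    have "monom 1 n - [:c:] \<noteq> (0 :: real poly)"
    proof
      assume "monom 1 n - [:c:] = 0"
      then have "coeff (monom 1 n - [:c:]) n = 0" by simp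
      with that show False by (simp add: coeff_pCons split: nat.splits)
    qed
    then have "finite {t. poly (monom 1 n - [:c:]) t = 0}" by (rule poly_roots_finite)
    then show ?thesis by (simp add: poly_monom)
  qed
  show ?thesis
  proof (cases "b > 0")
    case True
    then show ?thesis
      by (intro finite_subset[OF _ pos[of "nat b" c]]) (auto simp: power_int_def)
  next
    case False
    then show ?thesis
      using assms by (intro finite_subset[OF _ pos[of "nat (- b)" "inverse c"]]) (auto simp: power_int_def power_inverse)
  qed
qed

text \<open>
  For fixed \<open>Q\<close> each relation \<open>Q powi a * T powi b = 1\<close> with \<open>b \<noteq> 0\<close> has only finitely many solutions \<open>T\<close>, so only
  countably many \<open>T\<close> are excluded.
\<close>

lemma generic_params_dense:
  fixes q t \<epsilon> :: real
  assumes "\<bar>q\<bar> < 1" "\<bar>t\<bar> < 1" "\<epsilon> > 0"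
  obtains Q T where "generic_params Q T" "\<bar>Q - q\<bar> < \<epsilon>" "\<bar>T - t\<bar> < \<epsilon>"
proof -
  have nonempty: "\<exists>x. \<bar>x\<bar> < 1 \<and> \<bar>x - a\<bar> < \<epsilon> \<and> x \<notin> B" if "\<bar>a\<bar> < 1" "countable B" for a :: real and B
  proof -
    define l where "l = max (- 1) (a - \<epsilon>)"
    define u where "u = min 1 (a + \<epsilon>)"
    have "l < u" using that assms by (auto simp: l_def u_def)
    then have "uncountable {l<..<u}" by (simp add: uncountable_open_interval)
    then have "\<not> {l<..<u} \<subseteq> B" using that(2) countable_subset by blast
    then obtain x where "x \<in> {l<..<u}" "x \<notin> B" by blast
    then show ?thesis by (intro exI[of _ x]) (auto simp: l_def u_def)
  qed
  obtain Q where Q: "\<bar>Q\<bar> < 1" "\<bar>Q - q\<bar> < \<epsilon>" "Q \<noteq> 0"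
    using nonempty[OF assms(1), of "{0}"] by auto
  define B where "B = insert 0 (\<Union>(a, b)\<in>{(a :: int, b :: int). b \<noteq> 0}. {t :: real. t \<noteq> 0 \<and> t powi b = inverse (Q powi a)})"
  have "countable B"
    unfolding B_def by (intro countable_insert countable_UN) (auto intro: countable_finite finite_real_powi_roots)
  then obtain T where T: "\<bar>T\<bar> < 1" "\<bar>T - t\<bar> < \<epsilon>" "T \<notin> B"
    using nonempty[OF assms(2)] by blast
  have "generic_params Q T"
  proof
    fix a b assume *: "Q powi a * T powi b = 1"
    have "T powi b = inverse (Q powi a)"
      using * Q by (simp add: field_simps)
    then show "b = 0" using T(3) unfolding B_def by auto
  qed (use Q T B_def in auto)
  with Q T that show ?thesis by blast
qed

lemma generic_params_sequence:
  fixes q t :: real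
  assumes "\<bar>q\<bar> < 1" "\<bar>t\<bar> < 1"
  obtains Q T where "\<And>k. generic_params (Q k) (T k)" "Q \<longlonglongrightarrow> q" "T \<longlonglongrightarrow> t"
proof -
  have "\<exists>Q T. generic_params Q T \<and> \<bar>Q - q\<bar> < inverse (real (Suc k)) \<and> \<bar>T - t\<bar> < inverse (real (Suc k))" for k
    using generic_params_dense[OF assms, of "inverse (real (Suc k))"] by (metis inverse_positive_iff_positive of_nat_0_less_iff zero_less_Suc)
  then obtain Q T where QT: "\<And>k. generic_params (Q k) (T k)"
    "\<And>k. \<bar>Q k - q\<bar> < inverse (real (Suc k))" "\<And>k. \<bar>T k - t\<bar> < inverse (real (Suc k))"
    by metis
  have lim: "X \<longlonglongrightarrow> x" if "\<And>k. \<bar>X k - x\<bar> < inverse (real (Suc k))" for X x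
  proof (rule LIM_zero_cancel, rule Lim_null_comparison[OF _ LIMSEQ_inverse_real_of_nat])
    show "\<forall>\<^sub>F k in sequentially. norm (X k - x) \<le> inverse (real (Suc k))"
      using that by (intro always_eventually allI) (simp add: less_imp_le del: of_nat_Suc)
  qed
  show ?thesis
    by (rule that[OF QT(1) lim[OF QT(2)] lim[OF QT(3)]])
qed

lemma tendsto_powi_nonneg:
  fixes Q :: "'a \<Rightarrow> real"
  assumes "(Q \<longlongrightarrow> q) F" "a \<ge> 0"
  shows "((\<lambda>x. Q x powi a) \<longlongrightarrow> q powi a) F"
  using assms by (auto simp: power_int_def intro: tendsto_power)

lemma tendsto_skew_coeff:
  assumes QT: "(Q \<longlongrightarrow> q) F" "(T \<longlongrightarrow> t) F" and q: "\<bar>q\<bar> < 1" and t: "\<bar>t\<bar> < 1"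
    and il: "interlacing (\<lambda>_. 0) n p l m" and np: "n \<le> Suc p" "p \<le> n"
  shows "((\<lambda>x. skew_coeff (Q x) (T x) (\<lambda>_. 0) n p l m) \<longlongrightarrow> skew_coeff q t (\<lambda>_. 0) n p l m) F"
proof -
  have ratio: "((\<lambda>x. f_ratio (Q x) (T x) (T x ^ k * Q x powi a) b) \<longlongrightarrow> f_ratio q t (t ^ k * q powi a) b) F"
    if "a \<ge> 0" for k a b
    using that q t by (intro tendsto_f_ratio tendsto_intros tendsto_powi_nonneg QT power_powi_le_1)
  have nz: "f_ratio q t (t ^ k * q powi a) b \<noteq> 0" if "a \<ge> 0" for k a b
    using that q t by (intro f_ratio_nonzero power_powi_le_1)
  have 1: "0 \<le> m i - l j" if "i < j" "j < n" for i j
    using interlacing_chain[OF il order_refl np(1) that refl] by simp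
  have 2: "0 \<le> m i - m j" if "i \<le> j" "j < p" for i j
    using interlacing_chain'[OF il order_refl np(1) that np(2) refl] by simp
  show ?thesis
    unfolding skew_coeff_def
  proof (rule tendsto_divide)
    show "(\<Prod>j<n. \<Prod>i<j. if (0::int) = 0 then f_ratio q t (t ^ (j - i - 1) * q powi (m i - l j)) (nat (l i - m i)) else 1) \<noteq> 0"
      using 1 nz by (auto simp: prod_zero_iff)
  qed (use 1 2 ratio in \<open>auto intro!: tendsto_prod\<close>)
qed

context
  fixes Q T :: "nat \<Rightarrow> real" and q t :: real
  assumes QT: "Q \<longlonglongrightarrow> q" "T \<longlonglongrightarrow> t" and q: "\<bar>q\<bar> < 1" and t: "\<bar>t\<bar> < 1"
    and Q: "\<And>k. \<bar>Q k\<bar> < 1" and T: "\<And>k. \<bar>T k\<bar> < 1"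
begin

lemma tendsto_macdonald_P:
  "length lam = n \<Longrightarrow> (\<lambda>k. lookup (macdonald_P (Q k) (T k) lam vs) d) \<longlonglongrightarrow> lookup (macdonald_P q t lam vs) d"
proof (induction n arbitrary: lam d)
  case (Suc n)
  have "(\<lambda>k. \<Sum>\<mu> | \<mu> \<prec>\<^sub>P lam. mac_psi (Q k) (T k) lam \<mu> *
      lookup (macdonald_P (Q k) (T k) \<mu> vs) (d - single (vs ! n) (sum_list lam - sum_list \<mu>))) \<longlonglongrightarrow>
    (\<Sum>\<mu> | \<mu> \<prec>\<^sub>P lam. mac_psi q t lam \<mu> *
      lookup (macdonald_P q t \<mu> vs) (d - single (vs ! n) (sum_list lam - sum_list \<mu>)))"
  proof (intro tendsto_sum tendsto_mult Suc.IH)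
    fix \<mu> assume "\<mu> \<in> {\<mu>. \<mu> \<prec>\<^sub>P lam}"
    then have il: "\<mu> \<prec>\<^sub>P lam" by simp
    then have len: "length lam = Suc (length \<mu>)" by (simp add: interlace_def)
    then show "length \<mu> = n" using Suc.prems by simp
    show "(\<lambda>k. mac_psi (Q k) (T k) lam \<mu>) \<longlonglongrightarrow> mac_psi q t lam \<mu>"
      using tendsto_skew_coeff[OF QT q t, of "length lam" "length \<mu>" "(!) lam" "(!) \<mu>"] il len interlace_iff_interlacing[OF len]
      by (simp add: mac_psi_eq_skew_coeff[OF _ _ il, of _ _ 0] Q T q t)
  qed
  then show ?case
    unfolding macdonald_P_branching[OF Suc.prems] by (simp add: lookup_sum mult.assoc lookup_const_mult lookup_x_pow_mult)
qed simp

lemma tendsto_g_coeff: "(\<lambda>k. g_coeff (Q k) (T k) m) \<longlonglongrightarrow> g_coeff q t m"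
proof -
  have "1 - q ^ Suc i \<noteq> 0" for i
    using abs_power_less_1[OF q, of i] by auto
  then show ?thesis
    unfolding g_coeff_def by (intro tendsto_intros QT) 
qed

lemma tendsto_g_series_mult:
  assumes "\<And>d. (\<lambda>k. lookup (p k) d) \<longlonglongrightarrow> lookup p' d"
  shows "(\<lambda>k. lookup (fps_nth (g_series (Q k) (T k) v n) M * p k) d) \<longlonglongrightarrow>
    lookup (fps_nth (g_series q t v n) M * p') d"
proof (induction n arbitrary: M d)
  case 0
  then show ?case using assms by (simp add: g_series_def fps_one_nth)
next
  case (Suc n)
  have *: "lookup (fps_nth (g_series q t v (Suc n)) M * r) d = (\<Sum>i = 0..M. g_coeff q t (M - i) *
     lookup (fps_nth (g_series q t v n) i * r) (d - single (v n) (- int (M - i))))" for q t r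
  proof -
    have "fps_nth (g_series q t v (Suc n)) M * r = (\<Sum>i = 0..M. const (g_coeff q t (M - i)) * (x_pow (v n) (- int (M - i)) *
      (fps_nth (g_series q t v n) i * r)))"
    proof -
      have "g_series q t v (Suc n) = g_series q t v n * Abs_fps (\<lambda>m. const (g_coeff q t m) * x_pow (v n) (- int m))"
        by (simp add: g_series_def)
      then show ?thesis
        by (simp only: fps_mult_nth fps_nth_Abs_fps sum_distrib_right) (simp only: mult_ac)
    qed
    then show ?thesis by (simp add: lookup_sum lookup_const_mult lookup_x_pow_mult)
  qed
  show ?case
    unfolding * by (intro tendsto_sum tendsto_mult tendsto_g_coeff Suc.IH)
qed

end

text \<open>
  Every coefficient on both sides is continuous in \<open>q\<close> and \<open>t\<close>, and \<open>g_pieri_generic\<close> holds on a dense set.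
\<close>

theorem g_pieri:
  assumes q: "\<bar>q\<bar> < 1" and t: "\<bar>t\<bar> < 1" and lam: "lam \<in> Sig n"
  shows "fps_nth (g_series q t ((!) vs) n) M * macdonald_P q t lam vs =
    (\<Sum>\<sigma>\<in>strips lam M. const (skew_coeff q t (\<lambda>_. 0) n n ((!) lam) ((!) \<sigma>)) * macdonald_P q t \<sigma> vs)"
proof (rule poly_mapping_eqI)
  fix d
  obtain Q T where gen: "\<And>k. generic_params (Q k) (T k)" and lim: "Q \<longlonglongrightarrow> q" "T \<longlonglongrightarrow> t"
    using generic_params_sequence[OF q t] by blast
  have Q: "\<bar>Q k\<bar> < 1" and T: "\<bar>T k\<bar> < 1" for k
    using gen[of k] by (auto simp: generic_params_def)
  have n: "length lam = n" using lam by (simp add: Sig_def)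
  have "(\<lambda>k. lookup (fps_nth (g_series (Q k) (T k) ((!) vs) n) M * macdonald_P (Q k) (T k) lam vs) d) \<longlonglongrightarrow>
    lookup (fps_nth (g_series q t ((!) vs) n) M * macdonald_P q t lam vs) d"
    by (intro tendsto_g_series_mult tendsto_macdonald_P[OF lim q t Q T refl] lim q t Q T)
  moreover have "(\<lambda>k. lookup (fps_nth (g_series (Q k) (T k) ((!) vs) n) M * macdonald_P (Q k) (T k) lam vs) d) \<longlonglongrightarrow>
    lookup (\<Sum>\<sigma>\<in>strips lam M. const (skew_coeff q t (\<lambda>_. 0) n n ((!) lam) ((!) \<sigma>)) * macdonald_P q t \<sigma> vs) d"
    unfolding generic_params.g_pieri_generic[OF gen lam] lookup_sum lookup_const_mult
    by (intro tendsto_sum tendsto_mult tendsto_macdonald_P[OF lim q t Q T refl] tendsto_skew_coeff[OF lim q t])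
      (auto simp: strips_def n)
  ultimately show "lookup (fps_nth (g_series q t ((!) vs) n) M * macdonald_P q t lam vs) d =
    lookup (\<Sum>\<sigma>\<in>strips lam M. const (skew_coeff q t (\<lambda>_. 0) n n ((!) lam) ((!) \<sigma>)) * macdonald_P q t \<sigma> vs) d"
    by (rule LIMSEQ_unique)
qed

section \<open>The q-binomial theorem\<close>

lemma linear_mult_nth:
  fixes A :: "real fps"
  shows "fps_nth ((1 - fps_const a * fps_X) * A) n = fps_nth A n - (if n = 0 then 0 else a * fps_nth A (n - 1))"
  by (simp add: left_diff_distrib mult.assoc)

text \<open>
  The coefficients are determined one after the other since \<open>1 - q ^ Suc n\<close> is not zero.
\<close>

lemma functional_equation_unique:
  fixes A B :: "real fps"
  assumes q: "\<bar>q\<bar> < 1" and A: "A = (1 - fps_const a * fps_X) * fps_dilate q A" and B: "B = (1 - fps_const a * fps_X) * fps_dilate q B"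
    and "fps_nth A 0 = fps_nth B 0"
  shows "A = B"
proof (rule fps_ext)
  fix n
  have step: "(1 - q ^ Suc n) * fps_nth C (Suc n) = - a * q ^ n * fps_nth C n"
    if "C = (1 - fps_const a * fps_X) * fps_dilate q C" for C n
    using arg_cong[OF that, of "\<lambda>C. fps_nth C (Suc n)"] unfolding linear_mult_nth by (simp add: fps_dilate_def algebra_simps)
  show "fps_nth A n = fps_nth B n"
  proof (induction n)
    case (Suc n)
    have "q ^ Suc n \<noteq> 1" using abs_power_less_1[OF q, of n] by auto
    moreover have "(1 - q ^ Suc n) * fps_nth A (Suc n) = (1 - q ^ Suc n) * fps_nth B (Suc n)"
      unfolding step[OF A] step[OF B] Suc ..
    ultimately show ?case by (simp del: power_Suc)
  qed fact
qed

lemma qpoch_fps_limit: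
  assumes "\<bar>q\<bar> < 1"
  shows "(\<lambda>m. fps_nth (\<Prod>i<m. 1 - fps_const (a * q ^ i) * fps_X) n) \<longlonglongrightarrow> fps_nth (qpoch_fps a q) n"
  using convergent_qpoch_fps_coeff[OF assms, of a n] by (simp add: qpoch_fps_def convergent_LIMSEQ_iff)

lemma qpoch_fps_0: "\<bar>q\<bar> < 1 \<Longrightarrow> fps_nth (qpoch_fps a q) 0 = 1"
proof -
  assume q: "\<bar>q\<bar> < 1"
  have "fps_nth (\<Prod>i<m. 1 - fps_const (a * q ^ i) * fps_X) 0 = 1" for m
    by (induction m) auto
  then show ?thesis using qpoch_fps_limit[OF q, of a 0] by (simp add: LIMSEQ_const_iff)
qed

lemma qpoch_fps_equation:
  assumes "\<bar>q\<bar> < 1"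
  shows "qpoch_fps a q = (1 - fps_const a * fps_X) * fps_dilate q (qpoch_fps a q)"
proof (rule fps_ext)
  fix n
  define A where "A = (\<lambda>m. \<Prod>i<m. 1 - fps_const (a * q ^ i) * fps_X)"
  have resc: "fps_dilate q (1 - fps_const b * fps_X) = 1 - fps_const (q * b) * fps_X" for b
    by (rule fps_ext) (simp add: fps_dilate_def fps_X_def)
  have "fps_dilate q (A m) = (\<Prod>i<m. 1 - fps_const (a * q ^ Suc i) * fps_X)" for m
    by (induction m) (simp_all add: A_def fps_dilate_mult resc mult.left_commute[of q] del: fps_const_mult)
  then have "A (Suc m) = (1 - fps_const a * fps_X) * fps_dilate q (A m)" for m
    unfolding A_def by (subst prod.lessThan_Suc_shift) simp
  then have nth: "fps_nth (A (Suc m)) n = q ^ n * fps_nth (A m) n - (if n = 0 then 0 else a * (q ^ (n - 1) * fps_nth (A m) (n - 1)))" for m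
    unfolding linear_mult_nth[of a] by (simp add: linear_mult_nth fps_dilate_def)
  have lim: "(\<lambda>m. fps_nth (A m) n) \<longlonglongrightarrow> fps_nth (qpoch_fps a q) n" for n
    unfolding A_def by (rule qpoch_fps_limit[OF assms])
  have "(\<lambda>m. fps_nth (A (Suc m)) n) \<longlonglongrightarrow> q ^ n * fps_nth (qpoch_fps a q) n - (if n = 0 then 0 else a * (q ^ (n - 1) * fps_nth (qpoch_fps a q) (n - 1)))"
    unfolding nth by (cases "n = 0") (auto intro!: tendsto_intros lim)
  then have "fps_nth (qpoch_fps a q) n = q ^ n * fps_nth (qpoch_fps a q) n - (if n = 0 then 0 else a * (q ^ (n - 1) * fps_nth (qpoch_fps a q) (n - 1)))"
    by (rule LIMSEQ_unique[OF LIMSEQ_Suc[OF lim]])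
  then show "fps_nth (qpoch_fps a q) n = fps_nth ((1 - fps_const a * fps_X) * fps_dilate q (qpoch_fps a q)) n"
    by (simp only: linear_mult_nth fps_dilate_def fps_nth_Abs_fps)
qed

text \<open>
  After multiplication by the denominator both sides solve \<open>A(X) = (1 - t X) A(q X)\<close>.
\<close>

lemma q_binomial_theorem:
  assumes q: "\<bar>q\<bar> < 1"
  shows "qpoch_fps t q / qpoch_fps 1 q = Abs_fps (g_coeff q t)"
proof -
  define g where "g = Abs_fps (g_coeff q t)"
  define F where "F = qpoch_fps 1 q"
  have g: "(1 - fps_const 1 * fps_X) * g = (1 - fps_const t * fps_X) * fps_dilate q g"
  proof (rule fps_ext)
    fix n
    show "fps_nth ((1 - fps_const 1 * fps_X) * g) n = fps_nth ((1 - fps_const t * fps_X) * fps_dilate q g) n"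
      unfolding linear_mult_nth using g_coeff_Suc[OF q, of "n - 1" t]
      by (cases n) (auto simp: g_def fps_dilate_def algebra_simps)
  qed
  have "g * F = g * ((1 - fps_const 1 * fps_X) * fps_dilate q F)"
    unfolding F_def by (subst (1) qpoch_fps_equation[OF q]) (rule refl)
  also have "\<dots> = ((1 - fps_const 1 * fps_X) * g) * fps_dilate q F"
    by (simp only: mult_ac)
  also have "\<dots> = (1 - fps_const t * fps_X) * fps_dilate q (g * F)"
    unfolding g fps_dilate_mult by (simp only: mult_ac)
  finally have eq: "qpoch_fps t q = g * F"
    by (intro functional_equation_unique[OF q qpoch_fps_equation[OF q]])
      (simp_all add: g_def F_def qpoch_fps_0[OF q] g_coeff_def)
  have "F \<noteq> 0" using qpoch_fps_0[OF q, of 1] by (auto simp: F_def)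
  then show ?thesis
    unfolding F_def[symmetric] g_def[symmetric] eq by (rule nonzero_mult_div_cancel_right)
qed

section \<open>Truncation of the Cauchy kernels\<close>

lemma laurent_poly_as_sum: "(p :: laurent_poly) = (\<Sum>k\<in>keys p. single k (lookup p k))"
proof (rule poly_mapping_eqI)
  fix d
  have "lookup (\<Sum>k\<in>keys p. single k (lookup p k)) d =
    (\<Sum>k\<in>keys p. if k = d then lookup p k else 0)"
    unfolding lookup_sum by (intro sum.cong) (auto simp: lookup_single)
  also have "\<dots> = lookup p d"
    by (simp add: in_keys_iff)
  finally show "lookup p d = lookup (\<Sum>k\<in>keys p. single k (lookup p k)) d" ..
qed

lemma prod_single:
  "finite I \<Longrightarrow> (\<Prod>i\<in>I. single (a i) (c i) :: laurent_poly) = single (\<Sum>i\<in>I. a i) (\<Prod>i\<in>I. c i)"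
  by (induction rule: finite_induct) (auto simp: mult_single)

lemma lookup_prod:
  fixes p :: "'i \<Rightarrow> laurent_poly"
  assumes "finite I"
  shows "lookup (\<Prod>i\<in>I. p i) d = series_prod I (\<lambda>i. lookup (p i)) d"
proof -
  define A where "A = (\<Pi>\<^sub>E i\<in>I. keys (p i))"
  have finA: "finite A" unfolding A_def using assms by (intro finite_PiE) auto
  have "(\<Prod>i\<in>I. p i) = (\<Prod>i\<in>I. \<Sum>k\<in>keys (p i). single k (lookup (p i) k))"
    by (simp flip: laurent_poly_as_sum)
  also have "\<dots> = (\<Sum>a\<in>A. \<Prod>i\<in>I. single (a i) (lookup (p i) (a i)))"
    unfolding A_def using assms by (intro prod_sum_PiE) auto
  also have "\<dots> = (\<Sum>a\<in>A. single (\<Sum>i\<in>I. a i) (\<Prod>i\<in>I. lookup (p i) (a i)))"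
    using assms by (simp add: prod_single)
  finally have eq: "(\<Prod>i\<in>I. p i) = (\<Sum>a\<in>A. single (\<Sum>i\<in>I. a i) (\<Prod>i\<in>I. lookup (p i) (a i)))" .
  have "lookup (\<Prod>i\<in>I. p i) d =
      (\<Sum>a\<in>A. if (\<Sum>i\<in>I. a i) = d then \<Prod>i\<in>I. lookup (p i) (a i) else 0)"
    unfolding eq lookup_sum by (simp add: lookup_single when_def)
  also have "\<dots> = (\<Sum>a\<in>{a \<in> A. (\<Sum>i\<in>I. a i) = d}. \<Prod>i\<in>I. lookup (p i) (a i))"
    using finA by (rule sum.inter_filter[symmetric])
  also have "{a \<in> A. (\<Sum>i\<in>I. a i) = d} = {a \<in> I \<rightarrow>\<^sub>E UNIV. (\<Sum>i\<in>I. a i) = d \<and> (\<forall>i\<in>I. lookup (p i) (a i) \<noteq> 0)}"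
    by (auto simp: A_def PiE_def Pi_def in_keys_iff)
  finally show ?thesis by (simp add: series_prod_def)
qed

text \<open>
  The degree in the grading where the variable with number \<open>j\<close> has degree \<open>j\<close>. The ratios in the kernels have positive
  weight.
\<close>

definition weight :: "nat \<Rightarrow> monomial \<Rightarrow> int" where
  "weight N d = (\<Sum>j<N. int j * lookup d j)"

lemma weight_add: "weight N (a + b) = weight N a + weight N b"
  by (simp add: weight_def lookup_add algebra_simps sum.distrib)

lemma weight_0 [simp]: "weight N 0 = 0" by (simp add: weight_def)

lemma weight_sum: "weight N (sum f A) = (\<Sum>x\<in>A. weight N (f x))"
  by (induction A rule: infinite_finite_induct) (auto simp: weight_add)

lemma weight_single: "weight N (single j e) = (if j < N then int j * e else 0)"
proof -
  have "weight N (single j e) = (\<Sum>i<N. if i = j then int j * e else 0)"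
    unfolding weight_def by (intro sum.cong) (auto simp: lookup_single when_def)
  then show ?thesis by simp
qed

text \<open>
  \<open>F\<close> may be replaced by \<open>p\<close> as long as only monomials of weight at most \<open>B\<close> matter. The conditions on the
  supports make this stable under products.
\<close>

definition agree_up_to :: "nat \<Rightarrow> nat \<Rightarrow> laurent_series \<Rightarrow> laurent_poly \<Rightarrow> bool" where
  "agree_up_to N B F p \<longleftrightarrow> (\<forall>a. F a \<noteq> 0 \<longrightarrow> 0 \<le> weight N a) \<and> (\<forall>a. lookup p a \<noteq> 0 \<longrightarrow> 0 \<le> weight N a) \<and>
     (\<forall>a. weight N a \<le> int B \<longrightarrow> F a = lookup p a)"

text \<open>
  As all factors have nonnegative weight, no factor exceeds the weight of the product.
\<close>

lemma agree_up_to_series_prod: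
  assumes fin: "finite I" and agree: "\<And>i. i \<in> I \<Longrightarrow> agree_up_to N B (F i) (p i)"
  shows "agree_up_to N B (series_prod I F) (\<Prod>i\<in>I. p i)"
proof -
  define S where "S = (\<lambda>F :: 'a \<Rightarrow> laurent_series. \<lambda>d. {a \<in> I \<rightarrow>\<^sub>E UNIV. (\<Sum>i\<in>I. a i) = d \<and> (\<forall>i\<in>I. F i (a i) \<noteq> 0)})"
  have sp: "series_prod I F d = (\<Sum>a\<in>S F d. \<Prod>i\<in>I. F i (a i))" for F d
    by (simp add: series_prod_def S_def)
  have pos: "0 \<le> weight N d" if "series_prod I G d \<noteq> 0" "\<And>i a. i \<in> I \<Longrightarrow> G i a \<noteq> 0 \<Longrightarrow> 0 \<le> weight N a" for G d
  proof -
    have "S G d \<noteq> {}" using that(1) by (auto simp: sp)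
    then obtain a where "(\<Sum>i\<in>I. a i) = d" "\<forall>i\<in>I. G i (a i) \<noteq> 0" by (auto simp: S_def)
    then show ?thesis
      using that(2) by (auto simp: weight_sum intro!: sum_nonneg)
  qed
  have small: "weight N (a i) \<le> int B"
    if "i \<in> I" "\<And>i. i \<in> I \<Longrightarrow> 0 \<le> weight N (a i)" "weight N (\<Sum>i\<in>I. a i) \<le> int B" for a i
    using member_le_sum[of i I "\<lambda>i. weight N (a i)"] that fin by (force simp: weight_sum)
  have "series_prod I F d = lookup (\<Prod>i\<in>I. p i) d" if d: "weight N d \<le> int B" for d
  proof -
    have eq: "F i (a i) = lookup (p i) (a i)" if "(\<Sum>i\<in>I. a i) = d" "i \<in> I"
        "(\<forall>i\<in>I. F i (a i) \<noteq> 0) \<or> (\<forall>i\<in>I. lookup (p i) (a i) \<noteq> 0)" for a i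
    proof -
      have "\<And>i. i \<in> I \<Longrightarrow> 0 \<le> weight N (a i)" using agree that(3) unfolding agree_up_to_def by blast
      then have "weight N (a i) \<le> int B" using small[of i a] that d by simp
      then show ?thesis using agree[OF that(2)] by (simp add: agree_up_to_def)
    qed
    have "S F d = S (\<lambda>i. lookup (p i)) d"
      unfolding S_def using eq by (intro Collect_cong conj_cong refl) (metis (mono_tags, lifting))
    then have "series_prod I F d = series_prod I (\<lambda>i. lookup (p i)) d"
      unfolding sp using eq by (intro sum.cong prod.cong refl) (auto simp: S_def)
    then show ?thesis by (simp add: lookup_prod[OF fin])
  qed
  moreover have "0 \<le> weight N d" if "series_prod I F d \<noteq> 0" for d
    using that by (rule pos) (use agree in \<open>auto simp: agree_up_to_def\<close>)
  moreover have "0 \<le> weight N d" if "lookup (\<Prod>i\<in>I. p i) d \<noteq> 0" for d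
    using that unfolding lookup_prod[OF fin] by (rule pos) (use agree in \<open>auto simp: agree_up_to_def\<close>)
  ultimately show ?thesis by (auto simp: agree_up_to_def)
qed

lemma series_mult_lookup:
  "series_mult (lookup p) F d = (\<Sum>a\<in>keys p. lookup p a * F (d - a))"
proof -
  have "series_mult (lookup p) F d = (\<Sum>a\<in>{a \<in> keys p. F (d - a) \<noteq> 0}. lookup p a * F (d - a))"
    unfolding series_mult_def
    by (rule sum.reindex_bij_witness[of _ "\<lambda>a. (a, d - a)" fst]) (auto simp: in_keys_iff algebra_simps)
  also have "\<dots> = (\<Sum>a\<in>keys p. lookup p a * F (d - a))"
    by (rule sum.mono_neutral_left) auto
  finally show ?thesis .
qed

lemma lookup_mult_keys:
  fixes p k :: laurent_poly
  shows "lookup (p * k) d = (\<Sum>a\<in>keys p. lookup p a * lookup k (d - a))"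
proof -
  have "p * k = (\<Sum>a\<in>keys p. single a (lookup p a) * k)"
    by (simp flip: sum_distrib_right laurent_poly_as_sum)
  then show ?thesis by (simp add: lookup_sum lookup_single_mult)
qed

text \<open>
  The monomials of \<open>p\<close> are finitely many, so the weights that \<open>F\<close> has to supply are bounded.
\<close>

lemma eventually_series_mult_eq:
  assumes "\<And>B. agree_up_to N B F (k B)"
  shows "\<forall>\<^sub>F B in sequentially. series_mult (lookup p) F d = lookup (p * k B) d"
proof -
  have "\<forall>\<^sub>F B in sequentially. \<forall>a\<in>keys p. weight N (d - a) \<le> int B"
  proof (intro eventually_ball_finite ballI)
    fix a
    show "\<forall>\<^sub>F B in sequentially. weight N (d - a) \<le> int B"
      by (rule eventually_sequentiallyI[of "nat (weight N (d - a))"]) auto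
  qed simp
  then show ?thesis
  proof eventually_elim
    case (elim B)
    then show ?case
      using assms[of B] by (auto simp: series_mult_lookup lookup_mult_keys agree_up_to_def intro!: sum.cong)
  qed
qed

text \<open>
  The kernel factor of the variables \<open>i\<close> and \<open>j\<close>, cut off after the power \<open>B\<close> of \<open>x\<^sub>j / x\<^sub>i\<close>.
\<close>

definition kernel_trunc :: "real \<Rightarrow> real \<Rightarrow> nat \<Rightarrow> nat \<Rightarrow> nat \<Rightarrow> laurent_poly" where
  "kernel_trunc q t B i j = (\<Sum>m\<le>B. const (g_coeff q t m) * (x_pow i (- int m) * x_pow j (int m)))"

lemma agree_kernel_trunc:
  assumes q: "\<bar>q\<bar> < 1" and ij: "i < j" "j < N"
  shows "agree_up_to N B (fps_at_monomial (qpoch_fps t q / qpoch_fps 1 q) (single i (- 1) + single j 1)) (kernel_trunc q t B i j)"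
proof -
  define e where "e = single i (- 1 :: int) + single j 1"
  define pw where "pw = (\<lambda>n::nat. \<Sum>_<n. e)"
  have we: "weight N e = int (j - i)"
    using ij by (simp add: e_def weight_add weight_single of_nat_diff)
  have wpw: "weight N (pw n) = int n * int (j - i)" for n
    unfolding pw_def weight_sum we by simp
  have n_le: "int n \<le> weight N (pw n)" for n
    using mult_left_mono[of 1 "int (j - i)" "int n"] ij by (simp add: wpw)
  have pw_eq: "pw n = single i (- int n) + single j (int n)" for n
    unfolding pw_def by (rule poly_mapping_eqI, unfold lookup_sum) (simp add: e_def lookup_add lookup_single when_def)
  have inj: "pw n = pw n' \<Longrightarrow> n = n'" for n n'
    using wpw[of n] wpw[of n'] ij by (metis mult_right_cancel of_nat_0_less_iff of_nat_eq_iff order_less_irrefl zero_less_diff)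
  have F: "fps_at_monomial (qpoch_fps t q / qpoch_fps 1 q) e d = (\<Sum>n | pw n = d. g_coeff q t n)" for d
    by (simp add: fps_at_monomial_def q_binomial_theorem[OF q] pw_def)
  have K: "lookup (kernel_trunc q t B i j) d = (\<Sum>n | n \<le> B \<and> pw n = d. g_coeff q t n)" for d
  proof -
    have "kernel_trunc q t B i j = (\<Sum>m\<le>B. single (pw m) (g_coeff q t m))"
      by (simp add: kernel_trunc_def const_def x_pow_def mult_single pw_eq)
    then have "lookup (kernel_trunc q t B i j) d = (\<Sum>m\<le>B. if pw m = d then g_coeff q t m else 0)"
      by (simp add: lookup_sum lookup_single when_def)
    also have "\<dots> = (\<Sum>m\<in>{m \<in> {..B}. pw m = d}. g_coeff q t m)"
      by (rule sum.inter_filter[symmetric]) simp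
    finally show ?thesis by (simp add: atMost_def)
  qed
  show ?thesis
    unfolding agree_up_to_def e_def[symmetric]
  proof (intro conjI allI impI)
    fix a assume "fps_at_monomial (qpoch_fps t q / qpoch_fps 1 q) e a \<noteq> 0"
    then obtain n where "pw n = a" unfolding F by (metis (mono_tags, lifting) empty_Collect_eq sum.empty)
    then show "0 \<le> weight N a" using n_le[of n] by auto
  next
    fix a assume "lookup (kernel_trunc q t B i j) a \<noteq> 0"
    then obtain n where "pw n = a" unfolding K by (metis (mono_tags, lifting) empty_Collect_eq sum.empty)
    then show "0 \<le> weight N a" using n_le[of n] by auto
  next
    fix a assume "weight N a \<le> int B"
    then have "n \<le> B" if "pw n = a" for n using n_le[of n] that by auto
    then show "fps_at_monomial (qpoch_fps t q / qpoch_fps 1 q) e a = lookup (kernel_trunc q t B i j) a"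
      unfolding F K by (intro sum.cong) auto
  qed
qed

lemma agree_cauchy_kernel:
  assumes q: "\<bar>q\<bar> < 1" and ab: "a \<le> b" "b \<le> c" "c \<le> N"
  shows "agree_up_to N B (cauchy_kernel q t (map (\<lambda>j. single j (- 1)) [a..<b]) (map (\<lambda>j. single j 1) [b..<c]))
    (\<Prod>j\<in>{b..<c}. \<Prod>i\<in>{a..<b}. kernel_trunc q t B i j)"
proof -
  have "agree_up_to N B (cauchy_kernel q t (map (\<lambda>j. single j (- 1)) [a..<b]) (map (\<lambda>j. single j 1) [b..<c]))
    (\<Prod>(i, j)\<in>{..<b - a} \<times> {..<c - b}. kernel_trunc q t B (a + i) (b + j))"
    unfolding cauchy_kernel_def
  proof (simp, rule agree_up_to_series_prod)
    fix x assume "x \<in> {..<b - a} \<times> {..<c - b}"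
    then obtain i j where x: "x = (i, j)" "i < b - a" "j < c - b" by auto
    then show "agree_up_to N B (case x of (i, j) \<Rightarrow> fps_at_monomial (qpoch_fps t q / qpoch_fps 1 q)
        (map (\<lambda>j. single j (- 1)) [a..<b] ! i + map (\<lambda>j. single j 1) [b..<c] ! j))
        (case x of (i, j) \<Rightarrow> kernel_trunc q t B (a + i) (b + j))"
      using agree_kernel_trunc[OF q, of "a + i" "b + j" N B t] ab by simp
  qed simp
  also have "(\<Prod>(i, j)\<in>{..<b - a} \<times> {..<c - b}. kernel_trunc q t B (a + i) (b + j)) =
      (\<Prod>(i, j)\<in>{a..<b} \<times> {b..<c}. kernel_trunc q t B i j)"
    by (rule prod.reindex_bij_witness[of _ "\<lambda>(i, j). (i - a, j - b)" "\<lambda>(i, j). (a + i, b + j)"]) auto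
  also have "\<dots> = (\<Prod>i\<in>{a..<b}. \<Prod>j\<in>{b..<c}. kernel_trunc q t B i j)"
    by (simp add: prod.cartesian_product)
  also have "\<dots> = (\<Prod>j\<in>{b..<c}. \<Prod>i\<in>{a..<b}. kernel_trunc q t B i j)"
    by (rule prod.swap)
  finally show ?thesis .
qed

section \<open>Signatures divided into blocks\<close>

lemma prod_lessThan_add:
  fixes g :: "nat \<Rightarrow> 'a :: comm_monoid_mult"
  shows "(\<Prod>j<a + b. g j) = (\<Prod>j<a. g j) * (\<Prod>j<b. g (a + j))"
  by (induction b) (auto simp: mult_ac)

text \<open>
  A last block, on which \<open>h\<close> is constant and whose positions do not interact with the earlier ones, splits off.
\<close>

lemma skew_coeff_append:
  assumes sep: "\<And>i j. i < a \<Longrightarrow> a \<le> j \<Longrightarrow> j < a + n \<Longrightarrow> h i \<noteq> h j"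
    and same: "\<And>i j. a \<le> i \<Longrightarrow> i < a + n \<Longrightarrow> a \<le> j \<Longrightarrow> j < a + n \<Longrightarrow> h i = h j" and p: "p \<le> n"
  shows "skew_coeff q t h (a + n) (a + p) l m =
    skew_coeff q t h a a l m * skew_coeff q t (\<lambda>_. 0) n p (\<lambda>i. l (a + i)) (\<lambda>i. m (a + i))"
proof -
  have 1: "(\<Prod>j<a + p. \<Prod>i\<le>j. if h i = h j then g i j else 1) =
      (\<Prod>j<a. \<Prod>i\<le>j. if h i = h j then g i j else 1) * (\<Prod>j<p. \<Prod>i\<le>j. g (a + i) (a + j))" for g :: "nat \<Rightarrow> nat \<Rightarrow> real"
  proof -
    have "(\<Prod>i\<le>a + j. if h i = h (a + j) then g i (a + j) else 1) = (\<Prod>i\<le>j. g (a + i) (a + j))" if "j < p" for j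
    proof -
      have "(\<Prod>i\<le>a + j. if h i = h (a + j) then g i (a + j) else 1) = (\<Prod>i<a + Suc j. if h i = h (a + j) then g i (a + j) else 1)"
        by (simp only: add_Suc_right lessThan_Suc_atMost)
      also have "\<dots> = (\<Prod>i<a. if h i = h (a + j) then g i (a + j) else 1) * (\<Prod>i<Suc j. if h (a + i) = h (a + j) then g (a + i) (a + j) else 1)"
        by (rule prod_lessThan_add)
      also have "(\<Prod>i<a. if h i = h (a + j) then g i (a + j) else 1) = 1"
        using sep[of _ "a + j"] that p by (intro prod.neutral ballI) simp
      also have "(\<Prod>i<Suc j. if h (a + i) = h (a + j) then g (a + i) (a + j) else 1) = (\<Prod>i\<le>j. g (a + i) (a + j))"
        unfolding lessThan_Suc_atMost
      proof (rule prod.cong[OF refl])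
        fix i assume "i \<in> {..j}"
        then have "h (a + i) = h (a + j)" using that p by (intro same) auto
        then show "(if h (a + i) = h (a + j) then g (a + i) (a + j) else 1) = g (a + i) (a + j)" by simp
      qed
      finally show ?thesis by simp
    qed
    then show ?thesis by (simp add: prod_lessThan_add)
  qed
  have 2: "(\<Prod>j<a + n. \<Prod>i<j. if h i = h j then g i j else 1) =
      (\<Prod>j<a. \<Prod>i<j. if h i = h j then g i j else 1) * (\<Prod>j<n. \<Prod>i<j. g (a + i) (a + j))" for g :: "nat \<Rightarrow> nat \<Rightarrow> real"
  proof -
    have "(\<Prod>i<a + j. if h i = h (a + j) then g i (a + j) else 1) = (\<Prod>i<j. g (a + i) (a + j))" if "j < n" for j
    proof -
      have "(\<Prod>i<a. if h i = h (a + j) then g i (a + j) else 1) = 1"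
        using sep[of _ "a + j"] that by (intro prod.neutral ballI) simp
      moreover have "(\<Prod>i<j. if h (a + i) = h (a + j) then g (a + i) (a + j) else 1) = (\<Prod>i<j. g (a + i) (a + j))"
      proof (rule prod.cong[OF refl])
        fix i assume "i \<in> {..<j}"
        then have "h (a + i) = h (a + j)" using that by (intro same) auto
        then show "(if h (a + i) = h (a + j) then g (a + i) (a + j) else 1) = g (a + i) (a + j)" by simp
      qed
      ultimately show ?thesis by (simp add: prod_lessThan_add)
    qed
    then show ?thesis by (simp add: prod_lessThan_add)
  qed
  show ?thesis
    unfolding skew_coeff_def 1 2 by simp
qed

lemma interlacing_append:
  assumes sep: "\<And>i j. i < a \<Longrightarrow> a \<le> j \<Longrightarrow> j < a + n \<Longrightarrow> h i \<noteq> h j"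
    and same: "\<And>i j. a \<le> i \<Longrightarrow> i < a + n \<Longrightarrow> a \<le> j \<Longrightarrow> j < a + n \<Longrightarrow> h i = h j" and p: "p \<le> n"
  shows "interlacing h (a + n) (a + p) l m \<longleftrightarrow>
    interlacing h a a l m \<and> interlacing (\<lambda>_. 0) n p (\<lambda>i. l (a + i)) (\<lambda>i. m (a + i))" (is "?lhs \<longleftrightarrow> ?rhs")
proof
  assume ?lhs
  then have 1: "\<And>i. i < a + p \<Longrightarrow> m i \<le> l i" and 2: "\<And>i. Suc i < a + n \<Longrightarrow> h i = h (Suc i) \<Longrightarrow> l (Suc i) \<le> m i"
    by (auto simp: interlacing_def)
  have "l (Suc (a + i)) \<le> m (a + i)" if "Suc i < n" for i
    using that by (intro 2 same) auto
  then show ?rhs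
    unfolding interlacing_def using 1 2 by auto
next
  assume ?rhs
  then have 1: "\<And>i. i < a \<Longrightarrow> m i \<le> l i" "\<And>i. i < p \<Longrightarrow> m (a + i) \<le> l (a + i)"
    and 2: "\<And>i. Suc i < a \<Longrightarrow> h i = h (Suc i) \<Longrightarrow> l (Suc i) \<le> m i"
    and 3: "\<And>i. Suc i < n \<Longrightarrow> l (Suc (a + i)) \<le> m (a + i)"
    by (auto simp: interlacing_def)
  have "m i \<le> l i" if "i < a + p" for i
    using 1(1)[of i] 1(2)[of "i - a"] that by (cases "i < a") auto
  moreover have "l (Suc i) \<le> m i" if "Suc i < a + n" "h i = h (Suc i)" for i
  proof -
    consider "Suc i < a" | "Suc i = a" | "a \<le> i" by linarith
    then show ?thesis
    proof cases
      case 2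
      then show ?thesis using sep[of i a] that by auto
    next
      case 3
      then show ?thesis using \<open>\<And>i. Suc i < n \<Longrightarrow> l (Suc (a + i)) \<le> m (a + i)\<close>[of "i - a"] that by auto
    qed (use 2 that in auto)
  qed
  ultimately show ?lhs by (auto simp: interlacing_def)
qed

definition free_of :: "nat \<Rightarrow> laurent_poly \<Rightarrow> bool" where
  "free_of x p \<longleftrightarrow> (\<forall>d. lookup p d \<noteq> 0 \<longrightarrow> lookup d x = 0)"

lemma free_of_mult: "free_of x p \<Longrightarrow> free_of x r \<Longrightarrow> free_of x (p * r)"
  unfolding free_of_def in_keys_iff[symmetric]
  using keys_mult[of p r] by (fastforce simp: lookup_add)

lemma free_of_sum: "(\<And>i. i \<in> I \<Longrightarrow> free_of x (p i)) \<Longrightarrow> free_of x (\<Sum>i\<in>I. p i)"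
  unfolding free_of_def lookup_sum by (metis (mono_tags, lifting) sum.neutral)

lemma free_of_single: "lookup a x = 0 \<Longrightarrow> free_of x (single a c)"
  by (auto simp: free_of_def lookup_single when_def)

lemma free_of_const: "free_of x (const c)"
  by (simp add: const_def free_of_single)

lemma free_of_1: "free_of x 1"
  using free_of_const[of x 1] by simp

lemma free_of_x_pow: "i \<noteq> x \<Longrightarrow> free_of x (x_pow i e)"
  by (simp add: x_pow_def free_of_single lookup_single)

lemma free_of_prod: "(\<And>i. i \<in> I \<Longrightarrow> free_of x (p i)) \<Longrightarrow> free_of x (\<Prod>i\<in>I. p i)"
  by (induction I rule: infinite_finite_induct) (auto intro: free_of_mult free_of_1)

lemma free_of_macdonald_P:
  assumes "\<And>i. i < length lam \<Longrightarrow> vs ! i \<noteq> x"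
  shows "free_of x (macdonald_P q t lam vs)"
  unfolding macdonald_P_def using assms by (intro free_of_sum free_of_prod free_of_mult free_of_const free_of_x_pow) auto

lemma free_of_kernel_trunc: "i \<noteq> x \<Longrightarrow> j \<noteq> x \<Longrightarrow> free_of x (kernel_trunc q t B i j)"
  unfolding kernel_trunc_def by (intro free_of_sum free_of_mult free_of_const free_of_x_pow) auto

text \<open>
  The variable \<open>x\<^sub>n\<close> occurs in the product of the kernel factors only, and its power collects a coefficient of \<open>g_series\<close>.
  The truncation at \<open>B\<close> is not felt, because the exponent of \<open>x\<^sub>n\<close> is at most \<open>B\<close>.
\<close>

lemma lookup_mult_kernel_column:
  assumes "a \<le> n" "free_of n p" "lookup d n \<le> int B"
  shows "lookup (p * (\<Prod>i<a. kernel_trunc q t B i n)) d =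
    (if 0 \<le> lookup d n
     then lookup (fps_nth (g_series q t (\<lambda>i. i) a) (nat (lookup d n)) * p) (d - single n (lookup d n))
     else 0)"
  using assms
proof (induction a arbitrary: p d)
  case 0
  then have "lookup p d = 0" if "lookup d n \<noteq> 0"
    using that by (auto simp: free_of_def)
  then show ?case by (auto simp: g_series_def fps_one_nth)
next
  case (Suc a)
  define e where "e = lookup d n"
  define G where "G = (\<lambda>a. fps_nth (g_series q t (\<lambda>i. i) a))"
  have "lookup (p * (\<Prod>i<Suc a. kernel_trunc q t B i n)) d =
    (\<Sum>m\<le>B. g_coeff q t m * lookup ((x_pow a (- int m) * p) * (\<Prod>i<a. kernel_trunc q t B i n)) (d - single n (int m)))"
  proof -
    have "p * (\<Prod>i<Suc a. kernel_trunc q t B i n) =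
      (\<Sum>m\<le>B. const (g_coeff q t m) * (x_pow n (int m) * ((x_pow a (- int m) * p) * (\<Prod>i<a. kernel_trunc q t B i n))))"
      by (simp add: kernel_trunc_def[of q t B a n] sum_distrib_left mult_ac)
    then show ?thesis by (simp add: lookup_sum lookup_const_mult lookup_x_pow_mult)
  qed
  also have "\<dots> = (\<Sum>m\<le>B. if int m \<le> e then g_coeff q t m *
      lookup (G a (nat (e - int m)) * (x_pow a (- int m) * p)) (d - single n e) else 0)"
  proof (rule sum.cong[OF refl])
    fix m assume "m \<in> {..B}"
    have e': "lookup (d - single n (int m)) n = e - int m"
      by (simp add: lookup_minus e_def)
    have d': "d - single n (int m) - single n (e - int m) = d - single n e"
      by (simp add: single_diff)
    have "free_of n (x_pow a (- int m) * p)"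
      using Suc.prems by (intro free_of_mult free_of_x_pow) auto
    then have "lookup ((x_pow a (- int m) * p) * (\<Prod>i<a. kernel_trunc q t B i n)) (d - single n (int m)) =
      (if 0 \<le> e - int m then lookup (G a (nat (e - int m)) * (x_pow a (- int m) * p)) (d - single n e) else 0)"
      using Suc.IH[of "x_pow a (- int m) * p" "d - single n (int m)", unfolded e' d'] Suc.prems
      unfolding G_def e_def[symmetric] by simp
    then show "g_coeff q t m * lookup ((x_pow a (- int m) * p) * (\<Prod>i<a. kernel_trunc q t B i n)) (d - single n (int m)) =
      (if int m \<le> e then g_coeff q t m * lookup (G a (nat (e - int m)) * (x_pow a (- int m) * p)) (d - single n e) else 0)"
      by simp
  qed
  also have "\<dots> = (\<Sum>m\<in>{m \<in> {..B}. int m \<le> e}. g_coeff q t m *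
      lookup (G a (nat (e - int m)) * (x_pow a (- int m) * p)) (d - single n e))"
    by (rule sum.inter_filter[symmetric]) simp
  also have "\<dots> = (if 0 \<le> e then lookup (G (Suc a) (nat e) * p) (d - single n e) else 0)"
  proof (cases "0 \<le> e")
    case True
    define M where "M = nat e"
    have "G (Suc a) M = (\<Sum>i = 0..M. G a i * (const (g_coeff q t (M - i)) * x_pow a (- int (M - i))))"
    proof -
      have "g_series q t (\<lambda>i. i) (Suc a) = g_series q t (\<lambda>i. i) a * Abs_fps (\<lambda>m. const (g_coeff q t m) * x_pow a (- int m))"
        by (simp add: g_series_def)
      then show ?thesis by (simp only: G_def fps_mult_nth fps_nth_Abs_fps)
    qed
    also have "\<dots> = (\<Sum>m\<le>M. G a (M - m) * (const (g_coeff q t m) * x_pow a (- int m)))"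
      by (rule sum.reindex_bij_witness[of _ "\<lambda>m. M - m" "\<lambda>m. M - m"]) auto
    finally have "G (Suc a) M * p = (\<Sum>m\<le>M. G a (M - m) * (const (g_coeff q t m) * x_pow a (- int m)) * p)"
      by (simp only: sum_distrib_right)
    then have "G (Suc a) M * p = (\<Sum>m\<le>M. const (g_coeff q t m) * (G a (M - m) * (x_pow a (- int m) * p)))"
      by (simp only: mult_ac)
    then have "lookup (G (Suc a) M * p) (d - single n e) =
      (\<Sum>m\<le>M. g_coeff q t m * lookup (G a (M - m) * (x_pow a (- int m) * p)) (d - single n e))"
      by (simp add: lookup_sum lookup_const_mult)
    moreover have "{m \<in> {..B}. int m \<le> e} = {..M}"
      using True Suc.prems(3) by (auto simp: M_def e_def)
    moreover have "nat (e - int m) = M - m" for m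
      using True by (simp add: M_def nat_diff_distrib)
    ultimately show ?thesis using True by (simp add: M_def)
  next
    case False
    then have "{m \<in> {..B}. int m \<le> e} = {}" by auto
    then show ?thesis using False by simp
  qed
  finally show ?case by (simp only: e_def G_def)
qed

lemma tendsto_powi_linear_0:
  fixes q :: real and a b :: int
  assumes "\<bar>q\<bar> < 1" "0 < b"
  shows "(\<lambda>D. q powi (a + b * int D)) \<longlonglongrightarrow> 0"
proof -
  have ge: "\<forall>\<^sub>F D in sequentially. z \<le> a + b * int D" for z
  proof (rule eventually_sequentiallyI[of "nat (z - a)"])
    fix D assume "nat (z - a) \<le> D"
    then have "z - a \<le> int D" by simp
    also have "\<dots> \<le> b * int D" using mult_right_mono[of 1 b "int D"] assms(2) by simp
    finally show "z \<le> a + b * int D" by simp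
  qed
  have "filterlim (\<lambda>D. nat (a + b * int D)) at_top sequentially"
    unfolding filterlim_at_top
  proof
    fix Z :: nat
    show "\<forall>\<^sub>F D in sequentially. Z \<le> nat (a + b * int D)"
      using ge[of "int Z"] by eventually_elim linarith
  qed
  then have "(\<lambda>D. q ^ nat (a + b * int D)) \<longlonglongrightarrow> 0"
    by (rule filterlim_compose[OF LIMSEQ_abs_realpow_zero2[OF assms(1)]])
  moreover have "\<forall>\<^sub>F D in sequentially. q ^ nat (a + b * int D) = q powi (a + b * int D)"
    using ge[of 0] by eventually_elim (simp add: power_int_def)
  ultimately show ?thesis
    by (rule Lim_transform_eventually)
qed

text \<open>
  The ratio of two variables with different velocities tends to \<open>0\<close>, where \<open>f_ratio\<close> is \<open>1\<close>; with equal velocities it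
  is constant.
\<close>

lemma tendsto_skew_coeff_shift:
  assumes q: "\<bar>q\<bar> < 1" and t: "\<bar>t\<bar> < 1" and il: "interlacing h n p l m"
    and h: "\<And>i j. i \<le> j \<Longrightarrow> j < n \<Longrightarrow> h j \<le> h i" and np: "n \<le> Suc p" "p \<le> n"
  shows "(\<lambda>D. skew_coeff q t (\<lambda>_. 0) n p (\<lambda>i. l i + h i * int D) (\<lambda>i. m i + h i * int D)) \<longlonglongrightarrow> skew_coeff q t h n p l m"
proof -
  have far: "(\<lambda>D. f_ratio q t (t ^ k * q powi (x + h i * int D - (y + h j * int D))) b) \<longlonglongrightarrow> 1" if "i \<le> j" "j < n" "h i \<noteq> h j" for i j k b x y
  proof -
    have "(\<lambda>D. q powi (x - y + (h i - h j) * int D)) \<longlonglongrightarrow> 0"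
      using that h[of i j] by (intro tendsto_powi_linear_0 q) auto
    then have "(\<lambda>D. t ^ k * q powi (x - y + (h i - h j) * int D)) \<longlonglongrightarrow> 0"
      by (rule tendsto_mult_right_zero)
    then have "(\<lambda>D. f_ratio q t (t ^ k * q powi (x - y + (h i - h j) * int D)) b) \<longlonglongrightarrow> f_ratio q t 0 b"
      by (intro tendsto_f_ratio tendsto_const q) auto
    then show ?thesis by (simp add: algebra_simps)
  qed
  have near: "x + h i * int D - (y + h j * int D) = x - y" if "h i = h j" for i j x y D
    using that by simp
  have 1: "0 \<le> m i - l j" if "i < j" "j < n" "h i = h j" for i j
    using interlacing_chain[OF il h np(1) that] by simp
  have "(\<lambda>D. \<Prod>j<p. \<Prod>i\<le>j. f_ratio q t (t ^ (j - i) * q powi (m i + h i * int D - (m j + h j * int D))) (nat (l i - m i))) \<longlonglongrightarrow>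
    (\<Prod>j<p. \<Prod>i\<le>j. if h i = h j then f_ratio q t (t ^ (j - i) * q powi (m i - m j)) (nat (l i - m i)) else 1)"
    using np by (intro tendsto_prod) (auto simp: near intro!: far)
  moreover have "(\<lambda>D. \<Prod>j<n. \<Prod>i<j. f_ratio q t (t ^ (j - i - 1) * q powi (m i + h i * int D - (l j + h j * int D))) (nat (l i - m i))) \<longlonglongrightarrow>
    (\<Prod>j<n. \<Prod>i<j. if h i = h j then f_ratio q t (t ^ (j - i - 1) * q powi (m i - l j)) (nat (l i - m i)) else 1)"
    by (intro tendsto_prod) (auto simp: near intro!: far)
  moreover have "(\<Prod>j<n. \<Prod>i<j. if h i = h j then f_ratio q t (t ^ (j - i - 1) * q powi (m i - l j)) (nat (l i - m i)) else 1) \<noteq> 0"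
  proof -
    have "(if h i = h j then f_ratio q t (t ^ (j - i - 1) * q powi (m i - l j)) (nat (l i - m i)) else 1) \<noteq> 0" if "i < j" "j < n" for i j
      using 1[OF that] f_ratio_nonzero[OF q t power_powi_le_1[OF q t]] by auto
    then show ?thesis by (simp add: prod_zero_iff)
  qed
  ultimately show ?thesis
    unfolding skew_coeff_def by (simp add: tendsto_divide)
qed

text \<open>
  Block \<open>c\<close> consists of the positions from \<open>s c\<close> to \<open>s (Suc c) - 1\<close>, and its parts are shifted by \<open>L c * D\<close>.
\<close>

locale blocks =
  fixes k :: nat and s :: "nat \<Rightarrow> nat" and L :: "nat \<Rightarrow> int" and q t :: real
  assumes s_0 [simp]: "s 0 = 0" and s_Suc: "\<And>i. s i \<le> s (Suc i)"
    and L_dec: "\<And>i j. i < j \<Longrightarrow> j < k \<Longrightarrow> L j < L i"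
    and q: "\<bar>q\<bar> < 1" and t: "\<bar>t\<bar> < 1"
begin

abbreviation N where "N \<equiv> s k"

definition block_of :: "nat \<Rightarrow> nat" where
  "block_of i = (LEAST c. i < s (Suc c))"

text \<open>
  The velocity of a position. Positions belong to the same block if and only if their velocities agree (\<open>h_eq_iff\<close>).
\<close>

definition h :: "nat \<Rightarrow> int" where
  "h i = L (block_of i)"

definition block :: "nat \<Rightarrow> 'a list \<Rightarrow> 'a list" where
  "block c xs = drop (s c) (take (s (Suc c)) xs)"

text \<open>
  The product of the Macdonald polynomials of the first \<open>c\<close> blocks.
\<close>

definition block_prod :: "nat \<Rightarrow> int list \<Rightarrow> laurent_poly" where
  "block_prod c lam = (\<Prod>b<c. macdonald_P q t (block b lam) (block b [0..<N]))"

definition block_sorted :: "int list \<Rightarrow> bool" where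
  "block_sorted lam \<longleftrightarrow> (\<forall>i. Suc i < length lam \<and> h i = h (Suc i) \<longrightarrow> lam ! Suc i \<le> lam ! i)"

lemma s_mono: "i \<le> j \<Longrightarrow> s i \<le> s j"
  by (rule lift_Suc_mono_le[of s]) (rule s_Suc)

lemma block_ofI:
  assumes "s c \<le> i" "i < s (Suc c)" shows "block_of i = c"
  unfolding block_of_def
proof (rule Least_equality)
  fix b assume "i < s (Suc b)"
  then show "c \<le> b" using s_mono[of "Suc b" c] assms by (cases "c \<le> b") auto
qed fact

lemma block_of:
  assumes "i < N"
  shows "s (block_of i) \<le> i" "i < s (Suc (block_of i))" "block_of i < k"
proof -
  have ex: "i < s (Suc (k - 1))" using assms by (cases k) auto
  show 1: "i < s (Suc (block_of i))"
    unfolding block_of_def by (rule LeastI[of _ "k - 1"]) (rule ex)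
  show "s (block_of i) \<le> i"
  proof (cases "block_of i")
    case (Suc b)
    then have "\<not> i < s (Suc b)" using not_less_Least[of b "\<lambda>c. i < s (Suc c)"] by (simp add: block_of_def)
    then show ?thesis using Suc by simp
  qed simp
  have "block_of i \<le> k - 1" unfolding block_of_def by (rule Least_le) (rule ex)
  then show "block_of i < k" using assms by (cases k) auto
qed

lemma block_of_mono: "i \<le> j \<Longrightarrow> j < N \<Longrightarrow> block_of i \<le> block_of j"
  using block_of[of j] unfolding block_of_def by (intro Least_le) (simp add: block_of_def[symmetric])

lemma h_eq_iff: "i < N \<Longrightarrow> j < N \<Longrightarrow> h i = h j \<longleftrightarrow> block_of i = block_of j"
  using L_dec[of "block_of i" "block_of j"] L_dec[of "block_of j" "block_of i"] block_of(3)[of i] block_of(3)[of j]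
  unfolding h_def by (metis less_irrefl linorder_neqE_nat)

lemma h_antimono: "i \<le> j \<Longrightarrow> j < N \<Longrightarrow> h j \<le> h i"
  using block_of_mono[of i j] L_dec[of "block_of i" "block_of j"] block_of(3)[of j]
  unfolding h_def by (cases "block_of i = block_of j") auto

lemma h_separates:
  assumes "c < k" "i < s c" "s c \<le> j" "j < s (Suc c)"
  shows "h i \<noteq> h j"
proof -
  have N: "j < N" "i < N" using s_mono[of "Suc c" k] assms by auto
  have "block_of j = c" using assms by (intro block_ofI)
  moreover have "block_of i < c"
    using block_of(1)[OF N(2)] s_mono[of c "block_of i"] assms(2) by (cases "c \<le> block_of i") auto
  ultimately show ?thesis using h_eq_iff[OF N(2,1)] by simp
qed

lemma h_same:
  assumes "s c \<le> i" "i < s (Suc c)" "s c \<le> j" "j < s (Suc c)"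
  shows "h i = h j"
  using block_ofI[of c i] block_ofI[of c j] assms by (simp add: h_def)

lemma length_block: "s (Suc c) \<le> length xs \<Longrightarrow> length (block c xs) = s (Suc c) - s c"
  by (simp add: block_def)

lemma nth_block: "i < length (block c xs) \<Longrightarrow> block c xs ! i = xs ! (s c + i)"
  unfolding block_def by (subst nth_drop) auto

lemma block_variables: "c < k \<Longrightarrow> block c [0..<N] = [s c..<s (Suc c)]"
  using s_mono[of "Suc c" k] by (simp add: block_def)

lemma block_append:
  "length xs = s c \<Longrightarrow> b < c \<Longrightarrow> block b (xs @ ys) = block b xs"
  using s_mono[of "Suc b" c] by (simp add: block_def)

lemma block_append_last:
  "length xs = s c \<Longrightarrow> s c + length ys \<le> s (Suc c) \<Longrightarrow> block c (xs @ ys) = ys"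
  by (simp add: block_def)

lemma block_empty: "length xs \<le> s c \<Longrightarrow> block c xs = []"
  by (simp add: block_def)

lemma block_prod_append:
  "length xs = s c \<Longrightarrow> block_prod c (xs @ ys) = block_prod c xs"
  by (simp add: block_prod_def block_append)

lemma block_Sig:
  assumes "block_sorted lam" shows "block c lam \<in> Sig (length (block c lam))"
proof (rule SigI)
  fix i assume i: "Suc i < length (block c lam)"
  then have "s c + Suc i < s (Suc c)" "s c + Suc i < length lam" by (auto simp: block_def)
  then have "lam ! Suc (s c + i) \<le> lam ! (s c + i)"
    using assms h_same[of c "s c + i" "Suc (s c + i)"] by (auto simp: block_sorted_def)
  then show "block c lam ! Suc i \<le> block c lam ! i" using i by (simp add: nth_block)
qed simp

lemma interlacing_block_sorted:
  assumes "interlacing h n (length \<sigma>) ((!) lam) ((!) \<sigma>)" "length \<sigma> \<le> n"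
  shows "block_sorted \<sigma>"
  unfolding block_sorted_def
proof (intro allI impI)
  fix i assume i: "Suc i < length \<sigma> \<and> h i = h (Suc i)"
  then have "lam ! Suc i \<le> \<sigma> ! i" "\<sigma> ! Suc i \<le> lam ! Suc i"
    using assms by (auto simp: interlacing_def)
  then show "\<sigma> ! Suc i \<le> \<sigma> ! i" by linarith
qed

text \<open>
  Simultaneous removal of horizontal strips, of total size \<open>e\<close>, from the first \<open>c\<close> blocks.
\<close>

definition block_strips :: "nat \<Rightarrow> int list \<Rightarrow> nat \<Rightarrow> int list set" where
  "block_strips c lam e = {\<tau>. length \<tau> = s c \<and> interlacing h (s c) (s c) ((!) lam) ((!) \<tau>) \<and>
     (\<Sum>i<s c. lam ! i) - sum_list \<tau> = int e}"

lemma finite_block_strips: "finite (block_strips c lam e)"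
  by (rule finite_subset[OF _ finite_bounded_lists_fixed_sum[of "s c" "(!) lam" "(\<Sum>i<s c. lam ! i) - int e"]])
    (auto simp: block_strips_def interlacing_def)

lemma sum_list_block:
  fixes lam :: "int list"
  shows "s (Suc c) \<le> length lam \<Longrightarrow> (\<Sum>i<s (Suc c). lam ! i) = (\<Sum>i<s c. lam ! i) + sum_list (block c lam)"
proof -
  assume le: "s (Suc c) \<le> length lam"
  have "(\<Sum>i<s c + (s (Suc c) - s c). lam ! i) = (\<Sum>i<s c. lam ! i) + (\<Sum>i<s (Suc c) - s c. lam ! (s c + i))"
  proof -
    have "(\<Sum>i<a + m. f i) = (\<Sum>i<a. f i) + (\<Sum>i<m. f (a + i))" for a m and f :: "nat \<Rightarrow> int"
      by (induction m) auto
    then show ?thesis .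
  qed
  then show ?thesis
    using s_Suc[of c] le by (simp add: sum_list_sum_nth length_block nth_block atLeast0LessThan cong: sum.cong_simp)
qed

lemma skew_block_append:
  assumes c: "c < k" and len: "length \<tau> = s c" and n: "s c + n \<le> s (Suc c)" "length \<mu> \<le> n" "s c + n \<le> length lam"
  shows "skew_coeff q t h (s c + n) (s c + length \<mu>) ((!) lam) ((!) (\<tau> @ \<mu>)) =
      skew_coeff q t h (s c) (s c) ((!) lam) ((!) \<tau>) * skew_coeff q t (\<lambda>_. 0) n (length \<mu>) (\<lambda>i. lam ! (s c + i)) ((!) \<mu>)" (is ?A)
    and "interlacing h (s c + n) (s c + length \<mu>) ((!) lam) ((!) (\<tau> @ \<mu>)) \<longleftrightarrow>
      interlacing h (s c) (s c) ((!) lam) ((!) \<tau>) \<and> interlacing (\<lambda>_. 0) n (length \<mu>) (\<lambda>i. lam ! (s c + i)) ((!) \<mu>)" (is ?B)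
proof -
  have sep: "h i \<noteq> h j" if "i < s c" "s c \<le> j" "j < s c + n" for i j
    using that n c by (intro h_separates[of c]) auto
  have same: "h i = h j" if "s c \<le> i" "i < s c + n" "s c \<le> j" "j < s c + n" for i j
    using that n by (intro h_same[of c]) auto
  have mu: "(\<lambda>i. (\<tau> @ \<mu>) ! (s c + i)) = (!) \<mu>"
    using len by (simp add: nth_append fun_eq_iff)
  have "skew_coeff q t h (s c) (s c) ((!) lam) ((!) (\<tau> @ \<mu>)) = skew_coeff q t h (s c) (s c) ((!) lam) ((!) \<tau>)"
    by (rule skew_coeff_cong) (auto simp: nth_append len)
  then show ?A
    using skew_coeff_append[where a = "s c" and n = n and h = h, OF sep same n(2), where q = q and t = t and l = "(!) lam" and m = "(!) (\<tau> @ \<mu>)"] unfolding mu by simp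
  have "interlacing h (s c) (s c) ((!) lam) ((!) (\<tau> @ \<mu>)) = interlacing h (s c) (s c) ((!) lam) ((!) \<tau>)"
    by (rule interlacing_cong) (auto simp: nth_append len)
  then show ?B
    using interlacing_append[where a = "s c" and n = n and h = h, OF sep same n(2), where l = "(!) lam" and m = "(!) (\<tau> @ \<mu>)"] unfolding mu by simp
qed

text \<open>
  The Pieri rule for several complete blocks at once: \<open>g_series\<close> is multiplicative in the variables, and the weights are
  multiplicative in the blocks.
\<close>

lemma block_pieri:
  "c \<le> k \<Longrightarrow> s c \<le> length lam \<Longrightarrow> block_sorted lam \<Longrightarrow>
    fps_nth (g_series q t (\<lambda>i. i) (s c)) e * block_prod c lam =
    (\<Sum>\<tau>\<in>block_strips c lam e. const (skew_coeff q t h (s c) (s c) ((!) lam) ((!) \<tau>)) * block_prod c \<tau>)"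
proof (induction c arbitrary: e)
  case 0
  have "block_strips 0 lam e = (if e = 0 then {[]} else {})"
    by (auto simp: block_strips_def interlacing_def)
  then show ?case
    by (simp add: g_series_def fps_one_nth block_prod_def skew_coeff_def)
next
  case (Suc c)
  define a where "a = s c"
  define n where "n = s (Suc c) - s c"
  define P where "P = (\<lambda>\<mu>. macdonald_P q t \<mu> (block c [0..<N]))"
  define lc where "lc = block c lam"
  have an: "s (Suc c) = a + n" using s_Suc[of c] by (simp add: a_def n_def)
  have len: "length lc = n" using Suc.prems by (simp add: lc_def length_block n_def)
  have lc_nth: "lc ! i = lam ! (a + i)" if "i < n" for i
    using that len by (simp add: lc_def nth_block a_def)
  have c: "c < k" "c \<le> k" using Suc.prems by auto
  have lenlam: "a + n \<le> length lam" using Suc.prems an by simp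
  have "g_series q t (\<lambda>i. i) (s (Suc c)) = g_series q t (\<lambda>i. i) a * g_series q t (\<lambda>i. a + i) n"
    unfolding an g_series_def by (rule prod_lessThan_add)
  also have "g_series q t (\<lambda>i. a + i) n = g_series q t ((!) (block c [0..<N])) n"
    unfolding g_series_def block_variables[OF c(1)] by (intro prod.cong) (auto simp: a_def n_def)
  finally have G: "fps_nth (g_series q t (\<lambda>i. i) (s (Suc c))) e =
      (\<Sum>i = 0..e. fps_nth (g_series q t (\<lambda>i. i) a) i * fps_nth (g_series q t ((!) (block c [0..<N])) n) (e - i))"
    by (simp add: fps_mult_nth)
  have lc_Sig: "lc \<in> Sig n" using block_Sig[OF Suc.prems(3), of c] len by (simp add: lc_def)
  have split: "block_prod (Suc c) lam = block_prod c lam * P lc"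
    by (simp add: block_prod_def P_def lc_def)
  define X where "X = (\<lambda>\<tau>. const (skew_coeff q t h a a ((!) lam) ((!) \<tau>)) * block_prod c \<tau>)"
  define Y where "Y = (\<lambda>\<sigma>. const (skew_coeff q t (\<lambda>_. 0) n n ((!) lc) ((!) \<sigma>)) * P \<sigma>)"
  have "fps_nth (g_series q t (\<lambda>i. i) (s (Suc c))) e * block_prod (Suc c) lam =
    (\<Sum>i = 0..e. (fps_nth (g_series q t (\<lambda>i. i) (s c)) i * block_prod c lam) * (fps_nth (g_series q t ((!) (block c [0..<N])) n) (e - i) * P lc))"
    unfolding G split a_def[symmetric] sum_distrib_right by (simp only: mult_ac)
  also have "\<dots> = (\<Sum>i = 0..e. (\<Sum>\<tau>\<in>block_strips c lam i. X \<tau>) * (\<Sum>\<sigma>\<in>strips lc (e - i). Y \<sigma>))"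
    unfolding P_def using Suc.prems c s_Suc[of c] by (simp add: Suc.IH g_pieri[OF q t lc_Sig] X_def Y_def P_def a_def)
  also have "\<dots> = (\<Sum>i = 0..e. \<Sum>(\<tau>, \<sigma>)\<in>block_strips c lam i \<times> strips lc (e - i). X \<tau> * Y \<sigma>)"
    by (simp add: sum_product sum.cartesian_product)
  also have "\<dots> = (\<Sum>(i, \<tau>, \<sigma>)\<in>(SIGMA i:{0..e}. block_strips c lam i \<times> strips lc (e - i)). X \<tau> * Y \<sigma>)"
    by (subst sum.Sigma) (auto simp: finite_block_strips finite_strips case_prod_unfold)
  also have "\<dots> = (\<Sum>\<rho>\<in>block_strips (Suc c) lam e. const (skew_coeff q t h (s (Suc c)) (s (Suc c)) ((!) lam) ((!) \<rho>)) * block_prod (Suc c) \<rho>)"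
  proof (rule sum.reindex_bij_witness[of _ "\<lambda>\<rho>. (nat ((\<Sum>i<a. lam ! i) - sum_list (take a \<rho>)), take a \<rho>, drop a \<rho>)" "\<lambda>(i, \<tau>, \<sigma>). \<tau> @ \<sigma>"])
    fix x assume x: "x \<in> (SIGMA i:{0..e}. block_strips c lam i \<times> strips lc (e - i))"
    then obtain i \<tau> \<sigma> where x_eq: "x = (i, \<tau>, \<sigma>)" and i: "i \<le> e" and \<tau>: "\<tau> \<in> block_strips c lam i" and \<sigma>: "\<sigma> \<in> strips lc (e - i)"
      by auto
    have lens: "length \<tau> = s c" "length \<sigma> = n"
      using \<tau> \<sigma> len by (auto simp: block_strips_def strips_def)
    note app = skew_block_append[OF c(1) lens(1), of n \<sigma> lam]
    have il_lc: "interlacing (\<lambda>_. 0) n n (\<lambda>i. lam ! (s c + i)) ((!) \<sigma>) = interlacing (\<lambda>_. 0) n n ((!) lc) ((!) \<sigma>)"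
      by (rule interlacing_cong) (auto simp: lc_nth a_def)
    have sk_lc: "skew_coeff q t (\<lambda>_. 0) n n (\<lambda>i. lam ! (s c + i)) ((!) \<sigma>) = skew_coeff q t (\<lambda>_. 0) n n ((!) lc) ((!) \<sigma>)"
      by (rule skew_coeff_cong) (auto simp: lc_nth a_def)
    show "(\<lambda>\<rho>. (nat ((\<Sum>i<a. lam ! i) - sum_list (take a \<rho>)), take a \<rho>, drop a \<rho>)) (case x of (i, \<tau>, \<sigma>) \<Rightarrow> \<tau> @ \<sigma>) = x"
      using \<tau> lens by (simp add: x_eq block_strips_def a_def)
    show "(case x of (i, \<tau>, \<sigma>) \<Rightarrow> \<tau> @ \<sigma>) \<in> block_strips (Suc c) lam e"
      using \<tau> \<sigma> i lens app(2) an lenlam il_lc sum_list_block[of c lam] Suc.prems(2)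
      by (auto simp: x_eq block_strips_def strips_def a_def lc_def len of_nat_diff)
    have "block_prod (Suc c) (\<tau> @ \<sigma>) = block_prod c \<tau> * P \<sigma>"
      using block_prod_append[OF lens(1), of \<sigma>] block_append_last[OF lens(1), of \<sigma>] lens an
      by (simp add: block_prod_def P_def a_def)
    then show "const (skew_coeff q t h (s (Suc c)) (s (Suc c)) ((!) lam) ((!) (case x of (i, \<tau>, \<sigma>) \<Rightarrow> \<tau> @ \<sigma>))) *
        block_prod (Suc c) (case x of (i, \<tau>, \<sigma>) \<Rightarrow> \<tau> @ \<sigma>) = (case x of (i, \<tau>, \<sigma>) \<Rightarrow> X \<tau> * Y \<sigma>)"
      using app(1) an lens lenlam sk_lc by (simp add: x_eq X_def Y_def const_mult a_def mult_ac)
  next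
    fix \<rho> assume \<rho>: "\<rho> \<in> block_strips (Suc c) lam e"
    define \<tau> where "\<tau> = take a \<rho>"
    define \<sigma> where "\<sigma> = drop a \<rho>"
    have lens: "length \<tau> = s c" "length \<sigma> = n" and \<rho>_eq: "\<rho> = \<tau> @ \<sigma>"
      using \<rho> an by (auto simp: block_strips_def \<tau>_def \<sigma>_def a_def)
    note app = skew_block_append[OF c(1) lens(1), of n \<sigma> lam]
    have il_lc: "interlacing (\<lambda>_. 0) n n (\<lambda>i. lam ! (s c + i)) ((!) \<sigma>) = interlacing (\<lambda>_. 0) n n ((!) lc) ((!) \<sigma>)"
      by (rule interlacing_cong) (auto simp: lc_nth a_def)
    have il: "interlacing h a a ((!) lam) ((!) \<tau>)" "interlacing (\<lambda>_. 0) n n ((!) lc) ((!) \<sigma>)"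
      using \<rho> app(2) an lens lenlam il_lc by (auto simp: block_strips_def \<rho>_eq a_def)
    have "0 \<le> (\<Sum>i<a. lam ! i - \<tau> ! i)" "0 \<le> (\<Sum>i<n. lc ! i - \<sigma> ! i)"
      using il by (auto simp: interlacing_def intro!: sum_nonneg)
    then have def: "0 \<le> (\<Sum>i<a. lam ! i) - sum_list \<tau>" "0 \<le> sum_list lc - sum_list \<sigma>"
      using lens len by (auto simp: sum_subtractf sum_list_sum_nth atLeast0LessThan a_def)
    have total: "((\<Sum>i<a. lam ! i) - sum_list \<tau>) + (sum_list lc - sum_list \<sigma>) = int e"
      using \<rho> sum_list_block[of c lam] Suc.prems(2) by (simp add: block_strips_def \<rho>_eq lc_def a_def)
    show "(case (nat ((\<Sum>i<a. lam ! i) - sum_list (take a \<rho>)), take a \<rho>, drop a \<rho>) of (i, \<tau>, \<sigma>) \<Rightarrow> \<tau> @ \<sigma>) = \<rho>"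
      by simp
    show "(nat ((\<Sum>i<a. lam ! i) - sum_list (take a \<rho>)), take a \<rho>, drop a \<rho>) \<in> (SIGMA i:{0..e}. block_strips c lam i \<times> strips lc (e - i))"
      unfolding \<tau>_def[symmetric] \<sigma>_def[symmetric]
      using def total il lens len by (auto simp: block_strips_def strips_def a_def)
  qed
  finally show ?case .
qed

text \<open>
  The signatures that remain, relative to the shifts, when the last variable with exponent \<open>e\<close> is removed in the limit.
\<close>

definition below :: "nat \<Rightarrow> int list \<Rightarrow> int \<Rightarrow> int list set" where
  "below n lam e = {\<sigma>. length \<sigma> = n \<and> interlacing h (Suc n) n ((!) lam) ((!) \<sigma>) \<and> sum_list lam - sum_list \<sigma> = e}"

lemma finite_below: "finite (below n lam e)"
  by (rule finite_subset[OF _ finite_bounded_lists_fixed_sum[of n "(!) lam" "sum_list lam - e"]])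
    (auto simp: below_def interlacing_def)

text \<open>
  The limit of the coefficient of \<open>d\<close>, with the variables removed one by one. For \<open>n = 0\<close> only the constant
  polynomial \<open>1\<close> is left.
\<close>

primrec limit_coeff :: "nat \<Rightarrow> int list \<Rightarrow> monomial \<Rightarrow> real" where
  "limit_coeff 0 lam d = (if d = 0 then 1 else 0)"
| "limit_coeff (Suc n) lam d = (\<Sum>\<sigma>\<in>below n lam (lookup d n).
     skew_coeff q t h (Suc n) n ((!) lam) ((!) \<sigma>) * limit_coeff n \<sigma> (d - single n (lookup d n)))"

definition shift :: "nat \<Rightarrow> int list \<Rightarrow> int list" where
  "shift D lam = map (\<lambda>i. lam ! i + h i * int D) [0..<length lam]"

definition shift_monomial :: "nat \<Rightarrow> nat \<Rightarrow> monomial" where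
  "shift_monomial D n = (\<Sum>i<n. single i (h i * int D))"

lemma length_shift [simp]: "length (shift D lam) = length lam"
  by (simp add: shift_def)

lemma nth_shift: "i < length lam \<Longrightarrow> shift D lam ! i = lam ! i + h i * int D"
  by (simp add: shift_def)

lemma sum_list_shift: "sum_list (shift D lam) = sum_list lam + (\<Sum>i<length lam. h i) * int D"
  by (simp add: sum_list_sum_nth nth_shift sum.distrib sum_distrib_right atLeast0LessThan cong: sum.cong_simp)

definition unshift :: "nat \<Rightarrow> int list \<Rightarrow> int list" where
  "unshift D lam = map (\<lambda>i. lam ! i - h i * int D) [0..<length lam]"

lemma shift_unshift [simp]: "shift D (unshift D lam) = lam"
  by (intro nth_equalityI) (simp_all add: shift_def unshift_def)

lemma unshift_shift [simp]: "unshift D (shift D lam) = lam"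
  by (intro nth_equalityI) (simp_all add: shift_def unshift_def)

lemma inj_shift: "shift D \<sigma> = shift D \<tau> \<Longrightarrow> \<sigma> = \<tau>"
  by (metis unshift_shift)

lemma length_unshift [simp]: "length (unshift D lam) = length lam"
  by (simp add: unshift_def)

lemma below_of_interlace:
  assumes "\<mu> \<prec>\<^sub>P shift D lam" "length lam = Suc n"
  shows "interlacing h (Suc n) n ((!) lam) ((!) (unshift D \<mu>))"
proof -
  have len: "length \<mu> = n" using assms by (simp add: interlace_def)
  have 1: "\<mu> ! i \<le> lam ! i + h i * int D" "lam ! Suc i + h (Suc i) * int D \<le> \<mu> ! i" if "i < n" for i
    using assms that len by (auto simp: interlace_def nth_shift)
  have 2: "unshift D \<mu> ! i = \<mu> ! i - h i * int D" if "i < n" for i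
    using that len by (simp add: unshift_def)
  show ?thesis
    unfolding interlacing_def
  proof (intro conjI allI impI)
    fix i assume "i < n"
    then show "unshift D \<mu> ! i \<le> lam ! i" using 1(1)[of i] 2[of i] by simp
  next
    fix i assume i: "Suc i < Suc n \<and> h i = h (Suc i)"
    then show "lam ! Suc i \<le> unshift D \<mu> ! i" using 1(2)[of i] 2[of i] by simp
  qed
qed

text \<open>
  The inequalities between neighbours in different blocks hold as soon as the blocks are far enough apart.
\<close>

lemma eventually_interlace_shift:
  assumes "\<sigma> \<in> below n lam e" "length lam = Suc n" "Suc n \<le> N"
  shows "\<forall>\<^sub>F D in sequentially. shift D \<sigma> \<prec>\<^sub>P shift D lam"
proof -
  have len: "length \<sigma> = n" and il: "\<And>i. i < n \<Longrightarrow> \<sigma> ! i \<le> lam ! i" "\<And>i. i < n \<Longrightarrow> h i = h (Suc i) \<Longrightarrow> lam ! Suc i \<le> \<sigma> ! i"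
    using assms(1) by (auto simp: below_def interlacing_def)
  have "\<forall>\<^sub>F D in sequentially. \<forall>i\<in>{..<n}. lam ! Suc i + h (Suc i) * int D \<le> \<sigma> ! i + h i * int D"
  proof (intro eventually_ball_finite ballI)
    fix i assume i: "i \<in> {..<n}"
    show "\<forall>\<^sub>F D in sequentially. lam ! Suc i + h (Suc i) * int D \<le> \<sigma> ! i + h i * int D"
    proof (cases "h i = h (Suc i)")
      case True
      then show ?thesis using il(2)[of i] i by simp
    next
      case False
      then have gt: "1 \<le> h i - h (Suc i)"
        using h_antimono[of i "Suc i"] i assms(3) by auto
      show ?thesis
      proof (rule eventually_sequentiallyI[of "nat (lam ! Suc i - \<sigma> ! i)"])
        fix D assume "nat (lam ! Suc i - \<sigma> ! i) \<le> D"
        then have "lam ! Suc i - \<sigma> ! i \<le> int D" by simp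
        also have "\<dots> \<le> (h i - h (Suc i)) * int D" using mult_right_mono[OF gt, of "int D"] by simp
        finally show "lam ! Suc i + h (Suc i) * int D \<le> \<sigma> ! i + h i * int D" by (simp add: algebra_simps)
      qed
    qed
  qed simp
  then show ?thesis
    by eventually_elim (use il(1) len assms(2) in \<open>auto simp: interlace_def nth_shift\<close>)
qed

text \<open>
  In the branching rule only rows with the sum prescribed by the exponent of the last variable contribute. After
  subtraction of the shifts these are among the finitely many elements of \<open>below\<close>, and for large \<open>D\<close> they are all of
  them.
\<close>

theorem tendsto_limit_coeff:
  "n \<le> N \<Longrightarrow> length lam = n \<Longrightarrow>
    (\<lambda>D. lookup (macdonald_P q t (shift D lam) [0..<N]) (d + shift_monomial D n)) \<longlonglongrightarrow> limit_coeff n lam d"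
proof (induction n arbitrary: lam d)
  case 0
  then show ?case by (simp add: shift_def shift_monomial_def lookup_one when_def)
next
  case (Suc n)
  define e where "e = lookup d n"
  define d' where "d' = d - single n e"
  define S where "S = below n lam e"
  have finS: "finite S" by (simp add: S_def finite_below)
  define F where "F = (\<lambda>D \<sigma>. skew_coeff q t (\<lambda>_. 0) (Suc n) n (\<lambda>i. lam ! i + h i * int D) (\<lambda>i. \<sigma> ! i + h i * int D) *
     lookup (macdonald_P q t (shift D \<sigma>) [0..<N]) (d' + shift_monomial D n))"
  have expand: "lookup (macdonald_P q t (shift D lam) [0..<N]) (d + shift_monomial D (Suc n)) = (\<Sum>\<sigma>\<in>S. F D \<sigma>)"
    if all: "\<forall>\<sigma>\<in>S. shift D \<sigma> \<prec>\<^sub>P shift D lam" for D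
  proof -
    have len: "length (shift D lam) = Suc n" using Suc.prems by simp
    define X where "X = (\<lambda>\<mu>. mac_psi q t (shift D lam) \<mu> * lookup (macdonald_P q t \<mu> [0..<N])
       (d + shift_monomial D (Suc n) - single n (sum_list (shift D lam) - sum_list \<mu>)))"
    have "lookup (macdonald_P q t (shift D lam) [0..<N]) (d + shift_monomial D (Suc n)) = (\<Sum>\<mu> | \<mu> \<prec>\<^sub>P shift D lam. X \<mu>)"
      unfolding macdonald_P_branching[OF len] using Suc.prems
      by (simp add: X_def lookup_sum mult.assoc lookup_const_mult lookup_x_pow_mult)
    also have "\<dots> = (\<Sum>\<mu>\<in>shift D ` S. X \<mu>)"
    proof (rule sum.mono_neutral_right[OF finite_interlace])
      show "shift D ` S \<subseteq> {\<mu>. \<mu> \<prec>\<^sub>P shift D lam}" using all by auto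
      show "\<forall>\<mu>\<in>{\<mu>. \<mu> \<prec>\<^sub>P shift D lam} - shift D ` S. X \<mu> = 0"
      proof
        fix \<mu> assume \<mu>: "\<mu> \<in> {\<mu>. \<mu> \<prec>\<^sub>P shift D lam} - shift D ` S"
        then have len\<mu>: "length \<mu> = n" using Suc.prems by (simp add: interlace_def)
        have "unshift D \<mu> \<notin> S"
          using \<mu> by (metis DiffD2 imageI shift_unshift)
        then have ne: "sum_list lam - sum_list (unshift D \<mu>) \<noteq> e"
          using \<mu> below_of_interlace[of \<mu> D lam n] Suc.prems len\<mu> by (auto simp: S_def below_def)
        have sums: "sum_list (shift D lam) - sum_list \<mu> = sum_list lam - sum_list (unshift D \<mu>) + h n * int D"
          using sum_list_shift[of D "unshift D \<mu>"] sum_list_shift[of D lam] Suc.prems len\<mu> by (simp add: algebra_simps)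
        \<comment> \<open>The exponent that is left for \<open>x\<^sub>n\<close> is not zero, but \<open>x\<^sub>n\<close> does not occur any more.\<close>
        have "free_of n (macdonald_P q t \<mu> [0..<N])"
          using Suc.prems len\<mu> by (intro free_of_macdonald_P) auto
        moreover have "lookup (d + shift_monomial D (Suc n) - single n (sum_list (shift D lam) - sum_list \<mu>)) n \<noteq> 0"
        proof -
          have "lookup (shift_monomial D n) n = 0"
            by (simp add: shift_monomial_def lookup_sum lookup_single when_def)
          then show ?thesis
            using ne unfolding sums by (simp add: lookup_minus lookup_add shift_monomial_def e_def)
        qed
        ultimately show "X \<mu> = 0" by (auto simp: X_def free_of_def)
      qed
    qed
    also have "\<dots> = (\<Sum>\<sigma>\<in>S. X (shift D \<sigma>))"
      by (rule sum.reindex[unfolded o_def]) (auto simp: inj_on_def S_def below_def intro: inj_shift)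
    also have "\<dots> = (\<Sum>\<sigma>\<in>S. F D \<sigma>)"
    proof (rule sum.cong[OF refl])
      fix \<sigma> assume \<sigma>: "\<sigma> \<in> S"
      then have len\<sigma>: "length \<sigma> = n" and def: "sum_list lam - sum_list \<sigma> = e" by (auto simp: S_def below_def)
      have il: "shift D \<sigma> \<prec>\<^sub>P shift D lam" using all \<sigma> by auto
      have "mac_psi q t (shift D lam) (shift D \<sigma>) = skew_coeff q t (\<lambda>_. 0) (Suc n) n ((!) (shift D lam)) ((!) (shift D \<sigma>))"
        using mac_psi_eq_skew_coeff[OF q t il, of 0] len\<sigma> Suc.prems by simp
      also have "\<dots> = skew_coeff q t (\<lambda>_. 0) (Suc n) n (\<lambda>i. lam ! i + h i * int D) (\<lambda>i. \<sigma> ! i + h i * int D)"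
        by (rule skew_coeff_cong) (use len\<sigma> Suc.prems in \<open>auto simp: nth_shift\<close>)
      finally have psi: "mac_psi q t (shift D lam) (shift D \<sigma>) = \<dots>" .
      have "sum_list (shift D lam) - sum_list (shift D \<sigma>) = e + h n * int D"
        using def len\<sigma> Suc.prems by (simp add: sum_list_shift algebra_simps)
      then have "d + shift_monomial D (Suc n) - single n (sum_list (shift D lam) - sum_list (shift D \<sigma>)) = d' + shift_monomial D n"
        by (simp add: d'_def shift_monomial_def single_add algebra_simps)
      then show "X (shift D \<sigma>) = F D \<sigma>"
        by (simp only: X_def F_def psi)
    qed
    finally show ?thesis .
  qed
  have "(\<lambda>D. \<Sum>\<sigma>\<in>S. F D \<sigma>) \<longlonglongrightarrow> (\<Sum>\<sigma>\<in>S. skew_coeff q t h (Suc n) n ((!) lam) ((!) \<sigma>) * limit_coeff n \<sigma> d')"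
    unfolding F_def
  proof (intro tendsto_sum tendsto_mult Suc.IH)
    fix \<sigma> assume "\<sigma> \<in> S"
    then have il: "interlacing h (Suc n) n ((!) lam) ((!) \<sigma>)" and "length \<sigma> = n" by (auto simp: S_def below_def)
    then show "length \<sigma> = n" by simp
    have "h j \<le> h i" if "i \<le> j" "j < Suc n" for i j
      using h_antimono[of i j] that Suc.prems by simp
    then show "(\<lambda>D. skew_coeff q t (\<lambda>_. 0) (Suc n) n (\<lambda>i. lam ! i + h i * int D) (\<lambda>i. \<sigma> ! i + h i * int D)) \<longlonglongrightarrow>
        skew_coeff q t h (Suc n) n ((!) lam) ((!) \<sigma>)"
      by (intro tendsto_skew_coeff_shift q t il) auto
  qed (use Suc.prems in auto)
  moreover have "\<forall>\<^sub>F D in sequentially. \<forall>\<sigma>\<in>S. shift D \<sigma> \<prec>\<^sub>P shift D lam"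
    using Suc.prems by (intro eventually_ball_finite finS ballI eventually_interlace_shift[of _ n lam e]) (auto simp: S_def)
  then have "\<forall>\<^sub>F D in sequentially. (\<Sum>\<sigma>\<in>S. F D \<sigma>) = lookup (macdonald_P q t (shift D lam) [0..<N]) (d + shift_monomial D (Suc n))"
    by eventually_elim (simp add: expand)
  ultimately have "(\<lambda>D. lookup (macdonald_P q t (shift D lam) [0..<N]) (d + shift_monomial D (Suc n))) \<longlonglongrightarrow>
      (\<Sum>\<sigma>\<in>S. skew_coeff q t h (Suc n) n ((!) lam) ((!) \<sigma>) * limit_coeff n \<sigma> d')"
    by (rule Lim_transform_eventually)
  then show ?case by (simp add: S_def e_def d'_def)
qed

text \<open>
  The truncation of the product of all kernels, restricted to the first \<open>n\<close> variables.
\<close>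

definition kernel_prod :: "nat \<Rightarrow> nat \<Rightarrow> laurent_poly" where
  "kernel_prod B n = (\<Prod>j<n. \<Prod>i<j. if h i = h j then 1 else kernel_trunc q t B i j)"

lemma block_prod_beyond:
  assumes "length lam \<le> s c" "c \<le> k"
  shows "block_prod k lam = block_prod c lam"
proof -
  have "block_prod k lam = (\<Prod>b\<in>{..<c} \<union> {c..<k}. macdonald_P q t (block b lam) (block b [0..<N]))"
    unfolding block_prod_def using assms(2) by (simp add: ivl_disj_un)
  also have "\<dots> = block_prod c lam * (\<Prod>b\<in>{c..<k}. macdonald_P q t (block b lam) (block b [0..<N]))"
    unfolding block_prod_def by (rule prod.union_disjoint) auto
  also have "(\<Prod>b\<in>{c..<k}. macdonald_P q t (block b lam) (block b [0..<N])) = 1"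
  proof (intro prod.neutral ballI)
    fix b assume "b \<in> {c..<k}"
    then have "block b lam = []" using assms(1) s_mono[of c b] by (intro block_empty) auto
    then show "macdonald_P q t (block b lam) (block b [0..<N]) = 1" by simp
  qed
  finally show ?thesis by simp
qed

lemma free_of_block_prod:
  assumes "c \<le> k" "s c \<le> x"
  shows "free_of x (block_prod c lam)"
  unfolding block_prod_def
proof (intro free_of_prod free_of_macdonald_P)
  fix b i assume b: "b \<in> {..<c}" and i: "i < length (block b lam)"
  have len: "length (block b lam) \<le> s (Suc b) - s b" by (auto simp: block_def)
  have "block b [0..<N] ! i = s b + i"
    using b i len assms(1) by (simp add: block_variables)
  moreover have "s (Suc b) \<le> s c" using b by (intro s_mono) auto
  ultimately show "block b [0..<N] ! i \<noteq> x"
    using i len assms(2) by linarith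
qed

text \<open>
  The last variable \<open>x\<^sub>n\<close> occurs in the polynomial of its own block, which is expanded by the branching rule, and in the
  kernel factors with the variables of all earlier blocks, which act on the polynomials of these blocks by \<open>block_pieri\<close>.
  Together the two expansions run over \<open>below\<close>, with the product of the weights.
\<close>

theorem eventually_kernel_expansion:
  "n \<le> N \<Longrightarrow> length lam = n \<Longrightarrow> block_sorted lam \<Longrightarrow>
    \<forall>\<^sub>F B in sequentially. lookup (block_prod k lam * kernel_prod B n) d = limit_coeff n lam d"
proof (induction n arbitrary: lam d)
  case 0
  then have "block_prod k lam = 1"
    using block_prod_beyond[of lam 0] by (simp add: block_prod_def)
  then show ?case by (simp add: kernel_prod_def lookup_one when_def)
next
  case (Suc n)
  define c where "c = block_of n"
  define a where "a = s c"
  have c: "c < k" "a \<le> n" "n < s (Suc c)" "n < N"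
    using block_of[of n] Suc.prems by (auto simp: c_def a_def)
  define e where "e = lookup d n"
  define d' where "d' = d - single n e"
  define lc where "lc = drop a lam"
  define vs where "vs = block c [0..<N]"
  define P where "P = (\<lambda>\<mu>. macdonald_P q t \<mu> vs)"
  define S where "S = below n lam e"
  define M where "M = {\<mu>. \<mu> \<prec>\<^sub>P lc}"
  define \<delta> where "\<delta> = (\<lambda>\<mu>. sum_list lc - sum_list \<mu>)"
  define X where "X = (\<lambda>\<tau>. skew_coeff q t h a a ((!) lam) ((!) \<tau>))"
  define sk where "sk = (\<lambda>\<sigma>. skew_coeff q t h (Suc n) n ((!) lam) ((!) \<sigma>))"
  have finM: "finite M" by (simp add: M_def finite_interlace)
  have len_lc: "length lc = Suc (n - a)" using Suc.prems c by (simp add: lc_def Suc_diff_le)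
  have vs_nth: "vs ! (n - a) = n"
    using c by (simp add: vs_def block_variables a_def)
  have "block c lam = lc"
    using Suc.prems c by (simp add: block_def lc_def a_def)
  then have split: "block_prod k lam = block_prod c lam * P lc"
    using block_prod_beyond[of lam "Suc c"] Suc.prems c by (simp add: block_prod_def P_def vs_def)
  have K: "kernel_prod B (Suc n) = kernel_prod B n * (\<Prod>i<a. kernel_trunc q t B i n)" for B
  proof -
    have "(\<Prod>i<n. if h i = h n then 1 else kernel_trunc q t B i n) = (\<Prod>i<a. kernel_trunc q t B i n)"
    proof (rule prod.mono_neutral_cong_right)
      show "\<forall>i\<in>{..<n} - {..<a}. (if h i = h n then 1 else kernel_trunc q t B i n) = 1"
      proof
        fix i assume "i \<in> {..<n} - {..<a}"
        then have "h i = h n" using c by (intro h_same[of c]) (auto simp: a_def)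
        then show "(if h i = h n then 1 else kernel_trunc q t B i n) = 1" by simp
      qed
      show "(if h i = h n then 1 else kernel_trunc q t B i n) = kernel_trunc q t B i n" if "i \<in> {..<a}" for i
      proof -
        have "h i \<noteq> h n" using c that by (intro h_separates[of c]) (auto simp: a_def)
        then show ?thesis by simp
      qed
    qed (use c in auto)
    then show ?thesis by (simp add: kernel_prod_def)
  qed
  have free: "free_of n (block_prod c lam * P \<mu> * kernel_prod B n)" if "length \<mu> = n - a" for \<mu> B
  proof (intro free_of_mult)
    show "free_of n (block_prod c lam)" using c by (intro free_of_block_prod) (auto simp: a_def)
    show "free_of n (P \<mu>)" unfolding P_def
    proof (rule free_of_macdonald_P)
      fix i assume "i < length \<mu>"
      then have i: "i < n - a" using that by simp
      then have "vs ! i = a + i" using c by (simp add: vs_def block_variables a_def)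
      then show "vs ! i \<noteq> n" using i by linarith
    qed
    show "free_of n (kernel_prod B n)"
      unfolding kernel_prod_def by (intro free_of_prod) (auto intro: free_of_1 free_of_kernel_trunc)
  qed
  \<comment> \<open>\<open>\<mu>\<close> is what remains of the last block, \<open>\<tau>\<close> what remains of the earlier ones. The exponent \<open>e\<close> of \<open>x\<^sub>n\<close> is
    distributed among the two expansions.\<close>
  define T where "T = (SIGMA \<mu>:{\<mu> \<in> M. \<delta> \<mu> \<le> e}. block_strips c lam (nat (e - \<delta> \<mu>)))"
  have T_iff: "\<tau> @ \<mu> \<in> S \<longleftrightarrow> (\<mu>, \<tau>) \<in> T" and T_sk: "(\<mu>, \<tau>) \<in> T \<Longrightarrow> sk (\<tau> @ \<mu>) = mac_psi q t lc \<mu> * X \<tau>"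
    if lens: "length \<tau> = a" "length \<mu> = n - a" for \<tau> \<mu>
  proof -
    have eqs: "s c + (Suc n - a) = Suc n" "s c + length \<mu> = n"
      using c lens by (auto simp: a_def)
    note app = skew_block_append[OF c(1), of \<tau> "Suc n - a" \<mu> lam, unfolded eqs, folded a_def]
    have il_lc: "interlacing (\<lambda>_. 0) (Suc n - a) (length \<mu>) (\<lambda>i. lam ! (a + i)) ((!) \<mu>) \<longleftrightarrow> \<mu> \<prec>\<^sub>P lc"
    proof -
      have "interlacing (\<lambda>_. 0) (Suc n - a) (length \<mu>) (\<lambda>i. lam ! (a + i)) ((!) \<mu>) = interlacing (\<lambda>_. 0) (length lc) (length \<mu>) ((!) lc) ((!) \<mu>)"
        unfolding len_lc Suc_diff_le[OF c(2)] by (rule interlacing_cong) (use lens Suc.prems c in \<open>auto simp: lc_def\<close>)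
      then show ?thesis using interlace_iff_interlacing[of lc \<mu>] lens len_lc by simp
    qed
    have il: "interlacing h (Suc n) n ((!) lam) ((!) (\<tau> @ \<mu>)) \<longleftrightarrow> interlacing h a a ((!) lam) ((!) \<tau>) \<and> \<mu> \<prec>\<^sub>P lc"
      using app(2) il_lc lens c Suc.prems by simp
    have lam_sum: "sum_list lam = (\<Sum>i<a. lam ! i) + sum_list lc"
    proof -
      have "sum_list lam = sum_list (take a lam) + sum_list (drop a lam)"
        by (simp flip: sum_list_append)
      moreover have "sum_list (take a lam) = (\<Sum>i<a. lam ! i)"
        using Suc.prems c by (simp add: sum_list_sum_nth atLeast0LessThan min_def)
      ultimately show ?thesis by (simp add: lc_def)
    qed
    have pos: "0 \<le> (\<Sum>i<a. lam ! i) - sum_list \<tau>" if "interlacing h a a ((!) lam) ((!) \<tau>)"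
    proof -
      have "0 \<le> (\<Sum>i<a. lam ! i - \<tau> ! i)" using that by (intro sum_nonneg) (auto simp: interlacing_def)
      then show ?thesis using lens by (simp add: sum_subtractf sum_list_sum_nth atLeast0LessThan)
    qed
    show "\<tau> @ \<mu> \<in> S \<longleftrightarrow> (\<mu>, \<tau>) \<in> T"
      using il lens c pos lam_sum
      by (auto simp: S_def T_def M_def \<delta>_def below_def block_strips_def a_def[symmetric])
    show "sk (\<tau> @ \<mu>) = mac_psi q t lc \<mu> * X \<tau>" if "(\<mu>, \<tau>) \<in> T"
    proof -
      have \<mu>: "\<mu> \<prec>\<^sub>P lc" using that by (simp add: T_def M_def)
      have "skew_coeff q t (\<lambda>_. 0) (Suc n - a) (length \<mu>) (\<lambda>i. lam ! (a + i)) ((!) \<mu>) = mac_psi q t lc \<mu>"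
        unfolding mac_psi_eq_skew_coeff[OF q t \<mu>, of 0] len_lc Suc_diff_le[OF c(2)]
        by (rule skew_coeff_cong) (use lens Suc.prems c in \<open>auto simp: lc_def\<close>)
      then show ?thesis
        using app(1) lens c Suc.prems by (simp add: sk_def X_def mult.commute)
    qed
  qed
  have expand: "lookup (block_prod k lam * kernel_prod B (Suc n)) d =
      (\<Sum>\<sigma>\<in>S. sk \<sigma> * lookup (block_prod k \<sigma> * kernel_prod B n) d')"
    if B: "\<forall>\<mu>\<in>M. e - \<delta> \<mu> \<le> int B" for B
  proof -
    have len\<mu>: "length \<mu> = n - a" if "\<mu> \<in> M" for \<mu>
      using that len_lc by (simp add: M_def interlace_def)
    have "block_prod k lam * kernel_prod B (Suc n) =
      (\<Sum>\<mu>\<in>M. const (mac_psi q t lc \<mu>) * (x_pow n (\<delta> \<mu>) * ((block_prod c lam * P \<mu> * kernel_prod B n) * (\<Prod>i<a. kernel_trunc q t B i n))))"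
      unfolding split K P_def macdonald_P_branching[OF len_lc] vs_nth M_def \<delta>_def
      by (simp only: sum_distrib_left sum_distrib_right) (simp only: mult_ac)
    then have "lookup (block_prod k lam * kernel_prod B (Suc n)) d =
      (\<Sum>\<mu>\<in>M. mac_psi q t lc \<mu> * lookup ((block_prod c lam * P \<mu> * kernel_prod B n) * (\<Prod>i<a. kernel_trunc q t B i n)) (d - single n (\<delta> \<mu>)))"
      by (simp add: lookup_sum lookup_const_mult lookup_x_pow_mult)
    also have "\<dots> = (\<Sum>\<mu>\<in>M. if \<delta> \<mu> \<le> e then \<Sum>\<tau>\<in>block_strips c lam (nat (e - \<delta> \<mu>)).
        sk (\<tau> @ \<mu>) * lookup (block_prod k (\<tau> @ \<mu>) * kernel_prod B n) d' else 0)"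
    proof (rule sum.cong[OF refl])
      fix \<mu> assume \<mu>: "\<mu> \<in> M"
      have e': "lookup (d - single n (\<delta> \<mu>)) n = e - \<delta> \<mu>"
        by (simp add: lookup_minus e_def)
      have d'': "d - single n (\<delta> \<mu>) - single n (e - \<delta> \<mu>) = d'"
        by (simp add: single_diff d'_def)
      have "lookup ((block_prod c lam * P \<mu> * kernel_prod B n) * (\<Prod>i<a. kernel_trunc q t B i n)) (d - single n (\<delta> \<mu>)) =
        (if 0 \<le> e - \<delta> \<mu> then lookup (fps_nth (g_series q t (\<lambda>i. i) a) (nat (e - \<delta> \<mu>)) * (block_prod c lam * P \<mu> * kernel_prod B n)) d' else 0)"
        using lookup_mult_kernel_column[OF c(2) free[OF len\<mu>[OF \<mu>], of B], where d = "d - single n (\<delta> \<mu>)" and B = B and q = q and t = t, unfolded e' d''] B \<mu>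
        by simp
      also have "fps_nth (g_series q t (\<lambda>i. i) a) (nat (e - \<delta> \<mu>)) * (block_prod c lam * P \<mu> * kernel_prod B n) =
          (fps_nth (g_series q t (\<lambda>i. i) a) (nat (e - \<delta> \<mu>)) * block_prod c lam) * (P \<mu> * kernel_prod B n)"
        by (simp only: mult_ac)
      also have "\<dots> = (\<Sum>\<tau>\<in>block_strips c lam (nat (e - \<delta> \<mu>)). const (X \<tau>) * (block_prod c \<tau> * P \<mu> * kernel_prod B n))"
      proof -
        have "fps_nth (g_series q t (\<lambda>i. i) a) (nat (e - \<delta> \<mu>)) * block_prod c lam = (\<Sum>\<tau>\<in>block_strips c lam (nat (e - \<delta> \<mu>)). const (X \<tau>) * block_prod c \<tau>)"
          unfolding a_def X_def using Suc.prems c by (intro block_pieri) (auto simp: a_def)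
        then show ?thesis by (simp only: sum_distrib_right mult.assoc)
      qed
      finally have "mac_psi q t lc \<mu> * lookup ((block_prod c lam * P \<mu> * kernel_prod B n) * (\<Prod>i<a. kernel_trunc q t B i n)) (d - single n (\<delta> \<mu>)) =
        (if \<delta> \<mu> \<le> e then \<Sum>\<tau>\<in>block_strips c lam (nat (e - \<delta> \<mu>)). mac_psi q t lc \<mu> * X \<tau> * lookup (block_prod c \<tau> * P \<mu> * kernel_prod B n) d' else 0)"
        by (simp add: lookup_sum lookup_const_mult sum_distrib_left mult.assoc)
      also have "\<dots> = (if \<delta> \<mu> \<le> e then \<Sum>\<tau>\<in>block_strips c lam (nat (e - \<delta> \<mu>)).
          sk (\<tau> @ \<mu>) * lookup (block_prod k (\<tau> @ \<mu>) * kernel_prod B n) d' else 0)"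
      proof (intro if_cong refl sum.cong)
        fix \<tau> assume le: "\<delta> \<mu> \<le> e" and \<tau>: "\<tau> \<in> block_strips c lam (nat (e - \<delta> \<mu>))"
        then have len\<tau>: "length \<tau> = s c" by (simp add: block_strips_def)
        have "sk (\<tau> @ \<mu>) = mac_psi q t lc \<mu> * X \<tau>"
          using \<mu> \<tau> le len\<tau> len\<mu> by (intro T_sk) (auto simp: T_def a_def)
        moreover have "block_prod k (\<tau> @ \<mu>) = block_prod c \<tau> * P \<mu>"
        proof -
          have "block_prod k (\<tau> @ \<mu>) = block_prod (Suc c) (\<tau> @ \<mu>)"
            using len\<tau> len\<mu>[OF \<mu>] c by (intro block_prod_beyond) (auto simp: a_def)
          also have "\<dots> = block_prod c (\<tau> @ \<mu>) * P (block c (\<tau> @ \<mu>))"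
            by (simp add: block_prod_def P_def vs_def)
          also have "block c (\<tau> @ \<mu>) = \<mu>"
            using len\<tau> len\<mu>[OF \<mu>] c by (intro block_append_last) (auto simp: a_def)
          finally show ?thesis by (simp add: block_prod_append[OF len\<tau>])
        qed
        ultimately show "mac_psi q t lc \<mu> * X \<tau> * lookup (block_prod c \<tau> * P \<mu> * kernel_prod B n) d' =
            sk (\<tau> @ \<mu>) * lookup (block_prod k (\<tau> @ \<mu>) * kernel_prod B n) d'"
          by simp
      qed
      finally show "mac_psi q t lc \<mu> * lookup ((block_prod c lam * P \<mu> * kernel_prod B n) * (\<Prod>i<a. kernel_trunc q t B i n)) (d - single n (\<delta> \<mu>)) = \<dots>" .
    qed
    also have "\<dots> = (\<Sum>\<mu>\<in>{\<mu> \<in> M. \<delta> \<mu> \<le> e}. \<Sum>\<tau>\<in>block_strips c lam (nat (e - \<delta> \<mu>)).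
        sk (\<tau> @ \<mu>) * lookup (block_prod k (\<tau> @ \<mu>) * kernel_prod B n) d')"
      using finM by (rule sum.inter_filter[symmetric])
    also have "\<dots> = (\<Sum>(\<mu>, \<tau>)\<in>T. sk (\<tau> @ \<mu>) * lookup (block_prod k (\<tau> @ \<mu>) * kernel_prod B n) d')"
      unfolding T_def using finM by (intro sum.Sigma) (auto simp: finite_block_strips)
    also have "\<dots> = (\<Sum>\<sigma>\<in>S. sk \<sigma> * lookup (block_prod k \<sigma> * kernel_prod B n) d')"
    proof (rule sum.reindex_bij_witness[of _ "\<lambda>\<sigma>. (drop a \<sigma>, take a \<sigma>)" "\<lambda>(\<mu>, \<tau>). \<tau> @ \<mu>"])
      fix x assume x: "x \<in> T"
      then obtain \<mu> \<tau> where x_eq: "x = (\<mu>, \<tau>)" by (cases x) auto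
      have lens: "length \<tau> = a" "length \<mu> = n - a"
        using x len\<mu> by (auto simp: x_eq T_def block_strips_def a_def)
      show "(\<lambda>\<sigma>. (drop a \<sigma>, take a \<sigma>)) (case x of (\<mu>, \<tau>) \<Rightarrow> \<tau> @ \<mu>) = x"
        using lens by (simp add: x_eq)
      show "(case x of (\<mu>, \<tau>) \<Rightarrow> \<tau> @ \<mu>) \<in> S"
        using x T_iff[OF lens] by (simp add: x_eq)
    next
      fix \<sigma> assume \<sigma>: "\<sigma> \<in> S"
      then have "length (take a \<sigma>) = a" "length (drop a \<sigma>) = n - a" using c by (auto simp: S_def below_def)
      from T_iff[OF this] \<sigma> show "(drop a \<sigma>, take a \<sigma>) \<in> T" by simp
    qed (auto simp: case_prod_unfold)
    finally show ?thesis .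
  qed
  have "\<forall>\<^sub>F B in sequentially. \<forall>\<mu>\<in>M. e - \<delta> \<mu> \<le> int B"
  proof (intro eventually_ball_finite finM ballI)
    fix \<mu>
    show "\<forall>\<^sub>F B in sequentially. e - \<delta> \<mu> \<le> int B"
      by (rule eventually_sequentiallyI[of "nat (e - \<delta> \<mu>)"]) auto
  qed
  moreover have "\<forall>\<^sub>F B in sequentially. \<forall>\<sigma>\<in>S. lookup (block_prod k \<sigma> * kernel_prod B n) d' = limit_coeff n \<sigma> d'"
  proof (intro eventually_ball_finite ballI)
    fix \<sigma> assume "\<sigma> \<in> S"
    then have "length \<sigma> = n" "interlacing h (Suc n) (length \<sigma>) ((!) lam) ((!) \<sigma>)" by (auto simp: S_def below_def)
    then show "\<forall>\<^sub>F B in sequentially. lookup (block_prod k \<sigma> * kernel_prod B n) d' = limit_coeff n \<sigma> d'"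
      using Suc.prems by (intro Suc.IH interlacing_block_sorted) auto
  qed (simp add: S_def finite_below)
  ultimately show ?case
    by eventually_elim (simp add: expand S_def sk_def e_def d'_def)
qed

lemma prod_blocks:
  fixes g :: "nat \<Rightarrow> 'a :: comm_monoid_mult"
  shows "(\<Prod>c<m. \<Prod>i\<in>{s c..<s (Suc c)}. g i) = (\<Prod>i<s m. g i)"
proof (induction m)
  case (Suc m)
  have "(\<Prod>i<s (Suc m). g i) = (\<Prod>i\<in>{..<s m} \<union> {s m..<s (Suc m)}. g i)"
    using s_Suc[of m] by (simp add: ivl_disj_un)
  also have "\<dots> = (\<Prod>i<s m. g i) * (\<Prod>i\<in>{s m..<s (Suc m)}. g i)"
    by (rule prod.union_disjoint) auto
  finally show ?case by (simp add: Suc)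
qed simp

lemma h_in_block: "s c \<le> i \<Longrightarrow> i < s (Suc c) \<Longrightarrow> h i = L c"
  by (simp add: h_def block_ofI)

text \<open>
  The kernel with number \<open>c\<close> contains the pairs of a variable in block \<open>c\<close> and a later variable outside of it; the last block has no
  later variables.
\<close>

lemma kernel_prod_blocks:
  assumes "0 < k"
  shows "kernel_prod B N = (\<Prod>c<k - 1. \<Prod>j\<in>{s (Suc c)..<N}. \<Prod>i\<in>{s c..<s (Suc c)}. kernel_trunc q t B i j)"
proof -
  let ?K = "kernel_trunc q t B"
  have iff: "i < j \<and> h i \<noteq> h j \<longleftrightarrow> s (Suc (block_of i)) \<le> j" if "i < N" "j < N" for i j
  proof
    assume "s (Suc (block_of i)) \<le> j"
    then have "\<not> j < s (Suc (block_of i))" by simp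
    then have "block_of i \<noteq> block_of j" using block_of(2)[OF that(2)] by auto
    moreover have "i < j" using \<open>s (Suc (block_of i)) \<le> j\<close> block_of(2)[OF that(1)] by simp
    ultimately show "i < j \<and> h i \<noteq> h j" using h_eq_iff[OF that] by simp
  next
    assume *: "i < j \<and> h i \<noteq> h j"
    show "s (Suc (block_of i)) \<le> j"
    proof (rule ccontr)
      assume "\<not> s (Suc (block_of i)) \<le> j"
      then have "h i = h j" using * block_of[OF that(1)] by (intro h_same[of "block_of i"]) auto
      with * show False by simp
    qed
  qed
  have "kernel_prod B N = (\<Prod>j<N. \<Prod>i<N. if i < j \<and> h i \<noteq> h j then ?K i j else 1)"
    unfolding kernel_prod_def by (intro prod.cong refl prod.mono_neutral_cong_left) auto
  also have "\<dots> = (\<Prod>i<N. \<Prod>j<N. if i < j \<and> h i \<noteq> h j then ?K i j else 1)"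
    by (rule prod.swap)
  also have "\<dots> = (\<Prod>i<N. \<Prod>j\<in>{s (Suc (block_of i))..<N}. ?K i j)"
    by (intro prod.cong refl prod.mono_neutral_cong_right) (auto simp: iff)
  also have "\<dots> = (\<Prod>c<k. \<Prod>i\<in>{s c..<s (Suc c)}. \<Prod>j\<in>{s (Suc (block_of i))..<N}. ?K i j)"
    by (rule prod_blocks[symmetric])
  also have "\<dots> = (\<Prod>c<k. \<Prod>i\<in>{s c..<s (Suc c)}. \<Prod>j\<in>{s (Suc c)..<N}. ?K i j)"
    by (intro prod.cong refl) (auto simp: block_ofI)
  also have "\<dots> = (\<Prod>c<k. \<Prod>j\<in>{s (Suc c)..<N}. \<Prod>i\<in>{s c..<s (Suc c)}. ?K i j)"
    by (intro prod.cong refl prod.swap)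
  also have "{..<k} = insert (k - 1) {..<k - 1}"
    using assms by auto
  finally show ?thesis using assms by simp
qed

lemma monomial_denominator:
  "(\<Prod>c<k. \<Prod>j\<in>{s c..<s (Suc c)}. x_pow j (- (L c * int D))) = single (- shift_monomial D N) 1"
proof -
  have "(\<Prod>c<k. \<Prod>j\<in>{s c..<s (Suc c)}. x_pow j (- (L c * int D))) = (\<Prod>c<k. \<Prod>j\<in>{s c..<s (Suc c)}. x_pow j (- (h j * int D)))"
    by (intro prod.cong refl) (auto simp: h_in_block)
  also have "\<dots> = (\<Prod>j<N. x_pow j (- (h j * int D)))"
    by (rule prod_blocks)
  also have "\<dots> = single (- shift_monomial D N) 1"
    unfolding x_pow_def by (simp add: prod_single shift_monomial_def sum_negf single_uminus)
  finally show ?thesis .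
qed

lemma agree_kernels:
  assumes "0 < k"
  shows "agree_up_to N B (series_prod {..<k - 1} (\<lambda>c. cauchy_kernel q t
      (map (\<lambda>j. single j (- 1)) [s c..<s (Suc c)]) (map (\<lambda>j. single j 1) [s (Suc c)..<N]))) (kernel_prod B N)"
  unfolding kernel_prod_blocks[OF assms]
proof (rule agree_up_to_series_prod)
  fix c assume "c \<in> {..<k - 1}"
  then have "s (Suc c) \<le> N" by (intro s_mono) auto
  then show "agree_up_to N B (cauchy_kernel q t (map (\<lambda>j. single j (- 1)) [s c..<s (Suc c)]) (map (\<lambda>j. single j 1) [s (Suc c)..<N]))
      (\<Prod>j\<in>{s (Suc c)..<N}. \<Prod>i\<in>{s c..<s (Suc c)}. kernel_trunc q t B i j)"
    by (intro agree_cauchy_kernel q s_Suc) auto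
qed simp

text \<open>
  Both sides equal \<open>limit_coeff\<close>.
\<close>

theorem tendsto_kernel_expansion:
  assumes k: "0 < k" and lam: "length lam = N" "block_sorted lam"
  shows "(\<lambda>D. lookup (macdonald_P q t (shift D lam) [0..<N] * (\<Prod>c<k. \<Prod>j\<in>{s c..<s (Suc c)}. x_pow j (- (L c * int D)))) d)
    \<longlonglongrightarrow> series_mult (lookup (block_prod k lam)) (series_prod {..<k - 1} (\<lambda>c. cauchy_kernel q t
      (map (\<lambda>j. single j (- 1)) [s c..<s (Suc c)]) (map (\<lambda>j. single j 1) [s (Suc c)..<N]))) d"
proof -
  define F where "F = series_prod {..<k - 1} (\<lambda>c. cauchy_kernel q t
      (map (\<lambda>j. single j (- 1)) [s c..<s (Suc c)]) (map (\<lambda>j. single j 1) [s (Suc c)..<N]))"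
  have "\<forall>\<^sub>F B in sequentially. series_mult (lookup (block_prod k lam)) F d = lookup (block_prod k lam * kernel_prod B N) d"
    unfolding F_def by (rule eventually_series_mult_eq[OF agree_kernels[OF k]])
  moreover have "\<forall>\<^sub>F B in sequentially. lookup (block_prod k lam * kernel_prod B N) d = limit_coeff N lam d"
    using lam by (intro eventually_kernel_expansion) auto
  ultimately have "\<forall>\<^sub>F B :: nat in sequentially. series_mult (lookup (block_prod k lam)) F d = limit_coeff N lam d"
    by eventually_elim simp
  then have "series_mult (lookup (block_prod k lam)) F d = limit_coeff N lam d"
    by simp
  moreover have "(\<lambda>D. lookup (macdonald_P q t (shift D lam) [0..<N] * (\<Prod>c<k. \<Prod>j\<in>{s c..<s (Suc c)}. x_pow j (- (L c * int D)))) d)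
    \<longlonglongrightarrow> limit_coeff N lam d"
    unfolding monomial_denominator using tendsto_limit_coeff[OF order_refl lam(1), of d]
    by (subst mult.commute) (simp add: lookup_single_mult)
  ultimately show ?thesis by (simp add: F_def)
qed

lemma concat_blocks:
  assumes "\<And>c. c < k \<Longrightarrow> length (g c) = s (Suc c) - s c"
  shows "length (concat (map g [0..<k])) = N" and "c < k \<Longrightarrow> block c (concat (map g [0..<k])) = g c"
proof -
  have len: "length (concat (map g [0..<m])) = s m" if "m \<le> k" for m
    using that
  proof (induction m)
    case (Suc m)
    then show ?case using assms[of m] s_Suc[of m] by simp
  qed simp
  then show "length (concat (map g [0..<k])) = N" by simp
  show "block c (concat (map g [0..<k])) = g c" if "c < k"
  proof -
    have "[0..<k] = [0..<c] @ c # [Suc c..<k]"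
      using that upt_add_eq_append[of 0 c "k - c"] by (simp add: upt_conv_Cons)
    then have eq: "concat (map g [0..<k]) = concat (map g [0..<c]) @ g c @ concat (map g [Suc c..<k])"
      by simp
    show ?thesis
      unfolding eq block_def using len[of c] assms[OF that] that s_Suc[of c] by simp
  qed
qed

lemma nth_concat_blocks:
  assumes "\<And>c. c < k \<Longrightarrow> length (g c) = s (Suc c) - s c" "i < N"
  shows "concat (map g [0..<k]) ! i = g (block_of i) ! (i - s (block_of i))"
proof -
  define c where "c = block_of i"
  have c: "s c \<le> i" "i < s (Suc c)" "c < k" using block_of[OF assms(2)] by (auto simp: c_def)
  have "block c (concat (map g [0..<k])) = g c" using assms(1) c(3) by (rule concat_blocks(2))
  moreover have "block c (concat (map g [0..<k])) ! (i - s c) = concat (map g [0..<k]) ! (s c + (i - s c))"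
    using calculation assms(1)[OF c(3)] c by (intro nth_block) simp
  ultimately show ?thesis using c by (simp add: c_def)
qed

end

text \<open>
  It remains to read the concatenation of the given signatures as one list of parts that is divided into blocks.
\<close>

theorem theorem1p5:
  fixes q t :: real
    and k N :: nat
    and r s :: "nat \<Rightarrow> nat"
    and L :: "nat \<Rightarrow> int"
    and lam :: "nat \<Rightarrow> int list"
    and d :: monomial
  assumes "-1 < q" "q < 1" "-1 < t" "t < 1"
    and "0 < k" "0 < N"
    and "\<And>i. i < k \<Longrightarrow> 0 < r i"
    and "(\<Sum>i<k. r i) = N"
    and "\<And>i. s i = (\<Sum>j<i. r j)"
    and "\<And>i j. i < j \<Longrightarrow> j < k \<Longrightarrow> L i > L j"
    and "\<And>i. i < k \<Longrightarrow> lam i \<in> Sig (r i)"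
    and "Poly_Mapping.keys d \<subseteq> {..<N}"
  shows "(\<lambda>D. Poly_Mapping.lookup
            (macdonald_P q t (concat (map (\<lambda>i. map (\<lambda>p. L i * int D + p) (lam i)) [0..<k])) [0..<N] *
             (\<Prod>i<k. \<Prod>j\<in>{s i..<s (Suc i)}. x_pow j (- (L i * int D)))) d)
         \<longlonglongrightarrow>
         series_mult
           (Poly_Mapping.lookup (\<Prod>i<k. macdonald_P q t (lam i) [s i..<s (Suc i)]))
           (series_prod {..<k - 1} (\<lambda>i.
              cauchy_kernel q t
                (map (\<lambda>j. Poly_Mapping.single j (- 1)) [s i..<s (Suc i)])
                (map (\<lambda>j. Poly_Mapping.single j 1) [s (Suc i)..<N]))) d"
proof -
  interpret blocks k s L q t
    by standard (use assms(1-4,9,10) in auto)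
  have N: "s k = N" using assms(8,9) by simp
  have len: "length (lam c) = s (Suc c) - s c" if "c < k" for c
    using assms(11)[OF that] assms(9) by (simp add: Sig_def)
  define mu where "mu = concat (map lam [0..<k])"
  have len_mu: "length mu = s k"
    unfolding mu_def by (rule concat_blocks(1)[OF len])
  have nth_mu: "mu ! i = lam (block_of i) ! (i - s (block_of i))" if "i < s k" for i
    unfolding mu_def by (rule nth_concat_blocks[OF len that])
  have "block_sorted mu"
    unfolding block_sorted_def len_mu
  proof (intro allI impI)
    fix i assume i: "Suc i < s k \<and> h i = h (Suc i)"
    define c where "c = block_of i"
    have c: "s c \<le> i" "Suc i < s (Suc c)" "c < k" "block_of (Suc i) = c"
      using block_of[of i] block_of[of "Suc i"] h_eq_iff[of i "Suc i"] i by (auto simp: c_def)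
    have "lam c ! (Suc i - s c) \<le> lam c ! (i - s c)"
      using Sig_nth[OF assms(11)[OF c(3)], of "i - s c" "Suc i - s c"] c assms(9) by simp
    then show "mu ! Suc i \<le> mu ! i"
      using nth_mu[of i] nth_mu[of "Suc i"] i c by (simp add: c_def)
  qed
  note main = tendsto_kernel_expansion[OF assms(5) len_mu this, of d]
  have "concat (map (\<lambda>i. map (\<lambda>p. L i * int D + p) (lam i)) [0..<k]) = shift D mu" for D
  proof (rule nth_equalityI)
    have len': "length (map (\<lambda>p. L c * int D + p) (lam c)) = s (Suc c) - s c" if "c < k" for c
      using len[OF that] by simp
    show length: "length (concat (map (\<lambda>i. map (\<lambda>p. L i * int D + p) (lam i)) [0..<k])) = length (shift D mu)"
      using concat_blocks(1)[OF len'] len_mu by simp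
    fix i assume "i < length (concat (map (\<lambda>i. map (\<lambda>p. L i * int D + p) (lam i)) [0..<k]))"
    then have i: "i < s k" using concat_blocks(1)[OF len'] by simp
    then have "i - s (block_of i) < length (lam (block_of i))"
      using block_of[OF i] len by simp
    then show "concat (map (\<lambda>i. map (\<lambda>p. L i * int D + p) (lam i)) [0..<k]) ! i = shift D mu ! i"
      using nth_concat_blocks[OF len' i] nth_mu[OF i] len_mu i by (simp add: nth_shift h_def)
  qed
  moreover have "block_prod k mu = (\<Prod>i<k. macdonald_P q t (lam i) [s i..<s (Suc i)])"
    unfolding block_prod_def
    by (intro prod.cong refl) (simp add: block_variables mu_def concat_blocks(2)[OF len])
  ultimately show ?thesis
    using main by (simp add: N)
qed

end
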